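(* Fix integers $L\ge 2$ and widths $n_0,n_1,\dots,n_L\in\mathbb{N}_{>0}$, activation functions $\varphi_1,\dots,\varphi_L:\mathbb{R}\to\mathbb{R}$ with $\varphi_1(t)=t$ and $\varphi_2,\dots,\varphi_L$ Lipschitz, fixed variances $\sigma_{W^{(l)}}^2,\sigma_{b^{(l)}}^2>0$ for $l=1,\dots,L-1$, a training input set $\mathbf{x}=(\mathbf{x}_1,\dots,\mathbf{x}_k)\in\mathbb{R}^{n_0\times k}$ and training outputs $\mathbf{y}_{\mathcal D}\in\mathbb{R}^{n_L\times k}$. Let $\sigma^2\sim\mathrm{Inv\text{-}Gamma}(a,b)$ be a common random variance for the last layer and the likelihood (as described in the context), and assume that the matrix $\mathbf{K}'(\mathbf{x})$ is positive definite and that $$a>\tfrac12,\qquad b>\Big(1+\frac{\epsilon+2}{2\epsilon+2}\Big)\|\mathbf{y}_{\mathcal D}\|_F^2\quad\text{for some }\epsilon\text{ with }0<\epsilon<1/\|\mathbf{K}'(\mathbf{x})\|_{\mathrm{op}}.$$ Then there exists a constant $c>0$, independent of $n_1,\dots,n_{L-1}$, such that $$\mathcal W_1\big(f_{\boldsymbol\theta}(\mathbf{x})\,|\,\mathcal D,\; G(\mathbf{x})\,|\,\mathcal D\big)\le \frac{c}{\sqrt{n_{\min}}},\qquad n_{\min}:=\min_{l=1,\dots,L-1}n_l,$$ where $f_{\boldsymbol\theta}(\mathbf{x})\,|\,\mathcal D$ and $G(\mathbf{x})\,|\,\mathcal D$ are the posterior laws defined in the context.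
   Context: Network: $f^{(0)}(\mathbf{x}_0)=\mathbf{x}_0$ and $f^{(l)}(\mathbf{x}_0)=\mathbf{W}^{(l)}\varphi_l(f^{(l-1)}(\mathbf{x}_0))+\mathbf{b}^{(l)}$ for $l=1,\dots,L$ ($\varphi_l$ applied componentwise), with $\mathbf{W}^{(l)}\in\mathbb{R}^{n_l\times n_{l-1}}$, $\mathbf{b}^{(l)}\in\mathbb{R}^{n_l}$; $f_{\boldsymbol\theta}(\mathbf{x}):=(f^{(L)}(\mathbf{x}_1),\dots,f^{(L)}(\mathbf{x}_k))\in\mathbb{R}^{n_L\times k}$. Prior (given the last-layer variance $\sigma^2=s$): all entries independent, entries of $\mathbf{W}^{(l)}$ are $\mathcal N(0,\sigma_{W^{(l)}}^2/n_{l-1})$ and of $\mathbf{b}^{(l)}$ are $\mathcal N(0,\sigma_{b^{(l)}}^2)$, where $\sigma_{W^{(L)}}^2=\sigma_{b^{(L)}}^2=s$. $\sigma^2$ has the Inverse-Gamma density $p_{\sigma^2}(s)=\frac{b^a}{\Gamma(a)}s^{-a-1}e^{-b/s}$, $s>0$ ($a,b>0$). NNGP kernels: $K^{(1)}(\mathbf{x}_0,\mathbf{x}_0')=\sigma_{W^{(1)}}^2\mathbf{x}_0^T\mathbf{x}_0'/n_0+\sigma_{b^{(1)}}^2$; for $2\le l\le L-1$, $K^{(l)}(\mathbf{x}_i,\mathbf{x}_j)=\sigma_{W^{(l)}}^2\mathbb E[\varphi_l(Z_i)\varphi_l(Z_j)]+\sigma_{b^{(l)}}^2$ with $(Z_1,\dots,Z_k)\sim\mathcal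 N(0,K^{(l-1)}(\mathbf{x}))$, $K^{(l)}(\mathbf{x}):=(K^{(l)}(\mathbf{x}_i,\mathbf{x}_j))_{i,j\in[k]}$. The rescaled kernel $\mathbf{K}'(\mathbf{x})\in\mathbb{R}^{k\times k}$ has entries $\mathbb E[\varphi_L(Z_i)\varphi_L(Z_j)]+1$ with $(Z_1,\dots,Z_k)\sim\mathcal N(0,K^{(L-1)}(\mathbf{x}))$. Given $\sigma^2=s$, $G(\mathbf{x})$ is the random $n_L\times k$ matrix whose rows are i.i.d. $\mathcal N(0,s\,\mathbf{K}'(\mathbf{x}))$. Likelihood: $\mathcal L(\mathbf{z},s)=(2\pi s)^{-n_Lk/2}\exp(-\|\mathbf{y}_{\mathcal D}-\mathbf{z}\|_F^2/(2s))$ for $\mathbf{z}\in\mathbb{R}^{n_L\times k}$. Let $\mu_s$ and $\tilde\mu_s$ be the laws of $G(\mathbf{x})$ and $f_{\boldsymbol\theta}(\mathbf{x})$ given $\sigma^2=s$. The posterior laws are, for Borel $A\subseteq\mathbb{R}^{n_L\times k}$, $\mathbb P_{G(\mathbf{x})|\mathcal D}(A)=\frac1I\int_0^\infty\int_A\mathcal L(\mathbf{z},s)\mu_s(d\mathbf{z})p_{\sigma^2}(s)ds$ and $\mathbb P_{f_{\boldsymbol\theta}(\mathbf{x})|\mathcal D}(A)=\frac1{\tilde I}\int_0^\infty\int_A\mathcal L(\mathbf{z},s)\tilde\mu_s(d\mathbf{z})p_{\sigma^2}(s)ds$, with $I,\tilde I$ the normalizing constants. $\mathcal W_1(\mu,\nu)=\inf\mathbb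 E\|\mathbf{X}-\mathbf{Y}\|_F$ over couplings $(\mathbf{X},\mathbf{Y})$ with laws $\mu,\nu$. $\|\cdot\|_F$ is the Frobenius norm and $\|\cdot\|_{\mathrm{op}}$ the operator norm (largest eigenvalue). *)

theory Defs
  imports "HOL-Probability.Probability"
begin

text \<open>Neurons: layer 0 neurons are indexed by the finite type 'n0 (n_0 = CARD('n0)),
  hidden layers 1..L-1 by naturals below n l, output layer L by the finite type 'nL.\<close>
datatype ('n0, 'nL) neuron = Inp 'n0 | Hid nat | Out 'nL

datatype ('n0, 'nL) param =
  Wt nat "('n0, 'nL) neuron" "('n0, 'nL) neuron"   \<comment> \<open>Wt l i j = entry (i,j) of W^(l)\<close>
| Bs nat "('n0, 'nL) neuron"                        \<comment> \<open>Bs l i = entry i of b^(l)\<close>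

definition units :: "(nat \<Rightarrow> nat) \<Rightarrow> nat \<Rightarrow> nat \<Rightarrow> ('n0, 'nL) neuron set" where
  "units n L l = (if l = 0 then range Inp
                  else if l < L then Hid ` {..<n l}
                  else if l = L then range Out else {})"

definition params :: "(nat \<Rightarrow> nat) \<Rightarrow> nat \<Rightarrow> ('n0, 'nL) param set" where
  "params n L =
     {Wt l i j | l i j. l \<in> {1..L} \<and> i \<in> units n L l \<and> j \<in> units n L (l - 1)}
   \<union> {Bs l i | l i. l \<in> {1..L} \<and> i \<in> units n L l}"

text \<open>Prior variance of each parameter given sigma^2 = s
  (sigmaW l, sigmab l denote the variances sigma_{W^(l)}^2, sigma_{b^(l)}^2 for l < L).\<close>
fun pvar :: "(nat \<Rightarrow> real) \<Rightarrow> (nat \<Rightarrow> real) \<Rightarrow> (nat \<Rightarrow> nat) \<Rightarrow> nat \<Rightarrow> real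
             \<Rightarrow> ('n0::finite, 'nL::finite) param \<Rightarrow> real" where
  "pvar sW sb n L s (Wt l i j) =
     (if l = L then s else sW l) / real (card (units n L (l - 1) :: ('n0, 'nL) neuron set))"
| "pvar sW sb n L s (Bs l i) = (if l = L then s else sb l)"

definition prior :: "(nat \<Rightarrow> real) \<Rightarrow> (nat \<Rightarrow> real) \<Rightarrow> (nat \<Rightarrow> nat) \<Rightarrow> nat \<Rightarrow> real
                     \<Rightarrow> (('n0::finite, 'nL::finite) param \<Rightarrow> real) measure" where
  "prior sW sb n L s =
     PiM (params n L) (\<lambda>p. density lborel (normal_density 0 (sqrt (pvar sW sb n L s p))))"

primrec fwd :: "(nat \<Rightarrow> real \<Rightarrow> real) \<Rightarrow> (nat \<Rightarrow> nat) \<Rightarrow> nat \<Rightarrow> (('n0::finite, 'nL) param \<Rightarrow> real)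
                \<Rightarrow> real^'n0 \<Rightarrow> nat \<Rightarrow> ('n0, 'nL) neuron \<Rightarrow> real" where
  "fwd \<phi> n L \<theta> xc 0 = (\<lambda>u. case u of Inp a \<Rightarrow> xc $ a | _ \<Rightarrow> 0)"
| "fwd \<phi> n L \<theta> xc (Suc l) =
     (\<lambda>i. (\<Sum>j\<in>units n L l. \<theta> (Wt (Suc l) i j) * \<phi> (Suc l) (fwd \<phi> n L \<theta> xc l j))
          + \<theta> (Bs (Suc l) i))"

definition net_out :: "(nat \<Rightarrow> real \<Rightarrow> real) \<Rightarrow> (nat \<Rightarrow> nat) \<Rightarrow> nat
     \<Rightarrow> real^'k^'n0 \<Rightarrow> (('n0::finite, 'nL::finite) param \<Rightarrow> real) \<Rightarrow> real^'k^'nL" where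
  "net_out \<phi> n L x \<theta> = (\<chi> i c. fwd \<phi> n L \<theta> (column c x) L (Out i))"

definition net_law :: "(nat \<Rightarrow> real \<Rightarrow> real) \<Rightarrow> (nat \<Rightarrow> real) \<Rightarrow> (nat \<Rightarrow> real) \<Rightarrow> (nat \<Rightarrow> nat)
     \<Rightarrow> nat \<Rightarrow> real^'k^'n0 \<Rightarrow> real \<Rightarrow> (real^'k^'nL::finite) measure" where
  "net_law \<phi> sW sb n L x s =
     distr (prior sW sb n L s :: (('n0, 'nL) param \<Rightarrow> real) measure) borel (net_out \<phi> n L x)"

definition std_normal_vec :: "(real^'k::finite) measure" where
  "std_normal_vec = distr (PiM UNIV (\<lambda>_::'k. density lborel std_normal_density)) borel vec_lambda"

text \<open>N(0, Sigma) as the law of A xi with A A^T = Sigma and xi standard normal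
  (Sigma positive semidefinite; the law does not depend on the choice of A).\<close>
definition gauss_vec :: "real^'k^'k \<Rightarrow> (real^'k::finite) measure" where
  "gauss_vec \<Sigma> = distr std_normal_vec borel (\<lambda>\<xi>. (SOME A :: real^'k^'k. A ** transpose A = \<Sigma>) *v \<xi>)"

definition gexp :: "real^'k^'k \<Rightarrow> (real \<Rightarrow> real) \<Rightarrow> 'k::finite \<Rightarrow> 'k \<Rightarrow> real" where
  "gexp \<Sigma> f i j = (\<integral>Z. f (Z $ i) * f (Z $ j) \<partial>gauss_vec \<Sigma>)"

text \<open>nngp ... l = K^(l)(x), for 1 <= l <= L-1.\<close>
fun nngp :: "(nat \<Rightarrow> real \<Rightarrow> real) \<Rightarrow> (nat \<Rightarrow> real) \<Rightarrow> (nat \<Rightarrow> real) \<Rightarrow> real^'k^'n0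
             \<Rightarrow> nat \<Rightarrow> real^'k^'k" where
  "nngp \<phi> sW sb x 0 = 0"
| "nngp \<phi> sW sb x (Suc 0) =
     (\<chi> i j. sW 1 * (column i x \<bullet> column j x) / real CARD('n0::finite) + sb 1)"
| "nngp \<phi> sW sb x (Suc (Suc l)) =
     (\<chi> i j. sW (Suc (Suc l)) * gexp (nngp \<phi> sW sb x (Suc l)) (\<phi> (Suc (Suc l))) i j
             + sb (Suc (Suc l)))"

definition Kprime :: "(nat \<Rightarrow> real \<Rightarrow> real) \<Rightarrow> (nat \<Rightarrow> real) \<Rightarrow> (nat \<Rightarrow> real) \<Rightarrow> nat
                      \<Rightarrow> real^'k^'n0::finite \<Rightarrow> real^'k^'k::finite" where
  "Kprime \<phi> sW sb L x = (\<chi> i j. gexp (nngp \<phi> sW sb x (L - 1)) (\<phi> L) i j + 1)"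

definition gp_law :: "real^'k^'k \<Rightarrow> real \<Rightarrow> (real^'k::finite^'nL::finite) measure" where
  "gp_law K s = distr (PiM UNIV (\<lambda>_::'nL. gauss_vec (s *\<^sub>R K))) borel vec_lambda"

definition pos_def :: "real^'k^'k::finite \<Rightarrow> bool" where
  "pos_def K \<longleftrightarrow> transpose K = K \<and> (\<forall>v. v \<noteq> 0 \<longrightarrow> v \<bullet> (K *v v) > 0)"

definition invgamma_density :: "real \<Rightarrow> real \<Rightarrow> real \<Rightarrow> real" where
  "invgamma_density a b s = (if s > 0 then b powr a / Gamma a * s powr (- a - 1) * exp (- b / s) else 0)"

definition likelihood :: "real^'k^'nL \<Rightarrow> real^'k::finite^'nL::finite \<Rightarrow> real \<Rightarrow> real" where
  "likelihood y z s = (2 * pi * s) powr (- real (CARD('nL) * CARD('k)) / 2)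
                      * exp (- (norm (y - z))\<^sup>2 / (2 * s))"

definition post_unnorm :: "real \<Rightarrow> real \<Rightarrow> real^'k^'nL \<Rightarrow> (real \<Rightarrow> (real^'k::finite^'nL::finite) measure)
                           \<Rightarrow> (real^'k^'nL) set \<Rightarrow> ennreal" where
  "post_unnorm a b y \<mu> A =
     (\<integral>\<^sup>+ s. indicator {0<..} s * ennreal (invgamma_density a b s)
              * (\<integral>\<^sup>+ z. indicator A z * ennreal (likelihood y z s) \<partial>\<mu> s) \<partial>lborel)"

definition posterior :: "real \<Rightarrow> real \<Rightarrow> real^'k^'nL \<Rightarrow> (real \<Rightarrow> (real^'k::finite^'nL::finite) measure)
                         \<Rightarrow> (real^'k^'nL) measure" where
  "posterior a b y \<mu> = measure_of UNIV (sets borel)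
     (\<lambda>A. post_unnorm a b y \<mu> A / post_unnorm a b y \<mu> UNIV)"

section \<open>Wasserstein-1 distance (Frobenius norm = norm on real^'k^'nL)\<close>

definition couplings :: "'a measure \<Rightarrow> 'a measure \<Rightarrow> ('a \<times> 'a) measure set" where
  "couplings \<mu> \<nu> = {\<gamma>. prob_space \<gamma> \<and> sets \<gamma> = sets (\<mu> \<Otimes>\<^sub>M \<nu>)
                        \<and> distr \<gamma> \<mu> fst = \<mu> \<and> distr \<gamma> \<nu> snd = \<nu>}"

definition W1 :: "('a::real_normed_vector) measure \<Rightarrow> 'a measure \<Rightarrow> ennreal" where
  "W1 \<mu> \<nu> = (INF \<gamma> \<in> couplings \<mu> \<nu>. \<integral>\<^sup>+ p. ennreal (norm (fst p - snd p)) \<partial>\<gamma>)"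

end

theory Submission
  imports Defs
begin

text \<open>Conditionally on the hidden layers, the output matrix is Gaussian with rows of covariance
  \<open>s K\<close>, where \<open>K\<close> is the empirical kernel of the last layer. By induction over the
  layers \<open>E |K - K'| = O(1 / sqrt n_min)\<close>: the fluctuation within a layer is a law of large numbers,
  and the bias is controlled because \<open>E \<phi>(Z_i) \<phi>(Z_j)\<close> is Lipschitz at the limit covariance as
  soon as its diagonal is positive, which the bias variances guarantee even if the covariance is
  singular. With Cholesky factors both prior laws are images \<open>sqrt s A(K) \<xi>\<close> and
  \<open>sqrt s A(K') \<xi>\<close> of the same standard Gaussian \<open>\<xi>\<close>. Since \<open>K'\<close> is positive definite,
  \<open>A\<close> is differentiable there, hence the images are close on average.
  The posteriors reweight the joint law of \<open>s\<close>, the hidden layers and \<open>\<xi>\<close> by two densities; couple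
  them by the identity on the common part of the densities and independently on the rest.\<close>

section \<open>Gaussian laws on Euclidean spaces\<close>

text \<open>The coupling of the posteriors dictates the shape of the estimates. Where the two
  densities differ, points are moved over a distance comparable to their norms, and the densities
  differ by about the distance between the two images; the cost is therefore the expectation of
  \<open>norm (X - X') * (1 + norm X + norm X')\<close>, which is quadratic in the factors. To bound
  it by the first moment of the kernel error alone, the calmness of the Cholesky factor at the limit
  kernel carries the same weight: near that kernel it is differentiability, far from it the squared
  norm of the factor is the trace and grows only linearly. Hence no moment of the kernel error
  beyond the first is propagated through the layers, and no event of nearly singular empirical
  kernels has to be excluded. Constants that depend on a kernel are taken only at the limit kernels,
  which do not involve the widths. Since Gaussian laws may be degenerate here, they are identified
  through characteristic functions and not through densities.\<close>

lemma real_measure_eqI_char: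
  fixes M N :: "real measure"
  assumes "finite_measure M" "finite_measure N" "sets M = sets borel" "sets N = sets borel"
    and eq: "\<And>t. (CLINT x|M. iexp (t * x)) = (CLINT x|N. iexp (t * x))"
  shows "M = N"
proof -
  interpret M: finite_measure M by fact
  interpret N: finite_measure N by fact
  have sp: "space M = UNIV" "space N = UNIV"
    using assms(3,4) by (auto dest: sets_eq_imp_space_eq)
  \<comment> \<open>The transform at 0 is the total mass, so both measures can be normalised by the
    same number before the uniqueness theorem for distributions is applied; mass zero is the
    exception.\<close>
  have mass: "measure M UNIV = measure N UNIV"
    using eq[of 0] sp by simp
  show ?thesis
  proof (cases "measure M UNIV = 0")
    case True
    then have "emeasure M A = 0" "emeasure N A = 0" for A
      using mass emeasure_space[of M A] emeasure_space[of N A] sp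
      by (auto simp: M.emeasure_eq_measure N.emeasure_eq_measure)
    then show ?thesis using assms by (intro measure_eqI) auto
  next
    case False
    define m where "m = measure M UNIV"
    have m: "m > 0" using False by (simp add: m_def zero_less_measure_iff)
    have mN: "measure N UNIV = m" using mass by (simp add: m_def)
    let ?s = "\<lambda>M. density M (\<lambda>_::real. ennreal (1/m))"
    have em: "emeasure (?s K) A = ennreal (1/m) * emeasure K A" if "A \<in> sets K" for K A
      using that by (simp add: emeasure_density_const)
    have "UNIV \<in> sets M" "UNIV \<in> sets N" using assms(3,4) by auto
    then have "emeasure (?s M) (space (?s M)) = 1" "emeasure (?s N) (space (?s N)) = 1"
      using m mN m_def[symmetric] sp by (simp_all add: em M.emeasure_eq_measure N.emeasure_eq_measure flip: ennreal_mult)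
    then have rd: "real_distribution (?s M)" "real_distribution (?s N)"
      using assms by (auto simp: real_distribution_def real_distribution_axioms_def intro: prob_spaceI)
    have ch: "char (?s K) t = complex_of_real (1/m) * (CLINT x|K. iexp (t * x))"
      if "sets K = sets borel" for K t
    proof -
      have "char (?s K) t = (CLINT x|K. (1/m) *\<^sub>R iexp (t * x))"
        unfolding char_def using m that
        by (subst integral_density) (auto simp: measurable_cong_sets[OF that refl])
      then show ?thesis by (simp add: scaleR_conv_of_real)
    qed
    have "?s M = ?s N"
      by (rule Levy_uniqueness[OF rd]) (simp add: fun_eq_iff ch assms(3,4) eq del: of_real_mult)
    then have "emeasure (?s M) A = emeasure (?s N) A" for A by simp
    then have "ennreal (1/m) * emeasure M A = ennreal (1/m) * emeasure N A" if "A \<in> sets borel" for A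
      using that assms em by metis
    then have "emeasure M A = emeasure N A" if "A \<in> sets borel" for A
      using that m by (auto simp: ennreal_mult_cancel_left ennreal_eq_0_iff)
    then show ?thesis using assms by (intro measure_eqI) auto
  qed
qed

text \<open>A bounded weight \<open>g\<close> turns the law of the coordinate
  \<open>x \<bullet> b\<close> into a finite measure on the line whose characteristic function is
  the assumed integral. Conditions on the other coordinates can be hidden in \<open>g\<close>, which
  reduces the problem to dimension one.\<close>

lemma weighted_distr_eqI:
  fixes M N :: "'a::euclidean_space measure" and g :: "'a \<Rightarrow> real"
  assumes "prob_space M" "prob_space N" "sets M = sets borel" "sets N = sets borel"
    and [measurable]: "g \<in> borel_measurable borel" and g: "\<And>x. 0 \<le> g x" "\<And>x. g x \<le> B"
    and A: "A \<in> sets borel"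
    and eq: "\<And>s. (CLINT x|M. g x * iexp (s * (x \<bullet> b))) = (CLINT x|N. g x * iexp (s * (x \<bullet> b)))"
  shows "(LINT x|M. g x * indicator A (x \<bullet> b)) = (LINT x|N. g x * indicator A (x \<bullet> b))"
proof -
  interpret M: prob_space M by fact
  interpret N: prob_space N by fact
  note [measurable_cong] = assms(3,4)
  have fin: "finite_measure (distr (density K g) borel (\<lambda>x. x \<bullet> b))"
    if "prob_space K" "sets K = sets borel" for K
  proof -
    interpret prob_space K by fact
    note [measurable_cong] = that(2)
    have "integrable K g" using g by (intro integrable_const_bound[of _ B]) auto
    then have "(\<integral>\<^sup>+x. g x \<partial>K) < \<infinity>"
      using g by (simp add: integrable_iff_bounded)
    then have "finite_measure (density K g)"
      by (intro finite_measureI) (simp add: emeasure_density cong: nn_integral_cong)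
    then show ?thesis by (rule finite_measure.finite_measure_distr) simp
  qed
  have "distr (density M g) borel (\<lambda>x. x \<bullet> b) = distr (density N g) borel (\<lambda>x. x \<bullet> b)"
  proof (rule real_measure_eqI_char)
    fix t
    have "(CLINT x|distr (density K g) borel (\<lambda>x. x \<bullet> b). iexp (t * x)) = (CLINT x|K. g x * iexp (t * (x \<bullet> b)))"
      if "sets K = sets borel" for K :: "'a measure"
    proof -
      note [measurable_cong] = that
      show ?thesis using g
        by (subst integral_distr; simp?) (subst integral_density; simp add: scaleR_conv_of_real)
    qed
    then show "(CLINT x|distr (density M g) borel (\<lambda>x. x \<bullet> b). iexp (t * x))
        = (CLINT x|distr (density N g) borel (\<lambda>x. x \<bullet> b). iexp (t * x))"
      using eq[of t] assms(3,4) by simp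
  qed (use fin assms in auto)
  then have "(LINT z|distr (density M g) borel (\<lambda>x. x \<bullet> b). indicator A z :: real)
     = (LINT z|distr (density N g) borel (\<lambda>x. x \<bullet> b). indicator A z)" by simp
  then show ?thesis using A g
    by (subst (asm) (1 2) integral_distr; simp?) (subst (asm) (1 2) integral_density; simp)
qed

text \<open>The indicator constraints are introduced one coordinate at a time; the weights
  \<open>1 + cos\<close> and \<open>1 + sin\<close> keep the one-dimensional measures involved positive, so that
  the one-dimensional uniqueness theorem applies.\<close>
lemma char_eq_imp_rectangle_char_eq:
  fixes M N :: "'a::euclidean_space measure"
  assumes "prob_space M" "prob_space N" "sets M = sets borel" "sets N = sets borel"
    and eq: "\<And>t. (CLINT x|M. iexp (t \<bullet> x)) = (CLINT x|N. iexp (t \<bullet> x))"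
    and S: "finite S" and A: "\<And>b. A b \<in> sets borel"
  shows "(CLINT x|M. complex_of_real (\<Prod>b\<in>S. indicator (A b) (x \<bullet> b)) * iexp (t \<bullet> x))
       = (CLINT x|N. complex_of_real (\<Prod>b\<in>S. indicator (A b) (x \<bullet> b)) * iexp (t \<bullet> x))"
  using S
proof (induction S arbitrary: t)
  case empty
  then show ?case using eq by simp
next
  case (insert b S)
  note [measurable_cong] = assms(3,4)
  note [measurable] = A
  define h :: "'a \<Rightarrow> real" where "h x = (\<Prod>b\<in>S. indicator (A b) (x \<bullet> b))" for x
  have [measurable]: "h \<in> borel_measurable borel" unfolding h_def by measurable
  have h01: "0 \<le> h x" "h x \<le> 1" for x
    unfolding h_def by (auto intro!: prod_nonneg prod_le_1 split: split_indicator)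
  have IH: "(CLINT x|M. h x * iexp (t \<bullet> x)) = (CLINT x|N. h x * iexp (t \<bullet> x))" for t
    using insert.IH[of t] unfolding h_def by simp
  have bnd: "integrable K f" if "prob_space K" "sets K = sets borel" "f \<in> borel_measurable borel" "\<And>x. norm (f x) \<le> 2"
    for K and f :: "'a \<Rightarrow> 'b::{banach,second_countable_topology}"
  proof -
    interpret prob_space K by fact
    show ?thesis using that by (intro integrable_const_bound[of _ 2]) (auto simp: measurable_cong_sets[OF that(2) refl])
  qed
  have int: "integrable K (\<lambda>x. h x * iexp (u \<bullet> x))" if "prob_space K" "sets K = sets borel" for K u
    using that h01 order_trans[OF h01(2), of 2] by (intro bnd) (auto simp: norm_mult abs_of_nonneg)
  let ?I = "\<lambda>x. indicator (A b) (x \<bullet> b) :: real"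
  \<comment> \<open>\<open>v\<close> stands for \<open>cos\<close> or \<open>sin\<close> of
    \<open>t \<bullet> x\<close>, or for 0. Multiplying by it shifts the frequency by
    \<open>t\<close> or \<open>- t\<close>, and the induction hypothesis is available at every
    frequency; the bound on \<open>v\<close> keeps the weight nonnegative.\<close>
  have w: "(LINT x|M. h x * (1 + v x) * ?I x) = (LINT x|N. h x * (1 + v x) * ?I x)"
    if v: "\<And>x. complex_of_real (v x) = c1 * iexp (t \<bullet> x) + c2 * iexp ((-t) \<bullet> x)" "\<And>x. \<bar>v x\<bar> \<le> 1"
      and [measurable]: "v \<in> borel_measurable borel" for v c1 c2 
  proof (rule weighted_distr_eqI[where B=2, OF assms(1-4)])
    show "0 \<le> h x * (1 + v x)" for x using h01[of x] v(2)[of x] by (simp add: abs_le_iff)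
    show "h x * (1 + v x) \<le> 2" for x using mult_mono[of "h x" 1 "1 + v x" 2] h01[of x] v(2)[of x] by (simp add: abs_le_iff)
    fix s
    have "(CLINT x|K. complex_of_real (h x * (1 + v x)) * iexp (s * (x \<bullet> b)))
      = (CLINT x|K. h x * iexp ((s *\<^sub>R b) \<bullet> x)) + (c1 * (CLINT x|K. h x * iexp ((s *\<^sub>R b + t) \<bullet> x))
         + c2 * (CLINT x|K. h x * iexp ((s *\<^sub>R b - t) \<bullet> x)))" if K: "prob_space K" "sets K = sets borel" for K
    proof -
      have "complex_of_real (h x * (1 + v x)) * iexp (s * (x \<bullet> b)) = h x * iexp ((s *\<^sub>R b) \<bullet> x)
         + (c1 * (h x * iexp ((s *\<^sub>R b + t) \<bullet> x)) + c2 * (h x * iexp ((s *\<^sub>R b - t) \<bullet> x)))" for x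
        by (simp add: v(1) algebra_simps inner_simps exp_add[symmetric] exp_diff inner_commute[of b x] mult_exp_exp
             divide_inverse exp_minus)
      then show ?thesis using int[OF K, of "s *\<^sub>R b"] int[OF K, of "s *\<^sub>R b + t"] int[OF K, of "s *\<^sub>R b - t"]
        by (simp del: of_real_mult inner_scaleR_left)
    qed
    then show "(CLINT x|M. complex_of_real (h x * (1 + v x)) * iexp (s * (x \<bullet> b)))
         = (CLINT x|N. complex_of_real (h x * (1 + v x)) * iexp (s * (x \<bullet> b)))"
      by (simp only: assms(1-4) IH)
  qed (use A in auto)
  have i: "integrable K (\<lambda>x. h x * v x * ?I x)" if "prob_space K" "sets K = sets borel"
    "v \<in> borel_measurable borel" "\<And>x. \<bar>v x\<bar> \<le> 1" for K v
  proof (rule bnd[OF that(1,2)])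
    have "\<bar>h x\<bar> * \<bar>v x\<bar> * \<bar>?I x\<bar> \<le> 1 * 1 * 1" for x
      by (intro mult_mono) (use h01[of x] that(4)[of x] in \<open>auto split: split_indicator\<close>)
    then show "norm (h x * v x * ?I x) \<le> 2" for x by (simp add: abs_mult order_trans[of _ 1 2])
  qed (use that A in measurable)
  \<comment> \<open>The choice \<open>v = 0\<close> isolates the constant part of the weight, which
    is then subtracted to leave \<open>v\<close> alone.\<close>
  have one: "(LINT x|M. h x * 1 * ?I x) = (LINT x|N. h x * 1 * ?I x)"
    using w[of "\<lambda>_. 0" 0 0] by simp
  have w': "(LINT x|M. h x * v x * ?I x) = (LINT x|N. h x * v x * ?I x)"
    if v: "\<And>x. complex_of_real (v x) = c1 * iexp (t \<bullet> x) + c2 * iexp ((-t) \<bullet> x)" "\<And>x. \<bar>v x\<bar> \<le> 1"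
      and [measurable]: "v \<in> borel_measurable borel" for v c1 c2 
  proof -
    have "(LINT x|K. h x * (1 + v x) * ?I x) = (LINT x|K. h x * 1 * ?I x) + (LINT x|K. h x * v x * ?I x)"
      if "prob_space K" "sets K = sets borel" for K
      using i[OF that, of "\<lambda>_. 1"] i[OF that, of v] v(2)
      by (subst Bochner_Integration.integral_add[symmetric]) (auto simp: distrib_left distrib_right)
    then show ?thesis using w[OF v that(3)] one assms by simp
  qed
  have c: "(LINT x|M. h x * cos (t \<bullet> x) * ?I x) = (LINT x|N. h x * cos (t \<bullet> x) * ?I x)"
    by (rule w'[of _ "1/2" "1/2"]) (auto simp: cos_exp_eq cos_of_real[symmetric] add_divide_distrib)
  have s: "(LINT x|M. h x * sin (t \<bullet> x) * ?I x) = (LINT x|N. h x * sin (t \<bullet> x) * ?I x)"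
    by (rule w'[of _ "1/(2*\<i>)" "-1/(2*\<i>)"]) (auto simp: sin_exp_eq sin_of_real[symmetric] diff_divide_distrib right_diff_distrib)
  have "(CLINT x|K. complex_of_real (\<Prod>b\<in>insert b S. indicator (A b) (x \<bullet> b)) * iexp (t \<bullet> x))
     = complex_of_real (LINT x|K. h x * cos (t \<bullet> x) * ?I x) + \<i> * complex_of_real (LINT x|K. h x * sin (t \<bullet> x) * ?I x)"
    if K: "prob_space K" "sets K = sets borel" for K
  proof -
    have e: "complex_of_real (\<Prod>b\<in>insert b S. indicator (A b) (x \<bullet> b)) * iexp (t \<bullet> x)
       = complex_of_real (h x * cos (t \<bullet> x) * ?I x) + \<i> * complex_of_real (h x * sin (t \<bullet> x) * ?I x)" for x
      using insert.hyps by (simp add: exp_Euler algebra_simps h_def cos_of_real sin_of_real)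
    have "integrable K (\<lambda>x. complex_of_real (h x * cos (t \<bullet> x) * ?I x))"
      "integrable K (\<lambda>x. complex_of_real (h x * sin (t \<bullet> x) * ?I x))"
      by (intro integrable_of_real i[OF K]; simp)+
    then show ?thesis unfolding e
      by (simp del: of_real_mult)
  qed
  then show ?case using c s assms by simp
qed

text \<open>At frequency 0 the restricted transforms are the measures of open boxes, and these form
  an intersection-stable generator of the Borel sets.\<close>

theorem euclidean_measure_eqI_char:
  fixes M N :: "'a::euclidean_space measure"
  assumes pr: "prob_space M" "prob_space N" and sets: "sets M = sets borel" "sets N = sets borel"
    and eq: "\<And>t. (CLINT x|M. iexp (t \<bullet> x)) = (CLINT x|N. iexp (t \<bullet> x))"
  shows "M = N"
proof (rule measure_eqI_generator_eq)
  interpret M: prob_space M by fact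
  interpret N: prob_space N by fact
  let ?E = "range (\<lambda>(a, b). box a b::'a set)"
  show "Int_stable ?E"
    by (auto simp: Int_stable_def box_Int_box)
  show "?E \<subseteq> Pow UNIV" "sets M = sigma_sets UNIV ?E" "sets N = sigma_sets UNIV ?E"
    by (simp_all add: borel_eq_box sets)
  let ?A = "\<lambda>n::nat. box (- (real n *\<^sub>R One)) (real n *\<^sub>R One) :: 'a set"
  show "range ?A \<subseteq> ?E" "(\<Union>i. ?A i) = UNIV"
    unfolding UN_box_eq_UNIV by auto
  show "emeasure M (?A i) \<noteq> \<infinity>" for i by auto
  fix X assume "X \<in> ?E"
  then obtain l u where X: "X = box l u" by auto
  have ind: "complex_of_real (\<Prod>b\<in>Basis. indicator {l \<bullet> b<..<u \<bullet> b} (x \<bullet> b)) * iexp (0 \<bullet> x)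
      = complex_of_real (indicator X x)" for x
    by (auto simp: X box_def indicator_def prod_zero_iff)
  have "complex_of_real (LINT x|M. indicator X x) = complex_of_real (LINT x|N. indicator X x)"
    using char_eq_imp_rectangle_char_eq[OF pr sets eq finite_Basis, of "\<lambda>b. {l \<bullet> b<..<u \<bullet> b}" 0]
    unfolding ind integral_complex_of_real by simp
  then show "emeasure M X = emeasure N X"
    using sets X by (simp add: M.emeasure_eq_measure N.emeasure_eq_measure)
qed


text \<open>\<open>q t\<close> is the variance of \<open>t \<bullet> x\<close>. Describing a centred
  law by this function alone makes singular covariances unexceptional and reduces the identification
  of two laws to a comparison of forms.\<close>

definition gaussian_law :: "'a::euclidean_space measure \<Rightarrow> ('a \<Rightarrow> real) \<Rightarrow> bool" where
  "gaussian_law M q \<longleftrightarrow> prob_space M \<and> sets M = sets borel \<and>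
     (\<forall>t. (CLINT x|M. iexp (t \<bullet> x)) = complex_of_real (exp (- q t / 2)))"

lemma gaussian_law_unique: "gaussian_law M q \<Longrightarrow> gaussian_law N q \<Longrightarrow> M = N"
  unfolding gaussian_law_def by (intro euclidean_measure_eqI_char) auto

lemma gaussian_law_prob_space: "gaussian_law M q \<Longrightarrow> prob_space M"
  and gaussian_law_sets: "gaussian_law M q \<Longrightarrow> sets M = sets borel"
  and gaussian_law_space: "gaussian_law M q \<Longrightarrow> space M = UNIV"
  unfolding gaussian_law_def by (auto dest: sets_eq_imp_space_eq)

abbreviation normal_measure :: "real \<Rightarrow> real measure" where
  "normal_measure \<sigma> \<equiv> density lborel (\<lambda>x. ennreal (normal_density 0 \<sigma> x))"

lemma char_normal_measure:
  assumes "\<sigma> > 0"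
  shows "(CLINT x|normal_measure \<sigma>. iexp (t * x)) = complex_of_real (exp (- (\<sigma>\<^sup>2 * t\<^sup>2) / 2))"
proof -
  interpret prob_space "normal_measure \<sigma>"
    using assms by (rule prob_space_normal_density)
  have "distributed (normal_measure \<sigma>) lborel (\<lambda>x. x) (\<lambda>x. ennreal (normal_density 0 \<sigma> x))"
    unfolding distributed_def by (auto simp: distr_id2 cong: distr_cong)
  then have "distributed (normal_measure \<sigma>) lborel (\<lambda>x. (x - 0) / \<sigma>) (\<lambda>x. ennreal (std_normal_density x))"
    using normal_standard_normal_convert[OF assms, of "\<lambda>x. x" 0] by simp
  then have *: "distr (normal_measure \<sigma>) borel (\<lambda>x. x / \<sigma>) = std_normal_distribution"
    by (simp add: distributed_def cong: distr_cong)
  have "(CLINT x|normal_measure \<sigma>. iexp (t * x)) = (CLINT x|distr (normal_measure \<sigma>) borel (\<lambda>x. x / \<sigma>). iexp ((\<sigma> * t) * x))"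
    using assms by (subst integral_distr) auto
  also have "\<dots> = char std_normal_distribution (\<sigma> * t)"
    unfolding * char_def ..
  finally show ?thesis
    by (simp add: char_std_normal_distribution power_mult_distrib)
qed

text \<open>The common source of Gaussian laws below: independent normals with vector coefficients
  \<open>w p\<close>, be it a layer of a network, a standard vector or a test coupling. Independence
  makes the characteristic function a product, so the variances add.\<close>

theorem gaussian_law_linear_combination:
  fixes w :: "'i \<Rightarrow> 'a::euclidean_space"
  assumes J: "finite J" and sd: "\<And>p. p \<in> J \<Longrightarrow> sd p > 0"
  shows "gaussian_law (distr (PiM J (\<lambda>p. normal_measure (sd p))) borel (\<lambda>\<theta>. \<Sum>p\<in>J. \<theta> p *\<^sub>R w p))
           (\<lambda>t. \<Sum>p\<in>J. (sd p)\<^sup>2 * (t \<bullet> w p)\<^sup>2)"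
proof -
  \<comment> \<open>The product locale asks for a probability measure at every index, also outside
    \<open>J\<close>, where \<open>sd\<close> may fail to be positive; the default 1 repairs this
    without changing the product over \<open>J\<close>.\<close>
  define sd' where "sd' p = (if p \<in> J then sd p else 1)" for p
  have sd': "sd' p > 0" for p using sd by (auto simp: sd'_def)
  interpret P: product_prob_space "\<lambda>p. normal_measure (sd' p)" J
    by (auto simp: product_prob_space_def product_sigma_finite_def product_prob_space_axioms_def
        intro!: prob_space_normal_density sd' prob_space_imp_sigma_finite)
  have PiM: "PiM J (\<lambda>p. normal_measure (sd p)) = PiM J (\<lambda>p. normal_measure (sd' p))"
    by (rule PiM_cong) (auto simp: sd'_def)
  let ?P = "PiM J (\<lambda>p. normal_measure (sd' p))"
  have m[measurable]: "(\<lambda>\<theta>. \<Sum>p\<in>J. \<theta> p *\<^sub>R w p) \<in> borel_measurable ?P"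
    by (intro borel_measurable_sum borel_measurable_scaleR) auto
  have "(CLINT x|distr ?P borel (\<lambda>\<theta>. \<Sum>p\<in>J. \<theta> p *\<^sub>R w p). iexp (t \<bullet> x))
     = complex_of_real (exp (- (\<Sum>p\<in>J. (sd p)\<^sup>2 * (t \<bullet> w p)\<^sup>2) / 2))" for t
  proof -
    have "(CLINT x|distr ?P borel (\<lambda>\<theta>. \<Sum>p\<in>J. \<theta> p *\<^sub>R w p). iexp (t \<bullet> x))
       = (CLINT \<theta>|?P. iexp (t \<bullet> (\<Sum>p\<in>J. \<theta> p *\<^sub>R w p)))"
      by (subst integral_distr) auto
    also have "\<dots> = (CLINT \<theta>|?P. (\<Prod>p\<in>J. iexp ((t \<bullet> w p) * \<theta> p)))"
      by (simp add: inner_sum_right exp_sum[OF J] sum_distrib_left mult.commute)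
    also have "\<dots> = (\<Prod>p\<in>J. CLINT x|normal_measure (sd' p). iexp ((t \<bullet> w p) * x))"
    proof (rule P.product_integral_prod[OF J])
      show "integrable (normal_measure (sd' p)) (\<lambda>x. iexp ((t \<bullet> w p) * x))" for p
        by (intro P.M.integrable_const_bound[of _ 1]) auto
    qed
    also have "\<dots> = (\<Prod>p\<in>J. complex_of_real (exp (- ((sd p)\<^sup>2 * (t \<bullet> w p)\<^sup>2) / 2)))"
      by (intro prod.cong refl, subst char_normal_measure[OF sd']) (simp add: sd'_def)
    also have "\<dots> = complex_of_real (exp (\<Sum>p\<in>J. - ((sd p)\<^sup>2 * (t \<bullet> w p)\<^sup>2) / 2))"
      by (simp only: exp_sum[OF J] of_real_prod)
    finally show ?thesis
      by (simp only: sum_negf sum_divide_distrib[symmetric])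
  qed
  moreover have "prob_space (distr ?P borel (\<lambda>\<theta>. \<Sum>p\<in>J. \<theta> p *\<^sub>R w p))"
    by (rule P.prob_space_distr) (rule m)
  ultimately show ?thesis unfolding gaussian_law_def PiM by simp
qed

text \<open>The assumption on \<open>f'\<close> says that it is the adjoint of \<open>f\<close>,
  which moves the frequency from the image back to the source.\<close>

lemma gaussian_law_linear_image:
  assumes "gaussian_law M q" "f \<in> borel_measurable borel" "\<And>t x. t \<bullet> f x = f' t \<bullet> x"
  shows "gaussian_law (distr M borel f) (\<lambda>t. q (f' t))"
proof -
  interpret prob_space M using gaussian_law_prob_space[OF assms(1)] .
  note [measurable_cong] = gaussian_law_sets[OF assms(1)]
  note [measurable] = assms(2)
  show ?thesis unfolding gaussian_law_def
  proof (safe intro!: prob_space_distr)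
    fix t
    have "(CLINT x|distr M borel f. iexp (t \<bullet> x)) = (CLINT x|M. iexp (f' t \<bullet> x))"
      by (subst integral_distr) (auto simp: assms(3))
    then show "(CLINT x|distr M borel f. iexp (t \<bullet> x)) = complex_of_real (exp (- q (f' t) / 2))"
      using assms(1) unfolding gaussian_law_def by simp
  qed auto
qed

text \<open>With uniqueness this yields independence: a joint law whose form splits into two
  separate forms is the product law.\<close>

lemma gaussian_law_pair:
  fixes M :: "'a::euclidean_space measure" and N :: "'b::euclidean_space measure"
  assumes M: "gaussian_law M q" and N: "gaussian_law N r"
  shows "gaussian_law (M \<Otimes>\<^sub>M N) (\<lambda>t. q (fst t) + r (snd t))"
proof -
  interpret M: prob_space M using gaussian_law_prob_space[OF M] .
  interpret N: prob_space N using gaussian_law_prob_space[OF N] .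
  interpret pair_prob_space M N ..
  have s: "sets (M \<Otimes>\<^sub>M N) = sets borel"
    unfolding borel_prod[symmetric] by (rule sets_pair_measure_cong[OF gaussian_law_sets[OF M] gaussian_law_sets[OF N]])
  note [measurable_cong] = gaussian_law_sets[OF M] gaussian_law_sets[OF N]
  have "(CLINT x|(M \<Otimes>\<^sub>M N). iexp (t \<bullet> x)) = complex_of_real (exp (- (q (fst t) + r (snd t)) / 2))" for t
  proof -
    have "integrable (M \<Otimes>\<^sub>M N) (\<lambda>x. iexp (fst t \<bullet> fst x) * iexp (snd t \<bullet> snd x))"
      by (intro P.integrable_const_bound[of _ 1]) (auto simp: norm_mult)
    then have "(CLINT x|(M \<Otimes>\<^sub>M N). iexp (fst t \<bullet> fst x) * iexp (snd t \<bullet> snd x))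
       = (CLINT x|M. (CLINT y|N. iexp (fst t \<bullet> x) * iexp (snd t \<bullet> y)))"
      by (subst integral_fst'[symmetric]) auto
    also have "\<dots> = complex_of_real (exp (- q (fst t) / 2)) * complex_of_real (exp (- r (snd t) / 2))"
      using M N by (simp add: gaussian_law_def)
    finally show ?thesis
      by (simp add: inner_prod_def distrib_left exp_add[symmetric] add_divide_distrib flip: of_real_mult)
  qed
  then show ?thesis using s P.prob_space_axioms unfolding gaussian_law_def by simp
qed

section \<open>Measurable Cholesky factors\<close>

definition psd :: "real^'k^'k::finite \<Rightarrow> bool" where
  "psd S \<longleftrightarrow> transpose S = S \<and> (\<forall>v. 0 \<le> v \<bullet> (S *v v))"

lemma psd_sym: "psd S \<Longrightarrow> S $ r $ c = S $ c $ r"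
  unfolding psd_def by (metis (no_types) transpose_def vec_lambda_beta)

lemma psd_quadratic_nonneg: "psd S \<Longrightarrow> 0 \<le> v \<bullet> (S *v v)"
  unfolding psd_def by simp

lemma pos_def_imp_psd: "pos_def K \<Longrightarrow> psd K"
  unfolding pos_def_def psd_def by (metis inner_zero_left less_imp_le order_refl)

lemma entry_eq_inner: "(S :: real^'k^'k::finite) $ r $ c = axis r 1 \<bullet> (S *v axis c 1)"
  by (simp add: matrix_vector_mult_basis inner_axis' column_def)

lemma psd_inner_commute: "psd S \<Longrightarrow> u \<bullet> (S *v v) = v \<bullet> (S *v u)"
  unfolding psd_def by (metis dot_lmul_matrix inner_commute transpose_matrix_vector)

text \<open>The usual discriminant argument, with a separate case for the null vectors of a singular
  matrix, where the form is affine in \<open>t\<close> and nonnegativity forces its slope to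
  vanish.\<close>

lemma psd_Cauchy_Schwarz:
  assumes "psd S"
  shows "(u \<bullet> (S *v v))\<^sup>2 \<le> (u \<bullet> (S *v u)) * (v \<bullet> (S *v v))"
proof -
  let ?a = "u \<bullet> (S *v u)" and ?b = "u \<bullet> (S *v v)" and ?c = "v \<bullet> (S *v v)"
  have q: "0 \<le> ?a + 2 * t * ?b + t\<^sup>2 * ?c" for t
  proof -
    have "(u + t *\<^sub>R v) \<bullet> (S *v (u + t *\<^sub>R v)) = ?a + 2 * t * ?b + t\<^sup>2 * ?c"
      using psd_inner_commute[OF assms, of v u]
      by (simp add: matrix_vector_right_distrib matrix_vector_mult_scaleR inner_simps power2_eq_square algebra_simps)
    then show ?thesis using psd_quadratic_nonneg[OF assms, of "u + t *\<^sub>R v"] by simp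
  qed
  show ?thesis
  proof (cases "?c = 0")
    case True
    have "?b = 0"
    proof (rule ccontr)
      assume b: "?b \<noteq> 0"
      have "0 \<le> ?a + 2 * (- (?a + 1) / (2 * ?b)) * ?b" using q[of "- (?a + 1) / (2 * ?b)"] True by simp
      also have "\<dots> = -1" using b by (simp add: field_simps)
      finally show False by simp
    qed
    then show ?thesis using True by simp
  next
    case False
    then have c: "?c > 0" using psd_quadratic_nonneg[OF assms, of v] by simp
    have "0 \<le> ?a + 2 * (- ?b / ?c) * ?b + (- ?b / ?c)\<^sup>2 * ?c" by (rule q)
    also have "\<dots> = ?a - ?b\<^sup>2 / ?c" using c by (simp add: field_simps power2_eq_square)
    finally show ?thesis using c by (simp add: field_simps)
  qed
qed

lemma psd_entry_bound: "psd S \<Longrightarrow> (S $ r $ c)\<^sup>2 \<le> S $ r $ r * S $ c $ c"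
  unfolding entry_eq_inner by (rule psd_Cauchy_Schwarz)

lemma psd_diag_nonneg: "psd S \<Longrightarrow> 0 \<le> S $ r $ r"
  unfolding entry_eq_inner by (rule psd_quadratic_nonneg)

lemma psd_zero_diag: "psd S \<Longrightarrow> S $ c $ c = 0 \<Longrightarrow> S $ r $ c = 0"
  using psd_entry_bound[of S r c] by simp

text \<open>Since \<open>x / 0 = 0\<close>, a vanishing pivot of a positive semidefinite matrix (whose whole column is then
  zero) leaves the matrix unchanged and contributes a zero column to the factor.\<close>
definition chol_step :: "real^'k^'k::finite \<Rightarrow> 'k \<Rightarrow> real^'k^'k" where
  "chol_step S i = (\<chi> r c. S $ r $ c - S $ r $ i * S $ c $ i / S $ i $ i)"

primrec chol :: "'k list \<Rightarrow> real^'k^'k::finite \<Rightarrow> real^'k^'k" where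
  "chol [] S = 0"
| "chol (i # xs) S = (\<chi> r c. if c = i then S $ r $ i / sqrt (S $ i $ i) else chol xs (chol_step S i) $ r $ c)"

text \<open>Subtracting the rank-one part of the pivot column completes the square. For a positive
  pivot the new form is the minimum of the old one over shifts of \<open>v\<close> along the axis
  \<open>i\<close>, so both semidefiniteness and definiteness survive the step.\<close>

lemma chol_step_quadratic:
  "v \<bullet> (chol_step S i *v v) = v \<bullet> (S *v v) - (v \<bullet> (S *v axis i 1))\<^sup>2 / S $ i $ i"
proof -
  have "chol_step S i *v v = S *v v - ((v \<bullet> column i S) / S $ i $ i) *\<^sub>R column i S"
    unfolding vec_eq_iff
    by (auto simp: chol_step_def matrix_vector_mult_def column_def inner_vec_def left_diff_distrib sum_subtractf
        sum_divide_distrib sum_distrib_left sum_distrib_right intro!: sum.cong)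
  then show ?thesis
    by (simp add: matrix_vector_mult_basis inner_diff_right power2_eq_square)
qed

lemma psd_chol_step:
  assumes "psd S" shows "psd (chol_step S i)"
proof -
  have "0 \<le> v \<bullet> (chol_step S i *v v)" for v
  proof (cases "S $ i $ i = 0")
    case True then show ?thesis using psd_quadratic_nonneg[OF assms] by (simp add: chol_step_quadratic)
  next
    case False
    then have "S $ i $ i > 0" using psd_diag_nonneg[OF assms, of i] by simp
    then show ?thesis using psd_Cauchy_Schwarz[OF assms, of v "axis i 1"]
      by (simp add: chol_step_quadratic entry_eq_inner[symmetric] field_simps)
  qed
  moreover have "transpose (chol_step S i) = chol_step S i"
    by (simp add: transpose_def chol_step_def vec_eq_iff psd_sym[OF assms] mult.commute)
  ultimately show ?thesis by (simp add: psd_def)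
qed

lemma chol_zero_column: "c \<notin> set xs \<Longrightarrow> chol xs S $ r $ c = 0"
  by (induction xs arbitrary: S) auto

text \<open>The vanishing rows outside \<open>xs\<close> are the invariant that lets the recursion
  end at the zero matrix: a step clears row \<open>i\<close>, for a positive pivot by the
  subtraction, for a zero pivot because that row of \<open>S\<close> is already zero.\<close>

lemma chol_factorization:
  assumes "psd S" "distinct xs" "\<And>r c. r \<notin> set xs \<Longrightarrow> S $ r $ c = 0"
  shows "chol xs S ** transpose (chol xs S) = S"
  using assms
proof (induction xs arbitrary: S)
  case Nil then show ?case by (simp add: vec_eq_iff matrix_matrix_mult_def)
next
  case (Cons i xs)
  let ?T = "chol_step S i" let ?B = "chol xs ?T"
  have "?T $ r $ c = 0" if "r \<notin> set xs" for r c
  proof (cases "r = i")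
    case True
    then show ?thesis using psd_zero_diag[OF Cons.prems(1), of i c] psd_sym[OF Cons.prems(1), of i c]
      by (auto simp: chol_step_def)
  next
    case False
    then show ?thesis using Cons.prems(3)[of r] that by (auto simp: chol_step_def)
  qed
  then have IH: "?B ** transpose ?B = ?T"
    using Cons.prems by (intro Cons.IH psd_chol_step) auto
  have ent: "(\<Sum>c\<in>UNIV. ?B $ r $ c * ?B $ r' $ c) = ?T $ r $ r'" for r r'
    using arg_cong[OF IH, of "\<lambda>M. M $ r $ r'"] by (simp add: matrix_matrix_mult_def transpose_def)
  \<comment> \<open>Column \<open>i\<close> of the recursive factor is empty, so overwriting it with
    the pivot column loses nothing.\<close>
  have z: "?B $ r $ i = 0" for r using Cons.prems(2) by (intro chol_zero_column) simp
  have "(\<Sum>c\<in>UNIV. chol (i # xs) S $ r $ c * chol (i # xs) S $ r' $ c) = S $ r $ r'" for r r'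
  proof -
    have "(\<Sum>c\<in>UNIV. chol (i # xs) S $ r $ c * chol (i # xs) S $ r' $ c)
      = S $ r $ i / sqrt (S $ i $ i) * (S $ r' $ i / sqrt (S $ i $ i)) + (\<Sum>c\<in>UNIV - {i}. ?B $ r $ c * ?B $ r' $ c)"
      by (subst sum.remove[of UNIV i]) (auto intro!: sum.cong)
    also have "(\<Sum>c\<in>UNIV - {i}. ?B $ r $ c * ?B $ r' $ c) = ?T $ r $ r'"
      unfolding ent[symmetric] by (rule sum.mono_neutral_left) (auto simp: z)
    also have "S $ r $ i / sqrt (S $ i $ i) * (S $ r' $ i / sqrt (S $ i $ i)) = S $ r $ i * S $ r' $ i / S $ i $ i"
      using psd_diag_nonneg[OF Cons.prems(1), of i] by simp
    finally show ?thesis by (simp add: chol_step_def)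
  qed
  then show ?case by (simp add: vec_eq_iff matrix_matrix_mult_def transpose_def)
qed

definition chol_order :: "'k::finite list" where
  "chol_order = (SOME xs. set xs = UNIV \<and> distinct xs)"

lemma chol_order: "set (chol_order :: 'k::finite list) = UNIV" "distinct (chol_order :: 'k list)"
  using someI_ex[OF finite_distinct_list[OF finite[of "UNIV :: 'k set"]]] unfolding chol_order_def by auto

text \<open>An explicit factor, in contrast to the arbitrary choice inside \<open>gauss_vec\<close>:
  it has to be measurable in a random \<open>S\<close> and differentiable at a definite one.\<close>

definition chol_factor :: "real^'k^'k::finite \<Rightarrow> real^'k^'k" where
  "chol_factor S = chol chol_order S"

lemma chol_factor: "psd S \<Longrightarrow> chol_factor S ** transpose (chol_factor S) = S"
  unfolding chol_factor_def by (rule chol_factorization) (auto simp: chol_order)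

lemma borel_measurable_matrixI:
  fixes f :: "'a \<Rightarrow> real^'c::finite^'r::finite"
  assumes "\<And>r c. (\<lambda>x. f x $ r $ c) \<in> borel_measurable M"
  shows "f \<in> borel_measurable M"
  unfolding borel_measurable_euclidean_space[of f] using assms
  by (auto simp: Basis_vec_def inner_axis)

lemma borel_measurable_entry [measurable (raw)]:
  fixes f :: "'a \<Rightarrow> real^'c::finite^'r::finite"
  assumes "f \<in> borel_measurable M"
  shows "(\<lambda>x. f x $ r $ c) \<in> borel_measurable M"
  by (rule borel_measurable_continuous_on[OF _ assms]) (intro continuous_intros)

lemma measurable_chol_step [measurable]: "(\<lambda>S. chol_step S i) \<in> borel_measurable borel"
  by (intro borel_measurable_matrixI) (simp add: chol_step_def)

lemma measurable_chol [measurable]: "chol xs \<in> borel_measurable borel"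
proof (induction xs)
  case Nil then show ?case by (simp add: chol.simps(1)[abs_def])
next
  case (Cons i xs)
  note [measurable] = Cons.IH
  show ?case
    by (intro borel_measurable_matrixI) simp
qed

lemma measurable_chol_factor [measurable]: "chol_factor \<in> borel_measurable borel"
  unfolding chol_factor_def[abs_def] by measurable

section \<open>Differentiability and growth of the Cholesky factor\<close>

lemma differentiable_matrixI:
  fixes f :: "'a::euclidean_space \<Rightarrow> real^'c::finite^'r::finite"
  assumes "\<And>r c. (\<lambda>x. f x $ r $ c) differentiable (at a)"
  shows "f differentiable (at a)"
  by (subst differentiable_componentwise_within) (auto simp: Basis_vec_def inner_axis assms)

lemma differentiable_entry: "(\<lambda>S. S $ r $ c) differentiable (at (a :: real^'c::finite^'r::finite))"
  by (intro bounded_linear_imp_differentiable bounded_linear_compose[OF bounded_linear_vec_nth bounded_linear_vec_nth])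

lemma differentiable_sqrt:
  fixes f :: "'a::real_normed_vector \<Rightarrow> real"
  shows "f differentiable (at a) \<Longrightarrow> f a > 0 \<Longrightarrow> (\<lambda>x. sqrt (f x)) differentiable (at a)"
  unfolding differentiable_def by (blast intro: has_derivative_real_sqrt)

lemma differentiable_chol_step: "S $ i $ i \<noteq> 0 \<Longrightarrow> (\<lambda>S. chol_step S i) differentiable (at S)"
  by (rule differentiable_matrixI)
     (auto simp: chol_step_def intro!: differentiable_diff differentiable_divide differentiable_mult differentiable_entry)

text \<open>All pivots stay positive along the recursion, so divisions and square roots occur only
  at positive arguments. Definiteness is demanded only for vectors supported on \<open>xs\<close>,
  since the steps already taken have made the other axes null directions.\<close>

lemma differentiable_chol:
  fixes S :: "real^'k^'k::finite"
  assumes "psd S" "distinct xs" "\<And>v. v \<noteq> 0 \<Longrightarrow> (\<And>r. r \<notin> set xs \<Longrightarrow> v $ r = 0) \<Longrightarrow> v \<bullet> (S *v v) > 0"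
  shows "chol xs differentiable (at S)"
  using assms
proof (induction xs arbitrary: S)
  case Nil then show ?case by (simp add: chol.simps(1)[abs_def])
next
  case (Cons i xs)
  have pivot: "S $ i $ i > 0"
    unfolding entry_eq_inner by (rule Cons.prems(3)) (simp add: axis_eq_0_iff, auto simp: axis_def)
  have "v \<bullet> (chol_step S i *v v) > 0" if v: "v \<noteq> 0" "\<And>r. r \<notin> set xs \<Longrightarrow> v $ r = 0" for v
  proof -
    \<comment> \<open>This \<open>t\<close> minimises the form of \<open>S\<close> on the line
      through \<open>v\<close> in direction \<open>axis i 1\<close>; the minimum is the form of the
      Schur complement at \<open>v\<close>.\<close>
    define t where "t = (v \<bullet> (S *v axis i 1)) / S $ i $ i"
    have i: "i \<notin> set xs" using Cons.prems(2) by simp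
    obtain r where r: "v $ r \<noteq> 0" using v(1) by (auto simp: vec_eq_iff)
    then have "r \<noteq> i" using v(2) i by auto
    then have "(v - t *\<^sub>R axis i 1) $ r \<noteq> 0" using r by (simp add: axis_def)
    then have "v - t *\<^sub>R axis i 1 \<noteq> 0" by (metis zero_index)
    then have "0 < (v - t *\<^sub>R axis i 1) \<bullet> (S *v (v - t *\<^sub>R axis i 1))"
      using v(2) by (intro Cons.prems(3)) (auto simp: axis_def)
    also have "\<dots> = v \<bullet> (S *v v) - 2 * t * (v \<bullet> (S *v axis i 1)) + t\<^sup>2 * S $ i $ i"
      using psd_inner_commute[OF Cons.prems(1), of v "axis i 1"] 
      by (simp add: matrix_vector_mult_diff_distrib matrix_vector_mult_scaleR inner_simps entry_eq_inner[of S i i]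
         power2_eq_square algebra_simps)
    also have "\<dots> = v \<bullet> (chol_step S i *v v)"
      using pivot by (simp add: chol_step_quadratic t_def power2_eq_square field_simps)
    finally show ?thesis .
  qed
  then have IH: "chol xs differentiable (at (chol_step S i))"
    using Cons.prems by (intro Cons.IH psd_chol_step) auto
  have "(chol xs \<circ> (\<lambda>S. chol_step S i)) differentiable (at S)"
    using pivot by (intro differentiable_chain_at IH differentiable_chol_step) auto
  then have comp: "(\<lambda>S. chol xs (chol_step S i) $ r $ c) differentiable (at S)" for r c
    using differentiable_chain_at[OF _ differentiable_entry[of r c], of "\<lambda>S. chol xs (chol_step S i)" S] 
    by (simp add: o_def)
  show ?case
  proof (rule differentiable_matrixI)
    fix r c
    show "(\<lambda>S. chol (i # xs) S $ r $ c) differentiable (at S)"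
      using pivot comp
      by (cases "c = i") (auto intro!: differentiable_divide differentiable_entry differentiable_sqrt)
  qed
qed

text \<open>A Lipschitz estimate with one end fixed at \<open>a\<close> needs the derivative at that
  single point only: the derivative contributes its norm bound and the remainder the constant
  1.\<close>

lemma differentiable_imp_locally_calm:
  assumes "f differentiable (at a)"
  shows "\<exists>C \<delta>. 0 < \<delta> \<and> 0 \<le> C \<and> (\<forall>x. norm (x - a) < \<delta> \<longrightarrow> norm (f x - f a) \<le> C * norm (x - a))"
proof -
  obtain f' where f': "(f has_derivative f') (at a)" using assms unfolding differentiable_def by blast
  then have bl: "bounded_linear f'" by (rule has_derivative_bounded_linear)
  obtain K where K: "\<And>x. norm (f' x) \<le> norm x * K" "K > 0" using bounded_linear.pos_bounded[OF bl] by blast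
  obtain d where d: "d > 0" "\<And>x. norm (x - a) < d \<Longrightarrow> norm (f x - f a - f' (x - a)) \<le> 1 * norm (x - a)"
    using f' unfolding has_derivative_at_alt by (meson zero_less_one)
  have "norm (f x - f a) \<le> (1 + K) * norm (x - a)" if "norm (x - a) < d" for x
    using norm_triangle_ineq[of "f x - f a - f' (x - a)" "f' (x - a)"] d(2)[OF that] K(1)[of "x - a"]
    by (simp add: algebra_simps)
  then show ?thesis using d(1) K(2) by (intro exI[of _ "1 + K"] exI[of _ d]) auto
qed

lemma norm_matrix_sq: "(norm (A :: real^'c::finite^'r::finite))\<^sup>2 = (\<Sum>r\<in>UNIV. \<Sum>c\<in>UNIV. (A $ r $ c)\<^sup>2)"
  unfolding power2_norm_eq_inner inner_vec_def by (simp add: power2_eq_square)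

lemma norm_chol_factor_sq: "psd S \<Longrightarrow> (norm (chol_factor S))\<^sup>2 = (\<Sum>r\<in>UNIV. S $ r $ r)"
proof -
  assume S: "psd S"
  have "(\<Sum>c\<in>UNIV. (chol_factor S $ r $ c)\<^sup>2) = S $ r $ r" for r
    using arg_cong[OF chol_factor[OF S], of "\<lambda>M. M $ r $ r"]
    by (simp add: matrix_matrix_mult_def transpose_def power2_eq_square)
  then show ?thesis by (simp add: norm_matrix_sq)
qed

text \<open>Near \<open>K\<close> the factors are bounded and differentiability gives the linear
  estimate. Far from \<open>K\<close> the left side is at most a constant times one plus the traces
  of \<open>S\<close> and \<open>K\<close>, hence affine in \<open>norm (S - K)\<close>, and the
  constant part is absorbed because \<open>norm (S - K)\<close> is at least \<open>\<delta>\<close>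
  there. Continuity at singular \<open>S\<close> is not involved.\<close>

theorem chol_factor_calm:
  fixes K :: "real^'k^'k::finite"
  assumes "pos_def K"
  shows "\<exists>C\<ge>0. \<forall>S. psd S \<longrightarrow> norm (chol_factor S - chol_factor K) * (1 + norm (chol_factor S) + norm (chol_factor K))
            \<le> C * norm (S - K)"
proof -
  let ?A = "chol_factor :: real^'k^'k \<Rightarrow> _"
  have "chol_factor differentiable (at K)"
    unfolding chol_factor_def[abs_def]
    by (rule differentiable_chol) (use assms in \<open>auto simp: pos_def_imp_psd chol_order pos_def_def\<close>)
  then obtain C \<delta> where \<delta>: "\<delta> > 0" and C: "C \<ge> 0"
    and near: "\<And>S. norm (S - K) < \<delta> \<Longrightarrow> norm (?A S - ?A K) \<le> C * norm (S - K)"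
    using differentiable_imp_locally_calm by metis
  define T where "T = (\<Sum>r\<in>UNIV. K $ r $ r)"
  have T: "T \<ge> 0" unfolding T_def by (intro sum_nonneg psd_diag_nonneg pos_def_imp_psd assms)
  define k where "k = real CARD('k)"
  define C1 where "C1 = C * (1 + 2 * norm (?A K) + C * \<delta>)"
  define C2 where "C2 = 3 * (1 + 2 * T) / \<delta> + 3 * k"
  have C12: "C1 \<ge> 0" "C2 \<ge> 0" using C \<delta> T by (auto simp: C1_def C2_def k_def)
  have "norm (?A S - ?A K) * (1 + norm (?A S) + norm (?A K)) \<le> (C1 + C2) * norm (S - K)" if S: "psd S" for S
  proof (cases "norm (S - K) < \<delta>")
    case True
    have "norm (?A S) \<le> norm (?A K) + norm (?A S - ?A K)" by (metis norm_triangle_sub)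
    also have "norm (?A S - ?A K) \<le> C * \<delta>" using near[OF True] True C by (meson less_imp_le mult_left_mono order_trans)
    finally have "norm (?A S - ?A K) * (1 + norm (?A S) + norm (?A K)) \<le> (C * norm (S - K)) * (1 + 2 * norm (?A K) + C * \<delta>)"
      using near[OF True] C by (intro mult_mono) auto
    also have "\<dots> = C1 * norm (S - K)" by (simp add: C1_def)
    also have "\<dots> \<le> (C1 + C2) * norm (S - K)" using C12 by (simp add: mult_right_mono)
    finally show ?thesis .
  next
    case False
    let ?a = "norm (?A S)" and ?b = "norm (?A K)"
    have "norm (?A S - ?A K) \<le> 1 + ?a + ?b" using norm_triangle_ineq4[of "?A S" "?A K"] by simp
    then have "norm (?A S - ?A K) * (1 + ?a + ?b) \<le> (1 + ?a + ?b) * (1 + ?a + ?b)"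
      by (intro mult_right_mono) auto
    also have "\<dots> \<le> 3 * (1 + ?a\<^sup>2 + ?b\<^sup>2)"
      using sum_squares_ge_zero[of "?a - 1" "?b - 1"] zero_le_power2[of "?a - ?b"]
      by (simp add: power2_eq_square algebra_simps)
    also have "?a\<^sup>2 = (\<Sum>r\<in>UNIV. S $ r $ r)" by (rule norm_chol_factor_sq[OF S])
    also have "?b\<^sup>2 = T" unfolding T_def by (rule norm_chol_factor_sq[OF pos_def_imp_psd[OF assms]])
    also have "(\<Sum>r\<in>UNIV. S $ r $ r) \<le> T + k * norm (S - K)"
    proof -
      have "S $ r $ r \<le> K $ r $ r + norm (S - K)" for r
        using component_le_norm_cart[of "(S - K) $ r" r] Finite_Cartesian_Product.norm_nth_le[of "S - K" r] by simp
      then have "(\<Sum>r\<in>UNIV. S $ r $ r) \<le> (\<Sum>r\<in>UNIV. K $ r $ r + norm (S - K))" by (intro sum_mono)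
      then show ?thesis by (simp add: T_def k_def sum.distrib)
    qed
    also have "3 * (1 + (T + k * norm (S - K)) + T) = 3 * (1 + 2 * T) + 3 * k * norm (S - K)" by simp
    also have "3 * (1 + 2 * T) \<le> 3 * (1 + 2 * T) / \<delta> * norm (S - K)"
      using False \<delta> T mult_left_mono[of \<delta> "norm (S - K)" "3 * (1 + 2 * T)"] by (simp add: field_simps)
    finally have "norm (?A S - ?A K) * (1 + ?a + ?b) \<le> C2 * norm (S - K)" by (simp add: C2_def distrib_right)
    also have "\<dots> \<le> (C1 + C2) * norm (S - K)" using C12 by (simp add: mult_right_mono)
    finally show ?thesis .
  qed
  then show ?thesis using C12 by (intro exI[of _ "C1 + C2"]) auto
qed

section \<open>Covariance dependence of Gaussian expectations\<close>

lemma vec_lambda_eq_sum: "vec_lambda f = (\<Sum>i\<in>UNIV. f i *\<^sub>R axis i (1::real))"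
  by (simp add: vec_eq_iff axis_def if_distrib[of "\<lambda>x. _ * x"] cong: if_cong)

lemma gaussian_law_std_normal_vec: "gaussian_law (std_normal_vec :: (real^'k::finite) measure) (\<lambda>t. t \<bullet> t)"
proof -
  have "gaussian_law (distr (PiM UNIV (\<lambda>p::'k. normal_measure 1)) borel (\<lambda>\<theta>. \<Sum>p\<in>UNIV. \<theta> p *\<^sub>R axis p (1::real)))
           (\<lambda>t. \<Sum>p\<in>UNIV. 1\<^sup>2 * (t \<bullet> axis p 1)\<^sup>2)"
    by (rule gaussian_law_linear_combination) auto
  moreover have "(\<Sum>p\<in>UNIV. 1\<^sup>2 * (t \<bullet> axis p 1)\<^sup>2) = t \<bullet> t" for t :: "real^'k"
    unfolding inner_axis by (simp add: inner_vec_def power2_eq_square)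
  ultimately show ?thesis
    unfolding std_normal_vec_def vec_lambda_eq_sum[abs_def] by simp
qed

lemma measurable_matrix_vector_mult [measurable (raw)]:
  "f \<in> borel_measurable M \<Longrightarrow> (\<lambda>x. (A :: real^'k::finite^'j::finite) *v f x) \<in> borel_measurable M"
  by (rule borel_measurable_continuous_on[OF linear_continuous_on[OF matrix_vector_mul_bounded_linear]])

text \<open>The form depends on the chosen factor \<open>A\<close> only through
  \<open>A ** transpose A\<close>, and the Cholesky factor shows that a choice exists.\<close>

lemma gaussian_law_gauss_vec:
  fixes S :: "real^'k^'k::finite"
  assumes "psd S"
  shows "gaussian_law (gauss_vec S) (\<lambda>t. t \<bullet> (S *v t))"
proof -
  define A where "A = (SOME A :: real^'k^'k. A ** transpose A = S)"
  have A: "A ** transpose A = S"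
    unfolding A_def by (rule someI[of _ "chol_factor S"]) (rule chol_factor[OF assms])
  have "gaussian_law (distr std_normal_vec borel (\<lambda>\<xi>. A *v \<xi>)) (\<lambda>t. (transpose A *v t) \<bullet> (transpose A *v t))"
    by (rule gaussian_law_linear_image[OF gaussian_law_std_normal_vec])
       (auto simp: dot_lmul_matrix[symmetric] vector_transpose_matrix)
  moreover have "(transpose A *v t) \<bullet> (transpose A *v t) = t \<bullet> (S *v t)" for t
    unfolding A[symmetric]
    by (simp add: matrix_vector_mul_assoc[symmetric] dot_lmul_matrix[symmetric] vector_transpose_matrix)
  ultimately show ?thesis unfolding gauss_vec_def A_def by simp
qed

section \<open>Moments of Gaussian marginals\<close>

lemma gaussian_law_normal_measure:
  assumes "\<sigma> > 0" shows "gaussian_law (normal_measure \<sigma>) (\<lambda>t. \<sigma>\<^sup>2 * t\<^sup>2)"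
  using char_normal_measure[OF assms] prob_space_normal_density[OF assms, of 0] unfolding gaussian_law_def by simp

lemma normal_measure_moments:
  assumes "\<sigma> > 0"
  shows "integrable (normal_measure \<sigma>) (\<lambda>x. x\<^sup>2)" "(LINT x|normal_measure \<sigma>. x\<^sup>2) = \<sigma>\<^sup>2"
    "integrable (normal_measure \<sigma>) (\<lambda>x. x^4)" "(LINT x|normal_measure \<sigma>. x^4) = 3 * (\<sigma>\<^sup>2)\<^sup>2"
proof -
  note h = normal_moment_even[OF assms, of 0]
  have 2: "has_bochner_integral lborel (\<lambda>x. normal_density 0 \<sigma> x * x\<^sup>2) (\<sigma>\<^sup>2)"
    using h[of 1] assms by simp
  have 4: "has_bochner_integral lborel (\<lambda>x. normal_density 0 \<sigma> x * x^4) (3 * (\<sigma>\<^sup>2)\<^sup>2)"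
    using h[of 2] assms by (simp add: fact_numeral field_simps)
  show "integrable (normal_measure \<sigma>) (\<lambda>x. x\<^sup>2)" "(LINT x|normal_measure \<sigma>. x\<^sup>2) = \<sigma>\<^sup>2"
    "integrable (normal_measure \<sigma>) (\<lambda>x. x^4)" "(LINT x|normal_measure \<sigma>. x^4) = 3 * (\<sigma>\<^sup>2)\<^sup>2"
    using 2 4 by (auto simp: integrable_density integral_density has_bochner_integral_iff)
qed

lemma gaussian_law_moments:
  assumes M: "gaussian_law M q" and q: "\<And>s. q (s *\<^sub>R u) = v * s\<^sup>2" and v: "v > 0"
  shows "integrable M (\<lambda>x. (u \<bullet> x)\<^sup>2)" "(LINT x|M. (u \<bullet> x)\<^sup>2) = v"
    "integrable M (\<lambda>x. (u \<bullet> x)^4)" "(LINT x|M. (u \<bullet> x)^4) = 3 * v\<^sup>2"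
proof -
  note [measurable_cong] = gaussian_law_sets[OF M]
  have "gaussian_law (distr M borel (\<lambda>x. u \<bullet> x)) (\<lambda>t. q (t *\<^sub>R u))"
    by (rule gaussian_law_linear_image[OF M]) auto
  moreover have "gaussian_law (normal_measure (sqrt v)) (\<lambda>t. q (t *\<^sub>R u))"
    using gaussian_law_normal_measure[of "sqrt v"] v q by simp
  ultimately have e: "distr M borel (\<lambda>x. u \<bullet> x) = normal_measure (sqrt v)"
    by (rule gaussian_law_unique)
  note m = normal_measure_moments[of "sqrt v", folded e]
  show "integrable M (\<lambda>x. (u \<bullet> x)\<^sup>2)" "(LINT x|M. (u \<bullet> x)\<^sup>2) = v"
    "integrable M (\<lambda>x. (u \<bullet> x)^4)" "(LINT x|M. (u \<bullet> x)^4) = 3 * v\<^sup>2"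
    using m v by (auto simp: integrable_distr_eq integral_distr)
qed

text \<open>The form belongs to the covariance matrix with rows \<open>(p, r)\<close> and
  \<open>(r, q)\<close>. Perfect correlation is included, as happens when two inputs
  coincide.\<close>

definition bivariate :: "real \<Rightarrow> real \<Rightarrow> real \<Rightarrow> (real \<times> real) measure \<Rightarrow> bool" where
  "bivariate p q r M \<longleftrightarrow> gaussian_law M (\<lambda>t. p * (fst t)\<^sup>2 + 2 * r * fst t * snd t + q * (snd t)\<^sup>2)"

lemma bivariate_sets: "bivariate p q r M \<Longrightarrow> sets M = sets (borel \<Otimes>\<^sub>M borel)"
  unfolding bivariate_def borel_prod by (rule gaussian_law_sets)

lemma bivariate_unique: "bivariate p q r M \<Longrightarrow> bivariate p q r N \<Longrightarrow> M = N"
  unfolding bivariate_def by (rule gaussian_law_unique)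

lemma bivariate_moments:
  assumes "bivariate p q r M" "p > 0" "q > 0"
  shows "integrable M (\<lambda>z. (fst z)\<^sup>2)" "(LINT z|M. (fst z)\<^sup>2) = p"
    "integrable M (\<lambda>z. (fst z)^4)" "(LINT z|M. (fst z)^4) = 3 * p\<^sup>2"
    "integrable M (\<lambda>z. (snd z)\<^sup>2)" "(LINT z|M. (snd z)\<^sup>2) = q"
    "integrable M (\<lambda>z. (snd z)^4)" "(LINT z|M. (snd z)^4) = 3 * q\<^sup>2"
  using gaussian_law_moments[OF assms(1)[unfolded bivariate_def], of "(1,0)" p]
    gaussian_law_moments[OF assms(1)[unfolded bivariate_def], of "(0,1)" q] assms(2,3)
  by (simp_all add: inner_prod_def)

section \<open>Lipschitz functions of Gaussian pairs\<close>

lemma lipschitz_real_bounds: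
  fixes f :: "real \<Rightarrow> real"
  assumes "C-lipschitz_on UNIV f"
  shows "\<bar>f x - f y\<bar> \<le> C * \<bar>x - y\<bar>" "\<bar>f x\<bar> \<le> \<bar>f 0\<bar> + C * \<bar>x\<bar>" "(f x)\<^sup>2 \<le> 2 * (f 0)\<^sup>2 + 2 * C\<^sup>2 * x\<^sup>2" "0 \<le> C"
proof -
  show d: "\<bar>f x - f y\<bar> \<le> C * \<bar>x - y\<bar>" for x y
    using lipschitz_onD[OF assms, of x y] by (simp add: dist_real_def)
  show b: "\<bar>f x\<bar> \<le> \<bar>f 0\<bar> + C * \<bar>x\<bar>" using d[of x 0] by simp
  have "(f x)\<^sup>2 \<le> (\<bar>f 0\<bar> + C * \<bar>x\<bar>)\<^sup>2" using power_mono[OF b, of 2] by simp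
  also have "\<dots> \<le> 2 * (f 0)\<^sup>2 + 2 * C\<^sup>2 * x\<^sup>2"
    using zero_le_power2[of "\<bar>f 0\<bar> - C * \<bar>x\<bar>"] by (simp add: power2_eq_square algebra_simps)
  finally show "(f x)\<^sup>2 \<le> 2 * (f 0)\<^sup>2 + 2 * C\<^sup>2 * x\<^sup>2" .
  show "0 \<le> C" using assms lipschitz_on_nonneg by blast
qed

lemma lipschitz_measurable [measurable_dest]:
  fixes f :: "real \<Rightarrow> real"
  assumes "C-lipschitz_on UNIV f" shows "f \<in> borel_measurable borel"
  using lipschitz_on_continuous_on[OF assms] by (rule borel_measurable_continuous_onI)

lemma integrable_lipschitz_product:
  fixes f g :: "real \<Rightarrow> real"
  assumes M: "bivariate p q r M" "p > 0" "q > 0" and f: "A-lipschitz_on UNIV f" and g: "B-lipschitz_on UNIV g"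
  shows "integrable M (\<lambda>z. f (fst z) * g (snd z))"
proof -
  interpret prob_space M using M(1) unfolding bivariate_def by (rule gaussian_law_prob_space)
  note [measurable_cong] = bivariate_sets[OF M(1)]
  note [measurable] = lipschitz_measurable[OF f] lipschitz_measurable[OF g]
  let ?h = "\<lambda>z. (2 * (f 0)\<^sup>2 + 2 * A\<^sup>2 * (fst z)\<^sup>2) + (2 * (g 0)\<^sup>2 + 2 * B\<^sup>2 * (snd z)\<^sup>2)"
  have h: "integrable M ?h" using bivariate_moments[OF M] by auto
  have m: "(\<lambda>z. f (fst z) * g (snd z)) \<in> borel_measurable M" by measurable
  have "\<bar>f x * g y\<bar> \<le> (f x)\<^sup>2 + (g y)\<^sup>2" for x y
  proof -
    have "2 * \<bar>f x * g y\<bar> \<le> (f x)\<^sup>2 + (g y)\<^sup>2"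
      using zero_le_power2[of "\<bar>f x\<bar> - \<bar>g y\<bar>"] by (simp add: power2_eq_square algebra_simps abs_mult)
    then show ?thesis using abs_ge_zero[of "f x * g y"] by linarith
  qed
  then have "\<bar>f (fst z) * g (snd z)\<bar> \<le> ?h z" for z
    using lipschitz_real_bounds(3)[OF f, of "fst z"] lipschitz_real_bounds(3)[OF g, of "snd z"] by (smt (verit))
  then have "AE z in M. norm (f (fst z) * g (snd z)) \<le> norm (?h z)" by (auto intro!: AE_I2 order_trans[OF _ abs_ge_self])
  then show ?thesis by (rule Bochner_Integration.integrable_bound[OF h m])
qed

text \<open>With \<open>X\<^sub>\<plusminus> = U\<^sub>1 \<plusminus> a H\<close> and \<open>Y\<^sub>\<plusminus> = U\<^sub>2 \<plusminus> b H\<close>, equal signs give the covariance \<open>r'\<close> and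
  opposite signs the covariance \<open>r\<close>, so twice the difference of the two expectations is
  \<open>E (f X\<^sub>+ - f X\<^sub>-) (g Y\<^sub>+ - g Y\<^sub>-)\<close>. A synchronous coupling would only give \<open>sqrt (r' - r)\<close>.\<close>
lemma bivariate_covariance_lipschitz_aux:
  fixes f g :: "real \<Rightarrow> real"
  assumes M: "bivariate p q r M" and M': "bivariate p q r' M'" and pq: "p > 0" "q > 0"
    and r: "- sqrt (p * q) \<le> r" "r \<le> r'" "r' \<le> sqrt (p * q)"
    and f: "A-lipschitz_on UNIV f" and g: "B-lipschitz_on UNIV g"
  shows "\<bar>(LINT z|M'. f (fst z) * g (snd z)) - (LINT z|M. f (fst z) * g (snd z))\<bar> \<le> A * B * (r' - r)"
proof -
  define h where "h = (r' - r) / 2"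
  define c where "c = (r + r') / 2"
  define P where "P = sqrt p"
  define Q where "Q = sqrt q"
  have PQ: "P > 0" "Q > 0" "p = P\<^sup>2" "q = Q\<^sup>2" "sqrt (p * q) = P * Q"
    using pq by (auto simp: P_def Q_def real_sqrt_mult)
  have h: "0 \<le> h" using r by (simp add: h_def)
  \<comment> \<open>The shared noise \<open>H\<close> must carry the covariance
    \<open>h = a * b\<close>. Splitting it in the ratio \<open>P : Q\<close> of the standard
    deviations leaves residual variances with product \<open>(P * Q - h)\<^sup>2\<close>, which is
    just enough to accommodate the mean covariance \<open>c\<close>.\<close>
  define a where "a = sqrt (h * P / Q)"
  define b where "b = sqrt (h * Q / P)"
  have ab: "a\<^sup>2 = h * P / Q" "b\<^sup>2 = h * Q / P" "a * b = h" "a \<ge> 0" "b \<ge> 0"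
    using h PQ by (auto simp: a_def b_def real_sqrt_mult[symmetric] simp flip: power2_eq_square)
  define p1 where "p1 = p - a\<^sup>2"
  define q1 where "q1 = q - b\<^sup>2"
  have hPQ: "h \<le> P * Q - \<bar>c\<bar>" using r unfolding PQ(5) h_def c_def by (simp add: abs_if field_simps)
  have p1: "p1 = P / Q * (P * Q - h)" and q1: "q1 = Q / P * (P * Q - h)"
    unfolding p1_def q1_def ab(1,2) PQ(3,4) using PQ(1,2) by (simp_all add: field_simps power2_eq_square)
  have p1q1: "p1 * q1 = (P * Q - h)\<^sup>2" using PQ(1,2) by (simp add: p1 q1 power2_eq_square field_simps)
  have nn: "p1 \<ge> 0" "q1 \<ge> 0" using hPQ PQ(1,2) by (auto simp: p1 q1)
  have "\<bar>c\<bar>\<^sup>2 \<le> (P * Q - h)\<^sup>2" using hPQ by (intro power_mono) auto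
  then have c2: "c\<^sup>2 \<le> p1 * q1" by (simp add: p1q1)
  \<comment> \<open>\<open>U\<^sub>1\<close> and \<open>U\<^sub>2\<close> are built from two
    independent normals, with \<open>d\<close> the conditional deviation of the second. If
    \<open>p1 = 0\<close> then \<open>c = 0\<close> as well, and the quotient is 0 by
    convention.\<close>
  define d where "d = sqrt (q1 - c\<^sup>2 / p1)"
  have d2: "c\<^sup>2 / p1 + d\<^sup>2 = q1"
  proof (cases "p1 = 0")
    case False
    then have "c\<^sup>2 / p1 \<le> q1" using c2 nn by (simp add: field_simps)
    then show ?thesis by (simp add: d_def)
  qed (use nn in \<open>simp add: d_def\<close>)
  have cp: "sqrt p1 * (c / sqrt p1) = c" using c2 nn by (cases "p1 = 0") auto
  have cp2: "(c / sqrt p1)\<^sup>2 = c\<^sup>2 / p1" using nn by (simp add: power_divide)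
  define W :: "real \<Rightarrow> real \<Rightarrow> nat \<Rightarrow> real \<times> real" where
    "W s t j = (if j = 0 then (sqrt p1, c / sqrt p1) else if j = 1 then (0, d) else (s * a, t * b))" for s t j
  define N where "N = PiM {..<3::nat} (\<lambda>_. normal_measure 1)"
  define X where "X s \<theta> = \<theta> 0 * sqrt p1 + \<theta> 2 * (s * a)" for s and \<theta> :: "nat \<Rightarrow> real"
  define Y where "Y t \<theta> = \<theta> 0 * (c / sqrt p1) + \<theta> 1 * d + \<theta> 2 * (t * b)" for t and \<theta> :: "nat \<Rightarrow> real"
  have sum3: "(\<Sum>j<3. F j) = F 0 + F 1 + F (2::nat)" for F :: "nat \<Rightarrow> 'z::comm_monoid_add"
    by (simp add: numeral_3_eq_3 numeral_2_eq_2)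
  have mX[measurable]: "X s \<in> borel_measurable N" "Y s \<in> borel_measurable N" for s
    unfolding X_def[abs_def] Y_def[abs_def] N_def by measurable
  have law: "bivariate p q (c + s * t * h) (distr N borel (\<lambda>\<theta>. (X s \<theta>, Y t \<theta>)))"
    if st: "s\<^sup>2 = 1" "t\<^sup>2 = 1" for s t
  proof -
    have "gaussian_law (distr N borel (\<lambda>\<theta>. \<Sum>j<3. \<theta> j *\<^sub>R W s t j)) (\<lambda>u. \<Sum>j<3. 1\<^sup>2 * (u \<bullet> W s t j)\<^sup>2)"
      unfolding N_def by (rule gaussian_law_linear_combination) auto
    moreover have "(\<Sum>j<3. \<theta> j *\<^sub>R W s t j) = (X s \<theta>, Y t \<theta>)" for \<theta>
      unfolding sum3 by (simp add: W_def X_def Y_def)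
    moreover have "(\<Sum>j<3. 1\<^sup>2 * (u \<bullet> W s t j)\<^sup>2) = p * (fst u)\<^sup>2 + 2 * (c + s * t * h) * fst u * snd u + q * (snd u)\<^sup>2" for u
    proof -
      have "(\<Sum>j<3. 1\<^sup>2 * (u \<bullet> W s t j)\<^sup>2) = ((sqrt p1)\<^sup>2 + s\<^sup>2 * a\<^sup>2) * (fst u)\<^sup>2
         + 2 * (sqrt p1 * (c / sqrt p1) + s * t * (a * b)) * fst u * snd u
         + ((c / sqrt p1)\<^sup>2 + d\<^sup>2 + t\<^sup>2 * b\<^sup>2) * (snd u)\<^sup>2"
        unfolding sum3 by (simp add: W_def inner_prod_def power2_eq_square algebra_simps)
      also have "\<dots> = p * (fst u)\<^sup>2 + 2 * (c + s * t * h) * fst u * snd u + q * (snd u)\<^sup>2"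
        unfolding cp cp2 d2 st ab(3) using nn by (simp add: p1_def q1_def)
      finally show ?thesis .
    qed
    ultimately show ?thesis unfolding bivariate_def by simp
  qed
  note fm[measurable] = lipschitz_measurable[OF f] lipschitz_measurable[OF g]
  have E: "integrable N (\<lambda>\<theta>. f (X s \<theta>) * g (Y t \<theta>))"
    "(LINT z|K. f (fst z) * g (snd z)) = (LINT \<theta>|N. f (X s \<theta>) * g (Y t \<theta>))"
    if st: "s\<^sup>2 = 1" "t\<^sup>2 = 1" and K: "bivariate p q (c + s * t * h) K" for s t K
  proof -
    have K': "K = distr N borel (\<lambda>\<theta>. (X s \<theta>, Y t \<theta>))" by (rule bivariate_unique[OF K law[OF st]])
    show "(LINT z|K. f (fst z) * g (snd z)) = (LINT \<theta>|N. f (X s \<theta>) * g (Y t \<theta>))"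
      unfolding K' by (subst integral_distr) (auto simp: borel_prod[symmetric])
    show "integrable N (\<lambda>\<theta>. f (X s \<theta>) * g (Y t \<theta>))"
      using integrable_lipschitz_product[OF law[OF st] pq f g]
      by (subst (asm) integrable_distr_eq) (auto simp: borel_prod[symmetric])
  qed
  have rr: "c + h = r'" "c - h = r" by (auto simp: c_def h_def field_simps)
  have E': "(LINT z|M'. f (fst z) * g (snd z)) = (LINT \<theta>|N. f (X s \<theta>) * g (Y s \<theta>))"
    "integrable N (\<lambda>\<theta>. f (X s \<theta>) * g (Y s \<theta>))"
    "(LINT z|M. f (fst z) * g (snd z)) = (LINT \<theta>|N. f (X s \<theta>) * g (Y (- s) \<theta>))"
    "integrable N (\<lambda>\<theta>. f (X s \<theta>) * g (Y (- s) \<theta>))"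
    if "s = 1 \<or> s = -1" for s
    using E[of s s M'] E[of s "-s" M] M M' that rr by auto
  let ?D = "\<lambda>\<theta>. (f (X 1 \<theta>) - f (X (-1) \<theta>)) * (g (Y 1 \<theta>) - g (Y (-1) \<theta>))"
  have D: "integrable N ?D" "2 * ((LINT z|M'. f (fst z) * g (snd z)) - (LINT z|M. f (fst z) * g (snd z))) = (LINT \<theta>|N. ?D \<theta>)"
    using E'[of 1] E'[of "-1"] by (simp_all add: algebra_simps)
  have th2: "integrable N (\<lambda>\<theta>. (\<theta> 2)\<^sup>2)" "(LINT \<theta>|N. (\<theta> 2)\<^sup>2) = 1"
  proof -
    have gl: "gaussian_law (distr N borel (\<lambda>\<theta>. \<Sum>j<3. \<theta> j *\<^sub>R (if j = 2 then 1 else 0))) (\<lambda>u. \<Sum>j<3::nat. 1\<^sup>2 * (u \<bullet> (if j = 2 then 1 else 0 :: real))\<^sup>2)"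
      unfolding N_def by (rule gaussian_law_linear_combination) auto
    have [measurable]: "(\<lambda>\<theta>. \<theta> 2) \<in> borel_measurable N" unfolding N_def by measurable
    show "integrable N (\<lambda>\<theta>. (\<theta> 2)\<^sup>2)" "(LINT \<theta>|N. (\<theta> 2)\<^sup>2) = 1"
      using gaussian_law_moments(1,2)[OF gl, of 1 1] by (auto simp: sum3 integrable_distr_eq integral_distr)
  qed
  have bnd: "\<bar>?D \<theta>\<bar> \<le> 4 * A * B * h * (\<theta> 2)\<^sup>2" for \<theta>
  proof -
    have "\<bar>?D \<theta>\<bar> \<le> (A * \<bar>X 1 \<theta> - X (-1) \<theta>\<bar>) * (B * \<bar>Y 1 \<theta> - Y (-1) \<theta>\<bar>)"
      unfolding abs_mult using lipschitz_real_bounds(1,4)[OF f] lipschitz_real_bounds(1,4)[OF g]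
      by (intro mult_mono) auto
    also have "\<dots> = A * B * (4 * (a * b)) * (\<theta> 2)\<^sup>2"
      using ab(4,5) by (simp add: X_def Y_def abs_mult power2_eq_square algebra_simps)
    finally show ?thesis unfolding ab(3) by (simp add: mult_ac)
  qed
  have "\<bar>LINT \<theta>|N. ?D \<theta>\<bar> \<le> (LINT \<theta>|N. \<bar>?D \<theta>\<bar>)" by (rule integral_abs_bound)
  also have "\<dots> \<le> (LINT \<theta>|N. 4 * A * B * h * (\<theta> 2)\<^sup>2)"
    using D(1) th2(1) bnd by (intro integral_mono integrable_abs integrable_mult_right) auto
  also have "\<dots> = 2 * (A * B * (r' - r))" by (simp add: th2 h_def)
  finally show ?thesis unfolding D(2)[symmetric] by (simp add: abs_mult)
qed

lemma bivariate_covariance_lipschitz: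
  fixes f g :: "real \<Rightarrow> real"
  assumes M: "bivariate p q r M" and M': "bivariate p q r' M'" and pq: "p > 0" "q > 0"
    and r: "\<bar>r\<bar> \<le> sqrt (p * q)" "\<bar>r'\<bar> \<le> sqrt (p * q)"
    and f: "A-lipschitz_on UNIV f" and g: "B-lipschitz_on UNIV g"
  shows "\<bar>(LINT z|M. f (fst z) * g (snd z)) - (LINT z|M'. f (fst z) * g (snd z))\<bar> \<le> A * B * \<bar>r - r'\<bar>"
proof (cases "r \<le> r'")
  case True
  then show ?thesis using bivariate_covariance_lipschitz_aux[OF M M' pq _ _ _ f g] r by (simp add: abs_minus_commute abs_le_iff)
next
  case False
  then show ?thesis using bivariate_covariance_lipschitz_aux[OF M' M pq _ _ _ f g] r by (simp add: abs_le_iff)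
qed


text \<open>Cauchy-Schwarz by way of the weighted arithmetic-geometric inequality \<open>am\<close>;
  taking the standard deviations as weights makes the integrated bounds come out exactly.\<close>

lemma bivariate_abs_bounds:
  assumes M: "bivariate p q r M" "p > 0" "q > 0"
  shows "integrable M (\<lambda>z. \<bar>fst z\<bar>)" "(LINT z|M. \<bar>fst z\<bar>) \<le> sqrt p"
    "integrable M (\<lambda>z. \<bar>snd z\<bar>)" "(LINT z|M. \<bar>snd z\<bar>) \<le> sqrt q"
    "integrable M (\<lambda>z. \<bar>fst z * snd z\<bar>)" "(LINT z|M. \<bar>fst z * snd z\<bar>) \<le> sqrt p * sqrt q"
proof -
  interpret prob_space M using M(1) unfolding bivariate_def by (rule gaussian_law_prob_space)
  note [measurable_cong] = bivariate_sets[OF M(1)]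
  note mom = bivariate_moments[OF M]
  have sq: "sqrt p > 0" "sqrt q > 0" using M by auto
  have am: "\<bar>x * y\<bar> \<le> (x\<^sup>2 * (v / u) + y\<^sup>2 * (u / v)) / 2" if "u > 0" "v > 0" for x y u v :: real
  proof -
    have "0 \<le> (\<bar>x\<bar> * v - \<bar>y\<bar> * u)\<^sup>2 / (u * v)" using that by simp
    also have "\<dots> = x\<^sup>2 * (v / u) + y\<^sup>2 * (u / v) - 2 * \<bar>x * y\<bar>"
      using that by (simp add: power2_eq_square field_simps abs_mult)
    finally show ?thesis by simp
  qed
  have gen: "integrable M k \<and> (LINT z|M. k z) \<le> c" if "integrable M h" "(LINT z|M. h z) \<le> c"
    "k \<in> borel_measurable M" "\<And>z. 0 \<le> k z" "\<And>z. k z \<le> h z" for k h :: "real \<times> real \<Rightarrow> real" and c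
  proof -
    have "\<bar>k z\<bar> \<le> \<bar>h z\<bar>" for z using that(4)[of z] that(5)[of z] by simp
    then have "integrable M k"
      by (intro Bochner_Integration.integrable_bound[OF that(1,3)]) auto
    then show ?thesis using integral_mono[OF _ that(1), of k] that(2,5) by force
  qed
  have "integrable M (\<lambda>z. \<bar>fst z\<bar>) \<and> (LINT z|M. \<bar>fst z\<bar>) \<le> sqrt p"
  proof (rule gen[of "\<lambda>z. ((fst z)\<^sup>2 * (1 / sqrt p) + 1\<^sup>2 * (sqrt p / 1)) / 2"])
    show "(LINT z|M. ((fst z)\<^sup>2 * (1 / sqrt p) + 1\<^sup>2 * (sqrt p / 1)) / 2) \<le> sqrt p"
      using mom M by (simp add: real_div_sqrt prob_space)
  qed (use mom am[OF sq(1) zero_less_one, of _ 1] in auto)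
  moreover have "integrable M (\<lambda>z. \<bar>snd z\<bar>) \<and> (LINT z|M. \<bar>snd z\<bar>) \<le> sqrt q"
  proof (rule gen[of "\<lambda>z. ((snd z)\<^sup>2 * (1 / sqrt q) + 1\<^sup>2 * (sqrt q / 1)) / 2"])
    show "(LINT z|M. ((snd z)\<^sup>2 * (1 / sqrt q) + 1\<^sup>2 * (sqrt q / 1)) / 2) \<le> sqrt q"
      using mom M by (simp add: real_div_sqrt prob_space)
  qed (use mom am[OF sq(2) zero_less_one, of _ 1] in auto)
  moreover have "integrable M (\<lambda>z. \<bar>fst z * snd z\<bar>) \<and> (LINT z|M. \<bar>fst z * snd z\<bar>) \<le> sqrt p * sqrt q"
  proof (rule gen[of "\<lambda>z. ((fst z)\<^sup>2 * (sqrt q / sqrt p) + (snd z)\<^sup>2 * (sqrt p / sqrt q)) / 2"])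
    have "p * (sqrt q / sqrt p) = sqrt p * sqrt q" "q * (sqrt p / sqrt q) = sqrt p * sqrt q"
      using M(2,3) sq by (simp_all add: field_simps)
    then show "(LINT z|M. ((fst z)\<^sup>2 * (sqrt q / sqrt p) + (snd z)\<^sup>2 * (sqrt p / sqrt q)) / 2) \<le> sqrt p * sqrt q"
      using mom M by simp
  qed (use mom am[OF sq] in auto)
  ultimately show "integrable M (\<lambda>z. \<bar>fst z\<bar>)" "(LINT z|M. \<bar>fst z\<bar>) \<le> sqrt p"
    "integrable M (\<lambda>z. \<bar>snd z\<bar>)" "(LINT z|M. \<bar>snd z\<bar>) \<le> sqrt q"
    "integrable M (\<lambda>z. \<bar>fst z * snd z\<bar>)" "(LINT z|M. \<bar>fst z * snd z\<bar>) \<le> sqrt p * sqrt q" by auto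
qed

text \<open>Separates changes of variance from changes of correlation: rescaling the coordinates
  gives them the prescribed deviations \<open>P'\<close> and \<open>Q'\<close>. The coordinates are
  rescaled one after the other, each time at a cost proportional to the change of the
  deviation.\<close>

lemma bivariate_scaling_bound:
  fixes \<phi> :: "real \<Rightarrow> real"
  assumes M: "bivariate p q r M" "p > 0" "q > 0" and f: "C-lipschitz_on UNIV \<phi>"
    and PQ': "P' > 0" "Q' > 0"
  defines "l1 \<equiv> P' / sqrt p" and "l2 \<equiv> Q' / sqrt q" and "\<alpha> \<equiv> \<bar>sqrt p - P'\<bar>" and "\<beta> \<equiv> \<bar>sqrt q - Q'\<bar>"
  shows "\<bar>(LINT z|M. \<phi> (fst z) * \<phi> (snd z)) - (LINT z|M. \<phi> (l1 * fst z) * \<phi> (l2 * snd z))\<bar>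
    \<le> C * \<alpha> * (\<bar>\<phi> 0\<bar> + C * sqrt q) + (\<bar>\<phi> 0\<bar> + C * P') * C * \<beta>"
proof -
  interpret prob_space M using M(1) unfolding bivariate_def by (rule gaussian_law_prob_space)
  note [measurable_cong] = bivariate_sets[OF M(1)]
  note [measurable] = lipschitz_measurable[OF f]
  note lip = lipschitz_real_bounds[OF f]
  define P where "P = sqrt p" define Q where "Q = sqrt q"
  have PQ: "P > 0" "Q > 0" using M by (auto simp: P_def Q_def)
  define C0 where "C0 = \<bar>\<phi> 0\<bar>"
  have C: "C \<ge> 0" "C0 \<ge> 0" using lip(4) by (auto simp: C0_def)
  have l: "l1 > 0" "l2 > 0" using PQ PQ' by (auto simp: l1_def l2_def P_def Q_def)
  have ab: "\<bar>1 - l1\<bar> = \<alpha> / P" "\<bar>1 - l2\<bar> = \<beta> / Q"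
    using PQ unfolding l1_def l2_def \<alpha>_def \<beta>_def P_def[symmetric] Q_def[symmetric]
    by (simp_all add: abs_if field_simps)
  let ?h = "\<lambda>z. C * (\<alpha> / P) * C0 * \<bar>fst z\<bar> + C * (\<alpha> / P) * C * \<bar>fst z * snd z\<bar>
      + (C0 * C * (\<beta> / Q) * \<bar>snd z\<bar> + C * l1 * C * (\<beta> / Q) * \<bar>fst z * snd z\<bar>)"
  have "(C * l)-lipschitz_on UNIV (\<lambda>x. \<phi> (l * x))" if "l > 0" for l
  proof (rule lipschitz_onI)
    fix x y
    have "l * x - l * y = l * (x - y)" by (simp add: algebra_simps)
    then show "dist (\<phi> (l * x)) (\<phi> (l * y)) \<le> C * l * dist x y"
      using lip(1)[of "l * x" "l * y"] that by (simp add: dist_real_def abs_mult mult.assoc)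
  qed (use that C in simp)
  note scaled = this[OF l(1)] this[OF l(2)]
  have int: "integrable M (\<lambda>z. \<phi> (fst z) * \<phi> (snd z))" "integrable M (\<lambda>z. \<phi> (l1 * fst z) * \<phi> (l2 * snd z))"
    using integrable_lipschitz_product[OF M f f] integrable_lipschitz_product[OF M scaled] by auto
  have pt: "\<bar>\<phi> x * \<phi> y - \<phi> (l1 * x) * \<phi> (l2 * y)\<bar> \<le> ?h (x, y)" for x y
  proof -
    have 1: "\<bar>\<phi> x - \<phi> (l1 * x)\<bar> \<le> C * ((\<alpha> / P) * \<bar>x\<bar>)" "\<bar>\<phi> y - \<phi> (l2 * y)\<bar> \<le> C * ((\<beta> / Q) * \<bar>y\<bar>)"
      using lip(1)[of x "l1 * x"] lip(1)[of y "l2 * y"] 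
      unfolding ab[symmetric] abs_mult[symmetric] by (simp_all add: algebra_simps)
    have 2: "\<bar>\<phi> y\<bar> \<le> C0 + C * \<bar>y\<bar>" "\<bar>\<phi> (l1 * x)\<bar> \<le> C0 + C * (l1 * \<bar>x\<bar>)"
      using lip(2)[of y] lip(2)[of "l1 * x"] l by (simp_all add: C0_def abs_mult)
    have "\<phi> x * \<phi> y - \<phi> (l1 * x) * \<phi> (l2 * y)
       = (\<phi> x - \<phi> (l1 * x)) * \<phi> y + \<phi> (l1 * x) * (\<phi> y - \<phi> (l2 * y))" by (simp add: algebra_simps)
    then have "\<bar>\<phi> x * \<phi> y - \<phi> (l1 * x) * \<phi> (l2 * y)\<bar>
      \<le> \<bar>\<phi> x - \<phi> (l1 * x)\<bar> * \<bar>\<phi> y\<bar> + \<bar>\<phi> (l1 * x)\<bar> * \<bar>\<phi> y - \<phi> (l2 * y)\<bar>"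
      by (metis abs_mult abs_triangle_ineq)
    also have "\<dots> \<le> (C * ((\<alpha> / P) * \<bar>x\<bar>)) * (C0 + C * \<bar>y\<bar>) + (C0 + C * (l1 * \<bar>x\<bar>)) * (C * ((\<beta> / Q) * \<bar>y\<bar>))"
      using 1 2 by (intro add_mono mult_mono) auto
    also have "\<dots> = ?h (x, y)" by (simp add: algebra_simps abs_mult add_divide_distrib)
    finally show ?thesis .
  qed
  note ai = bivariate_abs_bounds[OF M, folded P_def Q_def]
  have "\<bar>(LINT z|M. \<phi> (fst z) * \<phi> (snd z)) - (LINT z|M. \<phi> (l1 * fst z) * \<phi> (l2 * snd z))\<bar>
     = \<bar>LINT z|M. \<phi> (fst z) * \<phi> (snd z) - \<phi> (l1 * fst z) * \<phi> (l2 * snd z)\<bar>" using int by simp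
  also have "\<dots> \<le> (LINT z|M. \<bar>\<phi> (fst z) * \<phi> (snd z) - \<phi> (l1 * fst z) * \<phi> (l2 * snd z)\<bar>)"
    by (rule integral_abs_bound)
  also have "\<dots> \<le> (LINT z|M. ?h z)"
  proof (rule integral_mono)
    show "integrable M ?h"
      by (intro Bochner_Integration.integrable_add integrable_mult_right ai(1,3,5))
    show "integrable M (\<lambda>z. \<bar>\<phi> (fst z) * \<phi> (snd z) - \<phi> (l1 * fst z) * \<phi> (l2 * snd z)\<bar>)"
      by (intro integrable_abs Bochner_Integration.integrable_diff int)
  qed (use pt[of "fst _" "snd _"] in simp)
  also have "\<dots> = C * (\<alpha> / P) * C0 * (LINT z|M. \<bar>fst z\<bar>) + C * (\<alpha> / P) * C * (LINT z|M. \<bar>fst z * snd z\<bar>)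
      + (C0 * C * (\<beta> / Q) * (LINT z|M. \<bar>snd z\<bar>) + C * l1 * C * (\<beta> / Q) * (LINT z|M. \<bar>fst z * snd z\<bar>))"
    using ai by (simp del: abs_mult)
  also have "\<dots> \<le> C * (\<alpha> / P) * C0 * P + C * (\<alpha> / P) * C * (P * Q) + (C0 * C * (\<beta> / Q) * Q + C * l1 * C * (\<beta> / Q) * (P * Q))"
    using ai(2,4,6) C PQ l by (intro add_mono mult_left_mono) (auto simp: \<alpha>_def \<beta>_def)
  also have "\<dots> = C * \<alpha> * (C0 + C * Q) + (C0 + C * P') * C * \<beta>"
    using PQ by (simp add: field_simps l1_def P_def[symmetric])
  finally show ?thesis by (simp add: C0_def Q_def)
qed

text \<open>The variances are moved by scaling, then the covariance by
  \<open>bivariate_covariance_lipschitz\<close> at fixed variances. Positivity of \<open>p'\<close>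
  and \<open>q'\<close> keeps the square root away from its singularity at 0, so that differences of
  deviations are controlled by differences of variances; \<open>D\<close> involves only the limit
  values and \<open>\<phi>\<close>.\<close>

theorem bivariate_calm:
  fixes \<phi> :: "real \<Rightarrow> real"
  assumes f: "C-lipschitz_on UNIV \<phi>" and p': "p' > 0" "q' > 0" "r'\<^sup>2 \<le> p' * q'" and M': "bivariate p' q' r' M'"
  shows "\<exists>D\<ge>0. \<forall>p q r M. p > 0 \<longrightarrow> q > 0 \<longrightarrow> r\<^sup>2 \<le> p * q \<longrightarrow> bivariate p q r M \<longrightarrow>
     \<bar>(LINT z|M. \<phi> (fst z) * \<phi> (snd z)) - (LINT z|M'. \<phi> (fst z) * \<phi> (snd z))\<bar> \<le> D * (\<bar>p - p'\<bar> + \<bar>q - q'\<bar> + \<bar>r - r'\<bar>)"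
proof -
  define P' where "P' = sqrt p'" define Q' where "Q' = sqrt q'" define C0 where "C0 = \<bar>\<phi> 0\<bar>"
  have PQ': "P' > 0" "Q' > 0" "p' = P'\<^sup>2" "q' = Q'\<^sup>2" using p' by (auto simp: P'_def Q'_def)
  note [measurable] = lipschitz_measurable[OF f]
  have C: "C \<ge> 0" "C0 \<ge> 0" using lipschitz_real_bounds(4)[OF f] by (auto simp: C0_def)
  define D where "D = (C * C0 + 2 * (C * C * Q')) / P' + 2 * (C * C) + (C0 * C + 2 * (C * C * P')) / Q'"
  have "\<bar>(LINT z|M. \<phi> (fst z) * \<phi> (snd z)) - (LINT z|M'. \<phi> (fst z) * \<phi> (snd z))\<bar> \<le> D * (\<bar>p - p'\<bar> + \<bar>q - q'\<bar> + \<bar>r - r'\<bar>)"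
    if pqr: "p > 0" "q > 0" "r\<^sup>2 \<le> p * q" and M: "bivariate p q r M" for p q r M
  proof -
    define P where "P = sqrt p" define Q where "Q = sqrt q"
    have PQ: "P > 0" "Q > 0" "p = P\<^sup>2" "q = Q\<^sup>2" using pqr by (auto simp: P_def Q_def)
    define \<alpha> where "\<alpha> = \<bar>P - P'\<bar>" define \<beta> where "\<beta> = \<bar>Q - Q'\<bar>"
    define x where "x = \<bar>p - p'\<bar>" define y where "y = \<bar>q - q'\<bar>" define z where "z = \<bar>r - r'\<bar>"
    have xy: "x = \<alpha> * (P + P')" "y = \<beta> * (Q + Q')"
    proof -
      have "p - p' = (P - P') * (P + P')" "q - q' = (Q - Q') * (Q + Q')"
        by (simp_all add: PQ PQ' power2_eq_square algebra_simps)
      then show "x = \<alpha> * (P + P')" "y = \<beta> * (Q + Q')" using PQ(1,2) PQ'(1,2) by (simp_all add: x_def y_def \<alpha>_def \<beta>_def abs_mult)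
    qed
    have ab0: "\<alpha> \<ge> 0" "\<beta> \<ge> 0" by (auto simp: \<alpha>_def \<beta>_def)
    have al: "\<alpha> \<le> x / P'" "\<beta> \<le> y / Q'"
      using ab0 PQ PQ' by (simp_all add: xy pos_le_divide_eq mult_left_mono)
    \<comment> \<open>Since \<open>sqrt q\<close> is not bounded in advance, it is replaced by
      \<open>Q' + \<beta>\<close>; the mixed term \<open>\<alpha> * \<beta>\<close> this creates is
      again of first order in the variances.\<close>
    have "\<alpha> * \<alpha> \<le> x" "\<beta> * \<beta> \<le> y" unfolding xy using ab0 PQ(1,2) PQ'(1,2)
      by (intro mult_left_mono; simp add: \<alpha>_def \<beta>_def abs_if)+
    moreover have "2 * (\<alpha> * \<beta>) \<le> \<alpha> * \<alpha> + \<beta> * \<beta>"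
      using zero_le_power2[of "\<alpha> - \<beta>"] by (simp add: power2_eq_square algebra_simps)
    moreover have "0 \<le> \<alpha> * \<beta>" using ab0 by simp
    ultimately have albe: "\<alpha> * \<beta> \<le> x + y" by linarith
    \<comment> \<open>The covariance after rescaling. The correlation is unchanged, so the bound
      \<open>P' * Q'\<close> is respected, and the shift from \<open>r\<close> is at most the change
      of \<open>P * Q\<close>.\<close>
    define \<rho> where "\<rho> = P' / P * (Q' / Q) * r"
    define M1 where "M1 = distr M borel (\<lambda>z. (P' / P * fst z, Q' / Q * snd z))"
    note [measurable_cong] = bivariate_sets[OF M]
    have m1: "(\<lambda>z. (P' / P * fst z, Q' / Q * snd z)) \<in> borel_measurable borel"
      unfolding borel_prod[symmetric] by measurable
    have M1: "bivariate p' q' \<rho> M1"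
    proof -
      have "gaussian_law M1 (\<lambda>t. p * (fst (P' / P * fst t, Q' / Q * snd t))\<^sup>2 
          + 2 * r * fst (P' / P * fst t, Q' / Q * snd t) * snd (P' / P * fst t, Q' / Q * snd t) + q * (snd (P' / P * fst t, Q' / Q * snd t))\<^sup>2)"
        unfolding M1_def by (rule gaussian_law_linear_image[OF M[unfolded bivariate_def] m1]) (simp add: inner_prod_def mult_ac)
      moreover have "p * (fst (P' / P * fst t, Q' / Q * snd t))\<^sup>2 
          + 2 * r * fst (P' / P * fst t, Q' / Q * snd t) * snd (P' / P * fst t, Q' / Q * snd t) + q * (snd (P' / P * fst t, Q' / Q * snd t))\<^sup>2
         = p' * (fst t)\<^sup>2 + 2 * \<rho> * fst t * snd t + q' * (snd t)\<^sup>2" for t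
        unfolding PQ(3,4) PQ'(3,4) \<rho>_def using PQ(1,2) by (simp add: field_simps power2_eq_square)
      ultimately show ?thesis unfolding bivariate_def by simp
    qed
    have r: "\<bar>r\<bar> \<le> P * Q" 
      using real_sqrt_le_mono[OF pqr(3)] by (simp add: P_def Q_def real_sqrt_mult)
    have r': "\<bar>r'\<bar> \<le> P' * Q'" 
      using real_sqrt_le_mono[OF p'(3)] by (simp add: P'_def Q'_def real_sqrt_mult)
    have sPQ': "sqrt (p' * q') = P' * Q'" by (simp add: P'_def Q'_def real_sqrt_mult)
    have rho: "\<bar>\<rho>\<bar> \<le> P' * Q'"
    proof -
      have "\<bar>\<rho>\<bar> = P' * Q' / (P * Q) * \<bar>r\<bar>" using PQ PQ' by (simp add: \<rho>_def abs_mult)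
      also have "\<dots> \<le> P' * Q' / (P * Q) * (P * Q)" using r PQ PQ' by (intro mult_left_mono) auto
      finally show ?thesis using PQ by simp
    qed
    have t2: "\<bar>\<rho> - r'\<bar> \<le> P' * \<beta> + Q' * \<alpha> + \<alpha> * \<beta> + z"
    proof -
      have "\<rho> - r = r * ((P' * Q' - P * Q) / (P * Q))" using PQ by (simp add: \<rho>_def field_simps)
      then have "\<bar>\<rho> - r\<bar> = \<bar>r\<bar> * (\<bar>P' * Q' - P * Q\<bar> / (P * Q))" using PQ by (simp add: abs_mult)
      also have "\<dots> \<le> (P * Q) * (\<bar>P' * Q' - P * Q\<bar> / (P * Q))" using r PQ by (intro mult_right_mono) auto
      also have "\<dots> = \<bar>P' * (Q' - Q) + Q' * (P' - P) + (P' - P) * (Q - Q')\<bar>" using PQ by (simp add: algebra_simps)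
      also have "\<dots> \<le> \<bar>P' * (Q' - Q)\<bar> + \<bar>Q' * (P' - P)\<bar> + \<bar>(P' - P) * (Q - Q')\<bar>" by linarith
      also have "\<dots> = P' * \<beta> + Q' * \<alpha> + \<alpha> * \<beta>" using PQ' by (simp add: \<alpha>_def \<beta>_def abs_mult abs_minus_commute)
      finally show ?thesis unfolding z_def by linarith
    qed
    have "\<bar>(LINT z|M1. \<phi> (fst z) * \<phi> (snd z)) - (LINT z|M'. \<phi> (fst z) * \<phi> (snd z))\<bar> \<le> C * C * \<bar>\<rho> - r'\<bar>"
      by (rule bivariate_covariance_lipschitz[OF M1 M' p'(1,2) _ _ f f]) (use rho r' sPQ' in auto)
    also have "\<dots> \<le> C * C * (P' * \<beta> + Q' * \<alpha> + \<alpha> * \<beta> + z)" using t2 C by (intro mult_left_mono) auto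
    finally have 2: "\<bar>(LINT z|M1. \<phi> (fst z) * \<phi> (snd z)) - (LINT z|M'. \<phi> (fst z) * \<phi> (snd z))\<bar> 
       \<le> C * C * (P' * \<beta> + Q' * \<alpha> + \<alpha> * \<beta> + z)" .
    have M1i: "(LINT z|M1. \<phi> (fst z) * \<phi> (snd z)) = (LINT z|M. \<phi> (P' / P * fst z) * \<phi> (Q' / Q * snd z))"
      unfolding M1_def by (subst integral_distr) (auto simp: borel_prod[symmetric])
    have "\<bar>(LINT z|M. \<phi> (fst z) * \<phi> (snd z)) - (LINT z|M1. \<phi> (fst z) * \<phi> (snd z))\<bar>
        \<le> C * \<alpha> * (C0 + C * Q) + (C0 + C * P') * C * \<beta>"
      using bivariate_scaling_bound[OF M pqr(1,2) f PQ'(1,2)] unfolding M1i P_def Q_def \<alpha>_def \<beta>_def C0_def .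
    also have "\<dots> \<le> C * \<alpha> * (C0 + C * (Q' + \<beta>)) + (C0 + C * P') * C * \<beta>"
      using C ab0 PQ'(1) by (intro add_mono mult_left_mono) (auto simp: \<beta>_def)
    finally have 1: "\<bar>(LINT z|M. \<phi> (fst z) * \<phi> (snd z)) - (LINT z|M1. \<phi> (fst z) * \<phi> (snd z))\<bar>
        \<le> C * \<alpha> * (C0 + C * (Q' + \<beta>)) + (C0 + C * P') * C * \<beta>" .
    have "C * \<alpha> * (C0 + C * (Q' + \<beta>)) + (C0 + C * P') * C * \<beta> + C * C * (P' * \<beta> + Q' * \<alpha> + \<alpha> * \<beta> + z)
      = (C * C0 + 2 * (C * C * Q')) * \<alpha> + 2 * (C * C) * (\<alpha> * \<beta>) + (C0 * C + 2 * (C * C * P')) * \<beta> + C * C * z"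
      by (simp add: algebra_simps)
    also have "\<dots> \<le> (C * C0 + 2 * (C * C * Q')) * (x / P') + 2 * (C * C) * (x + y) + (C0 * C + 2 * (C * C * P')) * (y / Q') + C * C * z"
      using C PQ' al albe by (intro add_mono mult_left_mono) auto
    also have "\<dots> \<le> D * (x + y + z)"
    proof -
      have nn: "(C * C0 + 2 * (C * C * Q')) / P' \<ge> 0" "(C0 * C + 2 * (C * C * P')) / Q' \<ge> 0" "C * C \<ge> 0" "x \<ge> 0" "y \<ge> 0" "z \<ge> 0"
        using C PQ' by (auto simp: x_def y_def z_def)
      have "D * (x + y + z) = (C * C0 + 2 * (C * C * Q')) * (x / P') + 2 * (C * C) * (x + y) + (C0 * C + 2 * (C * C * P')) * (y / Q') + C * C * z
        + ((C * C0 + 2 * (C * C * Q')) / P' * (y + z) + (C0 * C + 2 * (C * C * P')) / Q' * (x + z) + C * C * z)"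
        by (simp add: D_def algebra_simps add_divide_distrib)
      moreover have "(C * C0 + 2 * (C * C * Q')) / P' * (y + z) + (C0 * C + 2 * (C * C * P')) / Q' * (x + z) + C * C * z \<ge> 0"
        using nn C(1) by (intro add_nonneg_nonneg mult_nonneg_nonneg) auto
      ultimately show ?thesis by linarith
    qed
    finally show ?thesis using 1 2 unfolding x_def y_def z_def by linarith
  qed
  moreover have "D \<ge> 0" using C PQ' by (auto simp: D_def)
  ultimately show ?thesis by blast
qed

section \<open>The kernel map on covariance matrices\<close>

lemma gauss_vec_sets [measurable_cong]: "sets (gauss_vec S) = sets borel"
  by (simp add: gauss_vec_def)

lemma gauss_vec_prob_space: "psd S \<Longrightarrow> prob_space (gauss_vec S)"
  by (rule gaussian_law_prob_space[OF gaussian_law_gauss_vec])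

lemma bivariate_marginal:
  fixes S :: "real^'k^'k::finite"
  assumes "psd S"
  shows "bivariate (S $ i $ i) (S $ j $ j) (S $ i $ j) (distr (gauss_vec S) borel (\<lambda>Z. (Z $ i, Z $ j)))"
proof -
  have m: "(\<lambda>Z::real^'k. (Z $ i, Z $ j)) \<in> borel_measurable borel"
    by (intro borel_measurable_continuous_onI continuous_intros)
  have "gaussian_law (distr (gauss_vec S) borel (\<lambda>Z. (Z $ i, Z $ j)))
     (\<lambda>t. (fst t *\<^sub>R axis i 1 + snd t *\<^sub>R axis j 1) \<bullet> (S *v (fst t *\<^sub>R axis i 1 + snd t *\<^sub>R axis j 1)))"
    by (rule gaussian_law_linear_image[OF gaussian_law_gauss_vec[OF assms] m])
       (simp add: inner_prod_def inner_add_left inner_axis')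
  moreover have "(fst t *\<^sub>R axis i 1 + snd t *\<^sub>R axis j 1) \<bullet> (S *v (fst t *\<^sub>R axis i 1 + snd t *\<^sub>R axis j 1))
     = S $ i $ i * (fst t)\<^sup>2 + 2 * S $ i $ j * fst t * snd t + S $ j $ j * (snd t)\<^sup>2" for t :: "real \<times> real"
    using psd_sym[OF assms, of j i]
    by (simp add: matrix_vector_right_distrib matrix_vector_mult_scaleR inner_add_left inner_add_right
        entry_eq_inner[symmetric] power2_eq_square algebra_simps)
  ultimately show ?thesis unfolding bivariate_def by simp
qed

lemma quadratic_form_sum:
  "v \<bullet> ((\<chi> i j. M i j) *v v) = (\<Sum>i\<in>UNIV. \<Sum>j\<in>UNIV. v $ i * v $ j * M i j)"
  by (simp add: inner_vec_def matrix_vector_mult_def sum_distrib_left mult_ac)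

lemma square_sum_expand: "(\<Sum>i\<in>A. f i :: real)\<^sup>2 = (\<Sum>i\<in>A. \<Sum>j\<in>A. f i * f j)"
  by (simp add: power2_eq_square sum_product)

context
  fixes \<phi> :: "real \<Rightarrow> real" and C :: real
  assumes lip: "C-lipschitz_on UNIV \<phi>"
begin

lemma gexp_integrable_bivariate:
  fixes S :: "real^'k^'k::finite"
  assumes S: "psd S" "\<And>i. S $ i $ i > 0"
  shows "integrable (gauss_vec S) (\<lambda>Z. \<phi> (Z $ i) * \<phi> (Z $ j))"
    "gexp S \<phi> i j = (LINT z|distr (gauss_vec S) borel (\<lambda>Z. (Z $ i, Z $ j)). \<phi> (fst z) * \<phi> (snd z))"
proof -
  note [measurable] = lipschitz_measurable[OF lip]
  have [measurable]: "(\<lambda>Z::real^'k. (Z $ i, Z $ j)) \<in> borel_measurable borel"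
    by (intro borel_measurable_continuous_onI continuous_intros)
  show "integrable (gauss_vec S) (\<lambda>Z. \<phi> (Z $ i) * \<phi> (Z $ j))"
    using integrable_lipschitz_product[OF bivariate_marginal[OF S(1)] S(2) S(2) lip lip, of i j]
    by (subst (asm) integrable_distr_eq) (auto simp: borel_prod[symmetric])
  show "gexp S \<phi> i j = (LINT z|distr (gauss_vec S) borel (\<lambda>Z. (Z $ i, Z $ j)). \<phi> (fst z) * \<phi> (snd z))"
    unfolding gexp_def by (subst integral_distr) (auto simp: borel_prod[symmetric])
qed

text \<open>An entry depends on \<open>S\<close> only through a two-dimensional marginal, so
  \<open>bivariate_calm\<close> applies; the sum of the constants over all pairs of indices serves
  every entry.\<close>

lemma gexp_calm:
  fixes K :: "real^'k^'k::finite"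
  assumes K: "psd K" "\<And>i. K $ i $ i > 0"
  shows "\<exists>D\<ge>0. \<forall>S i j. psd S \<longrightarrow> (\<forall>i. S $ i $ i > 0) \<longrightarrow>
    \<bar>gexp S \<phi> i j - gexp K \<phi> i j\<bar> \<le> D * (\<bar>S $ i $ i - K $ i $ i\<bar> + \<bar>S $ j $ j - K $ j $ j\<bar> + \<bar>S $ i $ j - K $ i $ j\<bar>)"
proof -
  have "\<exists>D\<ge>0. \<forall>S. psd S \<longrightarrow> (\<forall>i. S $ i $ i > 0) \<longrightarrow>
    \<bar>gexp S \<phi> i j - gexp K \<phi> i j\<bar> \<le> D * (\<bar>S $ i $ i - K $ i $ i\<bar> + \<bar>S $ j $ j - K $ j $ j\<bar> + \<bar>S $ i $ j - K $ i $ j\<bar>)" for i j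
  proof -
    obtain D where D: "D \<ge> 0" "\<And>p q r M. p > 0 \<Longrightarrow> q > 0 \<Longrightarrow> r\<^sup>2 \<le> p * q \<Longrightarrow> bivariate p q r M \<Longrightarrow>
      \<bar>(LINT z|M. \<phi> (fst z) * \<phi> (snd z)) - gexp K \<phi> i j\<bar> \<le> D * (\<bar>p - K $ i $ i\<bar> + \<bar>q - K $ j $ j\<bar> + \<bar>r - K $ i $ j\<bar>)"
      using bivariate_calm[OF lip K(2) K(2) psd_entry_bound[OF K(1)] bivariate_marginal[OF K(1)], of i j]
      unfolding gexp_integrable_bivariate(2)[OF K] by blast
    show ?thesis
    proof (intro exI[of _ D] conjI allI impI D(1))
      fix S :: "real^'k^'k" assume S: "psd S" "\<forall>i. S $ i $ i > 0"
      show "\<bar>gexp S \<phi> i j - gexp K \<phi> i j\<bar> \<le> D * (\<bar>S $ i $ i - K $ i $ i\<bar> + \<bar>S $ j $ j - K $ j $ j\<bar> + \<bar>S $ i $ j - K $ i $ j\<bar>)"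
        using D(2)[OF _ _ psd_entry_bound[OF S(1)] bivariate_marginal[OF S(1)], of i j] S
        by (simp add: gexp_integrable_bivariate(2))
    qed
  qed
  then obtain D where D: "\<And>i j. D i j \<ge> 0" "\<And>i j S. psd S \<Longrightarrow> (\<forall>i. S $ i $ i > 0) \<Longrightarrow>
    \<bar>gexp S \<phi> i j - gexp K \<phi> i j\<bar> \<le> D i j * (\<bar>S $ i $ i - K $ i $ i\<bar> + \<bar>S $ j $ j - K $ j $ j\<bar> + \<bar>S $ i $ j - K $ i $ j\<bar>)"
    by metis
  have le: "D i j \<le> (\<Sum>i\<in>UNIV. \<Sum>j\<in>UNIV. D i j)" for i j
  proof -
    have "D i j \<le> (\<Sum>j\<in>UNIV. D i j)" using D(1) by (intro member_le_sum) auto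
    also have "\<dots> \<le> (\<Sum>i\<in>UNIV. \<Sum>j\<in>UNIV. D i j)"
      using D(1) by (intro member_le_sum[of i UNIV "\<lambda>i. \<Sum>j\<in>UNIV. D i j"]) (auto intro: sum_nonneg)
    finally show ?thesis .
  qed
  show ?thesis
  proof (intro exI[of _ "\<Sum>i\<in>UNIV. \<Sum>j\<in>UNIV. D i j"] conjI allI impI)
    show "0 \<le> (\<Sum>i\<in>UNIV. \<Sum>j\<in>UNIV. D i j)" using D(1) by (auto intro!: sum_nonneg)
    fix S :: "real^'k^'k" and i j assume "psd S" "\<forall>i. S $ i $ i > 0"
    then show "\<bar>gexp S \<phi> i j - gexp K \<phi> i j\<bar> \<le> (\<Sum>i\<in>UNIV. \<Sum>j\<in>UNIV. D i j) * (\<bar>S $ i $ i - K $ i $ i\<bar> + \<bar>S $ j $ j - K $ j $ j\<bar> + \<bar>S $ i $ j - K $ i $ j\<bar>)"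
      by (intro order_trans[OF D(2)] mult_right_mono[OF le]) auto
  qed
qed

text \<open>Provides the variance for the law of large numbers. The bound is written as a square so
  that its root, the actual error, is linear in the diagonal of \<open>S\<close>: averaging over a
  random kernel then costs a first moment only.\<close>

lemma gauss_vec_product_second_moment:
  "\<exists>B\<ge>0. \<forall>(S :: real^'k^'k::finite) i j. psd S \<longrightarrow> (\<forall>i. S $ i $ i > 0) \<longrightarrow>
     integrable (gauss_vec S) (\<lambda>Z. (\<phi> (Z $ i) * \<phi> (Z $ j))\<^sup>2) \<and>
     (LINT Z|gauss_vec S. (\<phi> (Z $ i) * \<phi> (Z $ j))\<^sup>2) \<le> (B * (1 + S $ i $ i + S $ j $ j))\<^sup>2"
proof -
  note [measurable] = lipschitz_measurable[OF lip]
  define c0 where "c0 = 8 * (\<phi> 0)^4"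
  define c1 where "c1 = 8 * C^4"
  have c: "c0 \<ge> 0" "c1 \<ge> 0" by (auto simp: c0_def c1_def)
  have f4: "(\<phi> x)^4 \<le> c0 + c1 * x^4" for x
  proof -
    have "((\<phi> x)\<^sup>2)\<^sup>2 \<le> (2 * (\<phi> 0)\<^sup>2 + 2 * C\<^sup>2 * x\<^sup>2)\<^sup>2" by (intro power_mono lipschitz_real_bounds(3)[OF lip]) auto
    also have "\<dots> \<le> 8 * ((\<phi> 0)\<^sup>2)\<^sup>2 + 8 * (C\<^sup>2 * x\<^sup>2)\<^sup>2"
      using zero_le_power2[of "2 * (\<phi> 0)\<^sup>2 - 2 * C\<^sup>2 * x\<^sup>2"] by (simp add: power2_eq_square algebra_simps)
    finally show ?thesis by (simp add: c0_def c1_def power_mult_distrib)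
  qed
  have xy: "(x * y)\<^sup>2 \<le> (x^4 + y^4) / 2" for x y :: real
  proof -
    have "0 \<le> (x\<^sup>2 - y\<^sup>2)\<^sup>2" by simp
    then show ?thesis by (simp add: power2_eq_square power4_eq_xxxx algebra_simps)
  qed
  \<comment> \<open>\<open>c0 + c1 * x^4\<close> dominates the fourth power of
    \<open>\<phi>\<close>, and the fourth moment of a centred normal is three times the squared
    variance.\<close>
  define B where "B = sqrt (c0 + 3 * c1)"
  have B: "B \<ge> 0" "B\<^sup>2 = c0 + 3 * c1" using c by (auto simp: B_def)
  have "integrable (gauss_vec S) (\<lambda>Z. (\<phi> (Z $ i) * \<phi> (Z $ j))\<^sup>2) \<and>
     (LINT Z|gauss_vec S. (\<phi> (Z $ i) * \<phi> (Z $ j))\<^sup>2) \<le> (B * (1 + S $ i $ i + S $ j $ j))\<^sup>2"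
    if S: "psd S" "\<forall>i. S $ i $ i > 0" for S :: "real^'k^'k" and i j
  proof -
    interpret prob_space "gauss_vec S" by (rule gauss_vec_prob_space[OF S(1)])
    have [measurable]: "(\<lambda>Z::real^'k. (Z $ i, Z $ j)) \<in> borel_measurable borel"
      by (intro borel_measurable_continuous_onI continuous_intros)
    note bm = bivariate_moments[OF bivariate_marginal[OF S(1), of i j]]
    have m4: "integrable (gauss_vec S) (\<lambda>Z. (Z $ i)^4)" "(LINT Z|gauss_vec S. (Z $ i)^4) = 3 * (S $ i $ i)\<^sup>2"
      "integrable (gauss_vec S) (\<lambda>Z. (Z $ j)^4)" "(LINT Z|gauss_vec S. (Z $ j)^4) = 3 * (S $ j $ j)\<^sup>2"
      using bm(3,4,7,8) S(2) by (auto simp: integrable_distr_eq integral_distr borel_prod[symmetric])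
    let ?h = "\<lambda>Z. ((c0 + c1 * (Z $ i)^4) + (c0 + c1 * (Z $ j)^4)) / 2"
    have h: "integrable (gauss_vec S) ?h" using m4 by auto
    have le: "(\<phi> (Z $ i) * \<phi> (Z $ j))\<^sup>2 \<le> ?h Z" for Z
      using xy[of "\<phi> (Z $ i)" "\<phi> (Z $ j)"] f4[of "Z $ i"] f4[of "Z $ j"] by simp
    have meas: "(\<lambda>Z. (\<phi> (Z $ i) * \<phi> (Z $ j))\<^sup>2) \<in> borel_measurable (gauss_vec S)" by measurable
    have int: "integrable (gauss_vec S) (\<lambda>Z. (\<phi> (Z $ i) * \<phi> (Z $ j))\<^sup>2)"
      using le by (intro Bochner_Integration.integrable_bound[OF h meas]) (auto intro!: AE_I2 order_trans[OF _ abs_ge_self])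
    have "(LINT Z|gauss_vec S. (\<phi> (Z $ i) * \<phi> (Z $ j))\<^sup>2) \<le> (LINT Z|gauss_vec S. ?h Z)"
      using int h le by (intro integral_mono)
    also have "\<dots> = c0 + 3 * c1 / 2 * ((S $ i $ i)\<^sup>2 + (S $ j $ j)\<^sup>2)"
      using m4 by (simp add: prob_space algebra_simps add_divide_distrib)
    also have "\<dots> \<le> B\<^sup>2 * (1 + (S $ i $ i)\<^sup>2 + (S $ j $ j)\<^sup>2)"
    proof -
      have "0 \<le> (c0 + 3 * c1 / 2) * ((S $ i $ i)\<^sup>2 + (S $ j $ j)\<^sup>2) + 3 * c1" using c by simp
      then show ?thesis unfolding B by (simp add: algebra_simps)
    qed
    also have "\<dots> \<le> B\<^sup>2 * (1 + S $ i $ i + S $ j $ j)\<^sup>2"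
      using S(2)[rule_format, of i] S(2)[rule_format, of j]
      by (intro mult_left_mono) (auto simp: power2_eq_square algebra_simps intro!: add_nonneg_nonneg)
    finally show ?thesis using int by (simp add: power_mult_distrib)
  qed
  then show ?thesis using B(1) by blast
qed

text \<open>The quadratic form is \<open>w\<close> times the expectation of a square, plus
  \<open>c\<close> times the square of the sum of the entries of \<open>v\<close>.\<close>

lemma psd_gexp_kernel:
  fixes S :: "real^'k^'k::finite"
  assumes S: "psd S" "\<And>i. S $ i $ i > 0" and w: "w \<ge> 0" "c \<ge> 0"
  shows "psd (\<chi> i j. w * gexp S \<phi> i j + c)"
proof -
  note int = gexp_integrable_bivariate(1)[OF S]
  have "0 \<le> v \<bullet> ((\<chi> i j. w * gexp S \<phi> i j + c) *v v)" for v :: "real^'k"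
  proof -
    have "(\<Sum>i\<in>UNIV. \<Sum>j\<in>UNIV. v $ i * v $ j * gexp S \<phi> i j)
      = (LINT Z|gauss_vec S. (\<Sum>i\<in>UNIV. \<Sum>j\<in>UNIV. v $ i * v $ j * (\<phi> (Z $ i) * \<phi> (Z $ j))))"
      using int by (simp add: gexp_def)
    also have "\<dots> = (LINT Z|gauss_vec S. (\<Sum>i\<in>UNIV. v $ i * \<phi> (Z $ i))\<^sup>2)"
      by (simp add: square_sum_expand mult_ac)
    also have "\<dots> \<ge> 0" by simp
    finally have 1: "0 \<le> (\<Sum>i\<in>UNIV. \<Sum>j\<in>UNIV. v $ i * v $ j * gexp S \<phi> i j)" .
    have "v \<bullet> ((\<chi> i j. w * gexp S \<phi> i j + c) *v v)
       = w * (\<Sum>i\<in>UNIV. \<Sum>j\<in>UNIV. v $ i * v $ j * gexp S \<phi> i j) + c * (\<Sum>i\<in>UNIV. v $ i)\<^sup>2"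
      unfolding quadratic_form_sum square_sum_expand by (simp add: sum_distrib_left sum.distrib algebra_simps)
    then show ?thesis using 1 w by simp
  qed
  moreover have "gexp S \<phi> i j = gexp S \<phi> j i" for i j unfolding gexp_def by (simp add: mult.commute)
  ultimately show ?thesis unfolding psd_def transpose_def by (simp add: vec_eq_iff)
qed

lemma gexp_diag_nonneg: "0 \<le> gexp S \<phi> i i"
  unfolding gexp_def by simp

end

lemma psd_Gram:
  fixes g :: "'u \<Rightarrow> 'k::finite \<Rightarrow> real"
  assumes "w \<ge> 0" "c \<ge> 0"
  shows "psd ((\<chi> i j. w * (\<Sum>u\<in>U. g u i * g u j) + c) :: real^'k^'k)"
proof -
  have "0 \<le> v \<bullet> ((\<chi> i j. w * (\<Sum>u\<in>U. g u i * g u j) + c) *v v)" for v :: "real^'k"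
  proof -
    have "(\<Sum>u\<in>U. (\<Sum>i\<in>UNIV. v $ i * g u i)\<^sup>2) = (\<Sum>i\<in>UNIV. \<Sum>j\<in>UNIV. v $ i * v $ j * (\<Sum>u\<in>U. g u i * g u j))"
    proof -
      have "(\<Sum>u\<in>U. (\<Sum>i\<in>UNIV. v $ i * g u i)\<^sup>2) = (\<Sum>u\<in>U. \<Sum>i\<in>UNIV. \<Sum>j\<in>UNIV. (v $ i * g u i) * (v $ j * g u j))"
        by (intro sum.cong refl square_sum_expand)
      also have "\<dots> = (\<Sum>i\<in>UNIV. \<Sum>j\<in>UNIV. \<Sum>u\<in>U. (v $ i * g u i) * (v $ j * g u j))"
        by (subst sum.swap) (intro sum.cong refl sum.swap)
      finally show ?thesis by (simp add: sum_distrib_left mult_ac)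
    qed
    then have "v \<bullet> ((\<chi> i j. w * (\<Sum>u\<in>U. g u i * g u j) + c) *v v)
       = w * (\<Sum>u\<in>U. (\<Sum>i\<in>UNIV. v $ i * g u i)\<^sup>2) + c * (\<Sum>i\<in>UNIV. v $ i)\<^sup>2"
      unfolding quadratic_form_sum square_sum_expand[of "\<lambda>i. v $ i"] by (simp add: sum_distrib_left sum.distrib algebra_simps)
    then show ?thesis using assms by (simp add: sum_nonneg)
  qed
  then show ?thesis unfolding psd_def transpose_def by (simp add: vec_eq_iff mult.commute)
qed

section \<open>Empirical kernels\<close>

text \<open>A Chebyshev-type bound in mean: the centred summands are pairwise uncorrelated, so only
  the diagonal terms contribute to the second moment of the average.\<close>

lemma (in prob_space) average_L1_bound:
  fixes Y :: "'u \<Rightarrow> 'a \<Rightarrow> real"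
  assumes U: "finite U" "U \<noteq> {}"
    and meas: "\<And>u. u \<in> U \<Longrightarrow> Y u \<in> borel_measurable M"
    and sq: "\<And>u. u \<in> U \<Longrightarrow> integrable M (\<lambda>\<omega>. (Y u \<omega>)\<^sup>2)" "\<And>u. u \<in> U \<Longrightarrow> expectation (\<lambda>\<omega>. (Y u \<omega>)\<^sup>2) \<le> V"
    and mean: "\<And>u. u \<in> U \<Longrightarrow> expectation (Y u) = m"
    and uncorr: "\<And>u v. u \<in> U \<Longrightarrow> v \<in> U \<Longrightarrow> u \<noteq> v \<Longrightarrow> expectation (\<lambda>\<omega>. Y u \<omega> * Y v \<omega>) = m\<^sup>2"
  shows "(\<integral>\<^sup>+\<omega>. \<bar>(\<Sum>u\<in>U. Y u \<omega>) / card U - m\<bar> \<partial>M) \<le> ennreal (sqrt (V / card U))"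
proof -
  let ?n = "real (card U)"
  have n: "?n > 0" using U by (simp add: card_gt_0_iff)
  have intY: "integrable M (Y u)" if "u \<in> U" for u
    by (rule square_integrable_imp_integrable[OF meas[OF that] sq(1)[OF that]])
  have intYY: "integrable M (\<lambda>\<omega>. Y u \<omega> * Y v \<omega>)" if "u \<in> U" "v \<in> U" for u v
  proof (rule Bochner_Integration.integrable_bound)
    show "integrable M (\<lambda>\<omega>. (Y u \<omega>)\<^sup>2 + (Y v \<omega>)\<^sup>2)"
      by (intro Bochner_Integration.integrable_add sq(1) that)
    have "\<bar>a * b\<bar> \<le> a\<^sup>2 + b\<^sup>2" for a b :: real
    proof -
      have "2 * \<bar>a * b\<bar> \<le> a\<^sup>2 + b\<^sup>2"
        using zero_le_power2[of "\<bar>a\<bar> - \<bar>b\<bar>"] by (simp add: power2_eq_square algebra_simps abs_mult)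
      then show ?thesis using abs_ge_zero[of "a * b"] by linarith
    qed
    then show "AE \<omega> in M. norm (Y u \<omega> * Y v \<omega>) \<le> norm ((Y u \<omega>)\<^sup>2 + (Y v \<omega>)\<^sup>2)"
      by (intro AE_I2) (metis abs_ge_self order_trans real_norm_def)
  qed (intro borel_measurable_times meas that)
  define D where "D \<omega> = (\<Sum>u\<in>U. Y u \<omega>) / ?n - m" for \<omega>
  have [measurable]: "D \<in> borel_measurable M" unfolding D_def[abs_def]
    by (intro borel_measurable_diff borel_measurable_divide borel_measurable_sum meas borel_measurable_const)
  have D: "D \<omega> = (\<Sum>u\<in>U. Y u \<omega> - m) / ?n" for \<omega>
    using n by (simp add: D_def sum_subtractf diff_divide_distrib)
  define G where "G u v \<omega> = Y u \<omega> * Y v \<omega> - m * Y u \<omega> - m * Y v \<omega> + m\<^sup>2" for u v \<omega>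
  have D2: "(D \<omega>)\<^sup>2 = (\<Sum>u\<in>U. \<Sum>v\<in>U. G u v \<omega>) / ?n\<^sup>2" for \<omega>
  proof -
    have "(Y u \<omega> - m) * (Y v \<omega> - m) = G u v \<omega>" for u v
      by (simp add: G_def algebra_simps power2_eq_square)
    then show ?thesis unfolding D power_divide square_sum_expand by simp
  qed
  have G: "integrable M (G u v)" "expectation (G u v) = expectation (\<lambda>\<omega>. Y u \<omega> * Y v \<omega>) - m * m - m * m + m\<^sup>2"
    if "u \<in> U" "v \<in> U" for u v
    using intY intYY mean that prob_space unfolding G_def[abs_def] by simp_all
  have int2: "integrable M (\<lambda>\<omega>. (D \<omega>)\<^sup>2)" unfolding D2
    using G by (intro integrable_divide Bochner_Integration.integrable_sum) auto
  have "expectation (\<lambda>\<omega>. (D \<omega>)\<^sup>2) = (\<Sum>u\<in>U. \<Sum>v\<in>U. expectation (G u v)) / ?n\<^sup>2"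
    unfolding D2 using G(1) by (simp add: Bochner_Integration.integral_sum)
  also have "\<dots> = (\<Sum>u\<in>U. \<Sum>v\<in>U. expectation (\<lambda>\<omega>. Y u \<omega> * Y v \<omega>) - m * m - m * m + m\<^sup>2) / ?n\<^sup>2"
    by (intro arg_cong2[where f="(/)"] sum.cong refl G(2))
  also have "\<dots> \<le> (\<Sum>u\<in>U. \<Sum>v\<in>U. if u = v then V else 0) / ?n\<^sup>2"
  proof (intro divide_right_mono sum_mono)
    fix u v assume uv: "u \<in> U" "v \<in> U"
    have "0 \<le> m\<^sup>2" "m * m = m\<^sup>2" by (simp_all add: power2_eq_square)
    moreover have "expectation (\<lambda>\<omega>. Y u \<omega> * Y u \<omega>) \<le> V"
      using sq(2)[OF uv(1)] by (simp add: power2_eq_square)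
    ultimately show "expectation (\<lambda>\<omega>. Y u \<omega> * Y v \<omega>) - m * m - m * m + m\<^sup>2 \<le> (if u = v then V else 0)"
      using uncorr[OF uv] by (cases "u = v") (simp_all only: refl if_True if_False simp_thms)
  qed simp
  also have "\<dots> = V / ?n" using U n by (simp add: power2_eq_square)
  finally have ED2: "expectation (\<lambda>\<omega>. (D \<omega>)\<^sup>2) \<le> V / ?n" .
  have intD: "integrable M D" by (rule square_integrable_imp_integrable[OF _ int2]) simp
  \<comment> \<open>Jensen's inequality for the square, in the form that the variance of
    \<open>\<bar>D \<omega>\<bar>\<close> is nonnegative.\<close>
  have "0 \<le> variance (\<lambda>\<omega>. \<bar>D \<omega>\<bar>)" by (rule variance_positive)
  also have "\<dots> = expectation (\<lambda>\<omega>. (D \<omega>)\<^sup>2) - (expectation (\<lambda>\<omega>. \<bar>D \<omega>\<bar>))\<^sup>2"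
    using intD int2 by (subst variance_eq) auto
  finally have "(expectation (\<lambda>\<omega>. \<bar>D \<omega>\<bar>))\<^sup>2 \<le> V / ?n" using ED2 by simp
  then have "expectation (\<lambda>\<omega>. \<bar>D \<omega>\<bar>) \<le> sqrt (V / ?n)" by (rule real_le_rsqrt)
  moreover have "(\<integral>\<^sup>+\<omega>. \<bar>D \<omega>\<bar> \<partial>M) = ennreal (expectation (\<lambda>\<omega>. \<bar>D \<omega>\<bar>))"
    using intD by (intro nn_integral_eq_integral) auto
  ultimately show ?thesis unfolding D_def[abs_def] by (simp add: ennreal_leI)
qed

section \<open>Product measures and the layers of parameters\<close>

lemma product_prob_space_normal:
  assumes "\<And>p. sd p > 0"
  shows "product_prob_space (\<lambda>p. normal_measure (sd p))"
  by (auto simp: product_prob_space_def product_sigma_finite_def product_prob_space_axioms_def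
        intro!: prob_space_normal_density assms prob_space_imp_sigma_finite)

lemma prob_space_PiM_normal:
  assumes "\<And>p. p \<in> J \<Longrightarrow> sd p > 0"
  shows "prob_space (PiM J (\<lambda>p. normal_measure (sd p)))"
  by (rule prob_space_PiM) (auto intro!: prob_space_normal_density assms)

text \<open>Conditioning on the parameters in \<open>I\<close>, in the form of Tonelli's theorem.
  Measurability refers to plain Borel products, so it can be checked without mentioning the
  variances.\<close>

lemma nn_integral_PiM_normal_Un:
  assumes "finite I" "finite J" "I \<inter> J = {}" and sd: "\<And>p. p \<in> I \<union> J \<Longrightarrow> sd p > 0"
    and f: "f \<in> borel_measurable (PiM (I \<union> J) (\<lambda>_. borel))"
  shows "(\<integral>\<^sup>+\<theta>. f \<theta> \<partial>PiM (I \<union> J) (\<lambda>p. normal_measure (sd p)))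
    = (\<integral>\<^sup>+\<eta>. (\<integral>\<^sup>+\<theta>. f (merge I J (\<eta>, \<theta>)) \<partial>PiM J (\<lambda>p. normal_measure (sd p))) \<partial>PiM I (\<lambda>p. normal_measure (sd p)))"
proof -
  define sd' where "sd' p = (if p \<in> I \<union> J then sd p else 1)" for p
  have e: "PiM A (\<lambda>p. normal_measure (sd p)) = PiM A (\<lambda>p. normal_measure (sd' p))" if "A \<subseteq> I \<union> J" for A
    using that by (intro PiM_cong) (auto simp: sd'_def)
  interpret product_prob_space "\<lambda>p. normal_measure (sd' p)" UNIV
    by (rule product_prob_space_normal) (use sd in \<open>auto simp: sd'_def\<close>)
  have "sets (PiM (I \<union> J) (\<lambda>p. normal_measure (sd' p))) = sets (PiM (I \<union> J) (\<lambda>_. borel))"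
    by (intro sets_PiM_cong) auto
  then have "f \<in> borel_measurable (PiM (I \<union> J) (\<lambda>p. normal_measure (sd' p)))"
    using f measurable_cong_sets by blast
  then show ?thesis using assms(1-3) unfolding e[OF order_refl] e[OF Un_upper1] e[OF Un_upper2]
    by (intro product_nn_integral_fold) auto
qed

definition layer_params :: "(nat \<Rightarrow> nat) \<Rightarrow> nat \<Rightarrow> nat \<Rightarrow> ('n0, 'nL) param set" where
  "layer_params n L l = (\<lambda>(i, j). Wt l i j) ` (units n L l \<times> units n L (l - 1)) \<union> Bs l ` units n L l"

text \<open>Layers are counted from 1, so the set is empty for \<open>l = 0\<close> and is the whole
  parameter set for \<open>l = L\<close>; the nesting lets the top layer be split off for
  conditioning.\<close>

definition params_upto :: "(nat \<Rightarrow> nat) \<Rightarrow> nat \<Rightarrow> nat \<Rightarrow> ('n0, 'nL) param set" where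
  "params_upto n L l = (\<Union>l'\<in>{1..l}. layer_params n L l')"

lemma finite_units [simp]: "finite (units n L l :: ('n0::finite, 'nL::finite) neuron set)"
  by (auto simp: units_def)

lemma finite_layer_params [simp]: "finite (layer_params n L l :: ('n0::finite, 'nL::finite) param set)"
  by (simp add: layer_params_def)

lemma finite_params_upto [simp]: "finite (params_upto n L l :: ('n0::finite, 'nL::finite) param set)"
  by (simp add: params_upto_def)

lemma params_upto_Suc: "params_upto n L (Suc l) = params_upto n L l \<union> layer_params n L (Suc l)"
  by (auto simp: params_upto_def atLeastAtMostSuc_conv)

lemma layer_params_iff [simp]:
  "Wt l' i j \<in> layer_params n L l \<longleftrightarrow> l' = l \<and> i \<in> units n L l \<and> j \<in> units n L (l - 1)"
  "Bs l' i \<in> layer_params n L l \<longleftrightarrow> l' = l \<and> i \<in> units n L l"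
  by (auto simp: layer_params_def)

lemma params_eq_params_upto: "params n L = (params_upto n L L :: ('n0, 'nL) param set)"
proof (rule set_eqI)
  fix p :: "('n0, 'nL) param"
  show "p \<in> params n L \<longleftrightarrow> p \<in> params_upto n L L"
    by (cases p) (auto simp: params_def params_upto_def)
qed

lemma layer_params_disjoint: "params_upto n L l \<inter> layer_params n L (Suc l) = {}"
  by (auto simp: params_upto_def layer_params_def)

lemma params_upto_mono: "l \<le> l' \<Longrightarrow> params_upto n L l \<subseteq> params_upto n L l'"
  unfolding params_upto_def by (intro UN_mono) auto

lemma layer_params_subset: "1 \<le> l \<Longrightarrow> l \<le> l' \<Longrightarrow> layer_params n L l \<subseteq> params_upto n L l'"
  unfolding params_upto_def by auto

lemma sum_layer_params:
  fixes F :: "('n0::finite, 'nL::finite) param \<Rightarrow> 'z::comm_monoid_add"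
  shows "(\<Sum>p\<in>layer_params n L l. F p) = (\<Sum>i\<in>units n L l. (\<Sum>j\<in>units n L (l - 1). F (Wt l i j)) + F (Bs l i))"
proof -
  have "(\<Sum>p\<in>layer_params n L l. F p) = (\<Sum>p\<in>(\<lambda>(i, j). Wt l i j) ` (units n L l \<times> units n L (l - 1)). F p) + (\<Sum>p\<in>Bs l ` units n L l. F p)"
    unfolding layer_params_def by (rule sum.union_disjoint) auto
  also have "\<dots> = (\<Sum>(i, j)\<in>units n L l \<times> units n L (l - 1). F (Wt l i j)) + (\<Sum>i\<in>units n L l. F (Bs l i))"
    by (subst (1 2) sum.reindex) (auto simp: inj_on_def intro!: sum.cong arg_cong2[where f="(+)"])
  finally show ?thesis by (simp add: sum.cartesian_product[symmetric] sum.distrib)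
qed

lemma fwd_cong:
  assumes "\<And>p. p \<in> params_upto n L l \<Longrightarrow> \<theta> p = \<theta>' p" "u \<in> units n L l"
  shows "fwd \<phi> n L \<theta> xc l u = fwd \<phi> n L \<theta>' xc l u"
  using assms
proof (induction l arbitrary: u)
  case (Suc l)
  have "fwd \<phi> n L \<theta> xc l j = fwd \<phi> n L \<theta>' xc l j" if "j \<in> units n L l" for j
    using Suc that params_upto_mono[of l "Suc l" n L] by auto
  moreover have "\<theta> (Wt (Suc l) u j) = \<theta>' (Wt (Suc l) u j)" if "j \<in> units n L l" for j
    using Suc.prems that by (intro Suc.prems) (auto simp: params_upto_Suc)
  moreover have "\<theta> (Bs (Suc l) u) = \<theta>' (Bs (Suc l) u)"
    using Suc.prems by (intro Suc.prems) (auto simp: params_upto_Suc)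
  ultimately show ?case by (simp cong: sum.cong)
qed simp

lemma measurable_fwd:
  assumes "\<And>l. l \<in> {1..m} \<Longrightarrow> \<phi> l \<in> borel_measurable borel"
    and "l \<le> m" "params_upto n L l \<subseteq> J" "u \<in> units n L l"
  shows "(\<lambda>\<theta>. fwd \<phi> n L \<theta> xc l u) \<in> borel_measurable (PiM J (\<lambda>_. borel))"
  using assms(2-4)
proof (induction l arbitrary: u)
  case (Suc l)
  have [measurable]: "\<phi> (Suc l) \<in> borel_measurable borel" using assms(1) Suc.prems by auto
  have [measurable]: "(\<lambda>\<theta>. fwd \<phi> n L \<theta> xc l j) \<in> borel_measurable (PiM J (\<lambda>_. borel))" if "j \<in> units n L l" for j
    using Suc that params_upto_mono[of l "Suc l" n L] by auto
  have [measurable]: "Wt (Suc l) u j \<in> J" if "j \<in> units n L l" for j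
    using Suc.prems that by (auto simp: params_upto_Suc)
  have [measurable]: "Bs (Suc l) u \<in> J"
    using Suc.prems by (auto simp: params_upto_Suc)
  have "(\<lambda>\<theta>. \<theta> (Wt (Suc l) u j) * \<phi> (Suc l) (fwd \<phi> n L \<theta> xc l j)) \<in> borel_measurable (PiM J (\<lambda>_. borel))"
    if [measurable]: "j \<in> units n L l" for j by measurable
  moreover have "(\<lambda>\<theta>. \<theta> (Bs (Suc l) u)) \<in> borel_measurable (PiM J (\<lambda>_. borel))" by measurable
  ultimately show ?case by simp
qed simp

definition features :: "(nat \<Rightarrow> real \<Rightarrow> real) \<Rightarrow> (nat \<Rightarrow> nat) \<Rightarrow> nat \<Rightarrow> real^'k^'n0 \<Rightarrow> nat
    \<Rightarrow> (('n0::finite, 'nL::finite) param \<Rightarrow> real) \<Rightarrow> ('n0, 'nL) neuron \<Rightarrow> real^'k" where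
  "features \<phi> n L x l \<theta> j = (\<chi> c. \<phi> l (fwd \<phi> n L \<theta> (column c x) (l - 1) j))"

text \<open>The conditional covariance, across the inputs, of one neuron of layer \<open>l\<close>
  given the lower layers. It depends on \<open>\<theta>\<close> only through the parameters up to
  layer \<open>l - 1\<close>.\<close>

definition emp_kernel :: "(nat \<Rightarrow> real \<Rightarrow> real) \<Rightarrow> (nat \<Rightarrow> real) \<Rightarrow> (nat \<Rightarrow> real) \<Rightarrow> (nat \<Rightarrow> nat) \<Rightarrow> nat \<Rightarrow> real^'k^'n0 \<Rightarrow> nat
    \<Rightarrow> (('n0::finite, 'nL::finite) param \<Rightarrow> real) \<Rightarrow> real^'k^'k" where
  "emp_kernel \<phi> sW sb n L x l \<theta> = (\<chi> c c'. sW l / card (units n L (l - 1) :: ('n0, 'nL) neuron set) *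
      (\<Sum>j\<in>units n L (l - 1). features \<phi> n L x l \<theta> j $ c * features \<phi> n L x l \<theta> j $ c') + sb l)"

lemma psd_emp_kernel: "sW l \<ge> 0 \<Longrightarrow> sb l \<ge> 0 \<Longrightarrow> psd (emp_kernel \<phi> sW sb n L x l \<theta>)"
  unfolding emp_kernel_def by (intro psd_Gram) auto

lemma emp_kernel_diag: "sW l \<ge> 0 \<Longrightarrow> emp_kernel \<phi> sW sb n L x l \<theta> $ c $ c \<ge> sb l"
  by (simp add: emp_kernel_def sum_nonneg)

lemma emp_kernel_quadratic:
  fixes x :: "real^'k::finite^'n0::finite" and t :: "real^'k" and \<theta> :: "('n0::finite, 'nL::finite) param \<Rightarrow> real"
  shows "t \<bullet> (emp_kernel \<phi> sW sb n L x l \<theta> *v t)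
    = (\<Sum>j\<in>units n L (l - 1). sW l / card (units n L (l - 1) :: ('n0, 'nL) neuron set) * (t \<bullet> features \<phi> n L x l \<theta> j)\<^sup>2)
      + sb l * (t \<bullet> (\<chi> c. 1))\<^sup>2"
proof -
  let ?g = "features \<phi> n L x l \<theta>" and ?U = "units n L (l - 1) :: ('n0, 'nL) neuron set"
  have sq: "(t \<bullet> v)\<^sup>2 = (\<Sum>c\<in>UNIV. \<Sum>c'\<in>UNIV. t $ c * t $ c' * (v $ c * v $ c'))" for v :: "real^'k"
    unfolding inner_vec_def square_sum_expand by (simp add: mult_ac)
  have "(\<Sum>j\<in>?U. (t \<bullet> ?g j)\<^sup>2) = (\<Sum>c\<in>UNIV. \<Sum>c'\<in>UNIV. \<Sum>j\<in>?U. t $ c * t $ c' * (?g j $ c * ?g j $ c'))"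
    unfolding sq by (subst sum.swap) (intro sum.cong refl sum.swap)
  moreover have "(t \<bullet> (\<chi> c. 1))\<^sup>2 = (\<Sum>c\<in>UNIV. \<Sum>c'\<in>UNIV. t $ c * t $ c')"
    unfolding sq by simp
  moreover have "t \<bullet> (emp_kernel \<phi> sW sb n L x l \<theta> *v t) = sW l / card ?U *
      (\<Sum>c\<in>UNIV. \<Sum>c'\<in>UNIV. \<Sum>j\<in>?U. t $ c * t $ c' * (?g j $ c * ?g j $ c')) + sb l * (\<Sum>c\<in>UNIV. \<Sum>c'\<in>UNIV. t $ c * t $ c')"
    unfolding emp_kernel_def quadratic_form_sum
    by (simp add: sum_distrib_left sum.distrib distrib_left mult_ac)
  ultimately show ?thesis unfolding sum_distrib_left[symmetric] by simp
qed

lemma measurable_features: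
  fixes x :: "real^'k::finite^'n0::finite"
  assumes "\<And>l. l \<in> {1..m} \<Longrightarrow> \<phi> l \<in> borel_measurable borel" "1 \<le> l" "l \<le> m"
    "params_upto n L (l - 1) \<subseteq> J" "j \<in> units n L (l - 1)"
  shows "(\<lambda>\<theta>. features \<phi> n L x l \<theta> j $ c) \<in> borel_measurable (PiM J (\<lambda>_. borel))"
proof -
  have [measurable]: "\<phi> l \<in> borel_measurable borel" using assms by auto
  have [measurable]: "(\<lambda>\<theta>. fwd \<phi> n L \<theta> (column c x) (l - 1) j) \<in> borel_measurable (PiM J (\<lambda>_. borel))"
    using assms by (intro measurable_fwd[where m=m]) auto
  show ?thesis unfolding features_def vec_lambda_beta by measurable
qed

lemma measurable_emp_kernel:
  fixes x :: "real^'k::finite^'n0::finite"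
  assumes "\<And>l. l \<in> {1..m} \<Longrightarrow> \<phi> l \<in> borel_measurable borel" "1 \<le> l" "l \<le> m"
    "params_upto n L (l - 1) \<subseteq> J"
  shows "emp_kernel \<phi> sW sb n L x l \<in> borel_measurable (PiM J (\<lambda>_. borel))"
proof (rule borel_measurable_matrixI)
  fix r c
  note [measurable] = measurable_features[OF assms, where x=x]
  show "(\<lambda>\<theta>. emp_kernel \<phi> sW sb n L x l \<theta> $ r $ c) \<in> borel_measurable (PiM J (\<lambda>_. borel))"
    unfolding emp_kernel_def by simp
qed

text \<open>With the lower layers frozen at \<open>\<eta>\<close>, a layer is linear in its own
  parameters; this is the coefficient of parameter \<open>p\<close> in neuron \<open>u\<close>, as a
  vector over the inputs.\<close>

definition unit_weight :: "(nat \<Rightarrow> real \<Rightarrow> real) \<Rightarrow> (nat \<Rightarrow> nat) \<Rightarrow> nat \<Rightarrow> real^'k^'n0 \<Rightarrow> nat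
    \<Rightarrow> (('n0::finite, 'nL::finite) param \<Rightarrow> real) \<Rightarrow> ('n0, 'nL) neuron \<Rightarrow> ('n0, 'nL) param \<Rightarrow> real^'k" where
  "unit_weight \<phi> n L x l \<eta> u p = (case p of
      Wt _ i j \<Rightarrow> if i = u then features \<phi> n L x l \<eta> j else 0
    | Bs _ i \<Rightarrow> if i = u then (\<chi> c. 1) else 0)"

definition preact :: "(nat \<Rightarrow> real \<Rightarrow> real) \<Rightarrow> (nat \<Rightarrow> nat) \<Rightarrow> nat \<Rightarrow> real^'k^'n0 \<Rightarrow> nat
    \<Rightarrow> (('n0::finite, 'nL::finite) param \<Rightarrow> real) \<Rightarrow> ('n0, 'nL) neuron \<Rightarrow> (('n0, 'nL) param \<Rightarrow> real) \<Rightarrow> real^'k" where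
  "preact \<phi> n L x l \<eta> u \<theta> = (\<Sum>p\<in>layer_params n L l. \<theta> p *\<^sub>R unit_weight \<phi> n L x l \<eta> u p)"

lemma merge_layer:
  "p \<in> params_upto n L m \<Longrightarrow> merge (params_upto n L m) J (\<eta>, \<theta>) p = \<eta> p"
  "p \<in> layer_params n L (Suc m) \<Longrightarrow> merge (params_upto n L m) (layer_params n L (Suc m)) (\<eta>, \<theta>) p = \<theta> p"
  using layer_params_disjoint[of n L m] by (auto simp: merge_def)

lemma sum_layer_params_unit:
  fixes F :: "('n0::finite, 'nL::finite) param \<Rightarrow> 'z::comm_monoid_add"
  assumes u: "u \<in> units n L l"
    and z: "\<And>i j. i \<noteq> u \<Longrightarrow> F (Wt l i j) = 0" "\<And>i. i \<noteq> u \<Longrightarrow> F (Bs l i) = 0"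
  shows "(\<Sum>p\<in>layer_params n L l. F p) = (\<Sum>j\<in>units n L (l - 1). F (Wt l u j)) + F (Bs l u)"
proof -
  have "(\<Sum>i\<in>units n L l. (\<Sum>j\<in>units n L (l - 1). F (Wt l i j)) + F (Bs l i))
    = (\<Sum>i\<in>units n L l. if i = u then (\<Sum>j\<in>units n L (l - 1). F (Wt l u j)) + F (Bs l u) else 0)"
    by (intro sum.cong refl) (auto simp: z)
  then show ?thesis using u by (simp add: sum_layer_params)
qed

lemma fwd_merge:
  fixes x :: "real^'k::finite^'n0::finite"
  assumes "u \<in> units n L (Suc m)"
  shows "fwd \<phi> n L (merge (params_upto n L m) (layer_params n L (Suc m)) (\<eta>, \<theta>)) (column c x) (Suc m) u
     = preact \<phi> n L x (Suc m) \<eta> u \<theta> $ c"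
proof -
  let ?\<zeta> = "merge (params_upto n L m) (layer_params n L (Suc m)) (\<eta>, \<theta>)"
  have "fwd \<phi> n L ?\<zeta> (column c x) m j = fwd \<phi> n L \<eta> (column c x) m j" if "j \<in> units n L m" for j
    by (rule fwd_cong[OF _ that]) (simp add: merge_layer)
  moreover have "?\<zeta> (Wt (Suc m) u j) = \<theta> (Wt (Suc m) u j)" if "j \<in> units n L m" for j
    using that assms by (intro merge_layer) simp
  moreover have "?\<zeta> (Bs (Suc m) u) = \<theta> (Bs (Suc m) u)"
    using assms by (intro merge_layer) simp
  moreover have "preact \<phi> n L x (Suc m) \<eta> u \<theta> = (\<Sum>j\<in>units n L m. \<theta> (Wt (Suc m) u j) *\<^sub>R features \<phi> n L x (Suc m) \<eta> j)
      + \<theta> (Bs (Suc m) u) *\<^sub>R (\<chi> c. 1)"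
    unfolding preact_def by (subst sum_layer_params_unit[OF assms]) (auto simp: unit_weight_def)
  ultimately show ?thesis by (simp add: features_def)
qed

section \<open>Conditional law of a hidden layer\<close>

abbreviation param_sd :: "(nat \<Rightarrow> real) \<Rightarrow> (nat \<Rightarrow> real) \<Rightarrow> (nat \<Rightarrow> nat) \<Rightarrow> nat \<Rightarrow> real
    \<Rightarrow> ('n0::finite, 'nL::finite) param \<Rightarrow> real" where
  "param_sd sW sb n L s p \<equiv> sqrt (pvar sW sb n L s p)"

lemma param_sd_pos:
  fixes p :: "('n0::finite, 'nL::finite) param"
  assumes "p \<in> layer_params n L l" "l \<noteq> L \<Longrightarrow> sW l > 0 \<and> sb l > 0" "s > 0"
  shows "param_sd sW sb n L s p > 0"
proof (cases p)
  case (Wt l' i j)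
  then have "j \<in> units n L (l - 1)" "l' = l" using assms by auto
  then have "card (units n L (l - 1) :: ('n0, 'nL) neuron set) > 0" by (auto simp: card_gt_0_iff)
  then show ?thesis using assms Wt \<open>l' = l\<close> by auto
next
  case (Bs l' i) then show ?thesis using assms by auto
qed

context
  fixes \<phi> :: "nat \<Rightarrow> real \<Rightarrow> real" and sW sb :: "nat \<Rightarrow> real" and n :: "nat \<Rightarrow> nat" and L :: nat
    and x :: "real^'k::finite^'n0::finite" and l :: nat and s :: real
    and \<eta> :: "('n0, 'nL::finite) param \<Rightarrow> real"
  assumes l: "1 \<le> l" "l < L" and var: "sW l > 0" "sb l > 0" "s > 0"
begin

lemma sd_pos: "p \<in> layer_params n L l \<Longrightarrow> param_sd sW sb n L s p > 0" for p :: "('n0, 'nL) param"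
  by (rule param_sd_pos) (use l var in auto)

interpretation layer: prob_space "PiM (layer_params n L l) (\<lambda>p::('n0, 'nL) param. normal_measure (param_sd sW sb n L s p))"
  by (rule prob_space_PiM_normal) (rule sd_pos)

private abbreviation "layer_measure \<equiv> PiM (layer_params n L l) (\<lambda>p::('n0, 'nL) param. normal_measure (param_sd sW sb n L s p))"
private abbreviation "Khat \<equiv> emp_kernel \<phi> sW sb n L x l \<eta>"

lemma psd_Khat: "psd Khat"
  by (rule psd_emp_kernel) (use var in auto)

lemma Khat_diag_pos: "Khat $ i $ i > 0"
  using emp_kernel_diag[of sW l sb \<phi> n L x \<eta> i] var by auto

lemma unit_quadratic:
  assumes u: "u \<in> units n L l"
  shows "(\<Sum>p\<in>layer_params n L l. (param_sd sW sb n L s p)\<^sup>2 * (t \<bullet> unit_weight \<phi> n L x l \<eta> u p)\<^sup>2) = t \<bullet> (Khat *v t)"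
proof -
  have "(param_sd sW sb n L s p)\<^sup>2 = pvar sW sb n L s p" if "p \<in> layer_params n L l" for p :: "('n0, 'nL) param"
    using sd_pos[OF that] by (simp add: less_imp_le)
  then have "(\<Sum>p\<in>layer_params n L l. (param_sd sW sb n L s p)\<^sup>2 * (t \<bullet> unit_weight \<phi> n L x l \<eta> u p)\<^sup>2)
    = (\<Sum>p\<in>layer_params n L l. pvar sW sb n L s p * (t \<bullet> unit_weight \<phi> n L x l \<eta> u p)\<^sup>2)" by simp
  also have "\<dots> = t \<bullet> (Khat *v t)"
    by (subst sum_layer_params_unit[OF u]) (use l in \<open>auto simp: unit_weight_def emp_kernel_quadratic\<close>)
  finally show ?thesis .
qed

lemma measurable_preact: "preact \<phi> n L x l \<eta> u \<in> borel_measurable layer_measure"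
  unfolding preact_def[abs_def]
  by (intro borel_measurable_sum borel_measurable_scaleR borel_measurable_const measurable_component_singleton[THEN measurable_compose]) auto

lemma law_preact:
  assumes u: "u \<in> units n L l"
  shows "distr layer_measure borel (preact \<phi> n L x l \<eta> u) = gauss_vec Khat"
proof (rule gaussian_law_unique)
  show "gaussian_law (gauss_vec Khat) (\<lambda>t. t \<bullet> (Khat *v t))"
    by (rule gaussian_law_gauss_vec[OF psd_Khat])
  show "gaussian_law (distr layer_measure borel (preact \<phi> n L x l \<eta> u)) (\<lambda>t. t \<bullet> (Khat *v t))"
    unfolding preact_def[abs_def] unit_quadratic[OF u, symmetric]
    by (rule gaussian_law_linear_combination) (simp, rule sd_pos)
qed

text \<open>Two neurons of one layer have disjoint incoming parameters, so no parameter has a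
  nonzero coefficient in both and the mixed terms of the joint form vanish. Full independence is
  wanted, since nonlinear functions of the neurons are averaged.\<close>

lemma law_preact_pair:
  assumes u: "u \<in> units n L l" and v: "v \<in> units n L l" and uv: "u \<noteq> v"
  shows "distr layer_measure borel (\<lambda>\<theta>. (preact \<phi> n L x l \<eta> u \<theta>, preact \<phi> n L x l \<eta> v \<theta>)) = gauss_vec Khat \<Otimes>\<^sub>M gauss_vec Khat"
proof (rule gaussian_law_unique)
  let ?q = "\<lambda>t. fst t \<bullet> (Khat *v fst t) + snd t \<bullet> (Khat *v snd t)"
  show "gaussian_law (gauss_vec Khat \<Otimes>\<^sub>M gauss_vec Khat) ?q"
    by (rule gaussian_law_pair) (rule gaussian_law_gauss_vec[OF psd_Khat])+
  let ?w = "\<lambda>p. (unit_weight \<phi> n L x l \<eta> u p, unit_weight \<phi> n L x l \<eta> v p)"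
  have "gaussian_law (distr layer_measure borel (\<lambda>\<theta>. \<Sum>p\<in>layer_params n L l. \<theta> p *\<^sub>R ?w p))
     (\<lambda>t. \<Sum>p\<in>layer_params n L l. (param_sd sW sb n L s p)\<^sup>2 * (t \<bullet> ?w p)\<^sup>2)"
    by (rule gaussian_law_linear_combination) (simp, rule sd_pos)
  moreover have "(\<Sum>p\<in>layer_params n L l. \<theta> p *\<^sub>R ?w p) = (preact \<phi> n L x l \<eta> u \<theta>, preact \<phi> n L x l \<eta> v \<theta>)" for \<theta>
    unfolding preact_def by (simp add: sum_prod)
  moreover have "(\<Sum>p\<in>layer_params n L l. (param_sd sW sb n L s p)\<^sup>2 * (t \<bullet> ?w p)\<^sup>2) = ?q t" for t
  proof -
    have "(t \<bullet> ?w p)\<^sup>2 = (fst t \<bullet> unit_weight \<phi> n L x l \<eta> u p)\<^sup>2 + (snd t \<bullet> unit_weight \<phi> n L x l \<eta> v p)\<^sup>2" for p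
    proof -
      have "unit_weight \<phi> n L x l \<eta> u p = 0 \<or> unit_weight \<phi> n L x l \<eta> v p = 0"
        using uv by (cases p) (auto simp: unit_weight_def)
      then show ?thesis by (auto simp: inner_prod_def)
    qed
    then show ?thesis unfolding unit_quadratic[OF u, of "fst t", symmetric] unit_quadratic[OF v, of "snd t", symmetric]
      by (simp add: distrib_left sum.distrib)
  qed
  ultimately show "gaussian_law (distr layer_measure borel (\<lambda>\<theta>. (preact \<phi> n L x l \<eta> u \<theta>, preact \<phi> n L x l \<eta> v \<theta>))) ?q"
    by simp
qed

text \<open>For frozen \<open>\<eta>\<close> the summands are pairwise independent copies with mean
  \<open>gexp Khat \<psi> i j\<close>. \<open>B\<close> is passed in from outside so that it can be
  chosen independently of \<open>\<eta>\<close> and the widths; the bound keeps the random diagonal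
  of \<open>Khat\<close>.\<close>

lemma layer_average_bound:
  fixes \<psi> :: "real \<Rightarrow> real"
  assumes lip: "C-lipschitz_on UNIV \<psi>" and n: "n l > 0"
    and B: "0 \<le> B" "\<And>i j. integrable (gauss_vec Khat) (\<lambda>Z. (\<psi> (Z $ i) * \<psi> (Z $ j))\<^sup>2)"
      "\<And>i j. (LINT Z|gauss_vec Khat. (\<psi> (Z $ i) * \<psi> (Z $ j))\<^sup>2) \<le> (B * (1 + Khat $ i $ i + Khat $ j $ j))\<^sup>2"
  shows "(\<integral>\<^sup>+\<theta>. \<bar>(\<Sum>u\<in>units n L l. \<psi> (preact \<phi> n L x l \<eta> u \<theta> $ i) * \<psi> (preact \<phi> n L x l \<eta> u \<theta> $ j)) / n l - gexp Khat \<psi> i j\<bar> \<partial>layer_measure)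
     \<le> ennreal (B * (1 + Khat $ i $ i + Khat $ j $ j) / sqrt (n l))"
proof -
  note [measurable] = lipschitz_measurable[OF lip] measurable_preact
  let ?U = "units n L l :: ('n0, 'nL) neuron set"
  have U: "?U = Hid ` {..<n l}" using l by (simp add: units_def)
  have card: "card ?U = n l" unfolding U by (subst card_image) (auto simp: inj_on_def)
  have ne: "?U \<noteq> {}" using n card by auto
  let ?h = "\<lambda>Z. \<psi> (Z $ i) * \<psi> (Z $ j)"
  let ?Y = "\<lambda>u \<theta>. ?h (preact \<phi> n L x l \<eta> u \<theta>)"
  interpret G: prob_space "gauss_vec Khat" by (rule gauss_vec_prob_space[OF psd_Khat])
  interpret GG: pair_prob_space "gauss_vec Khat" "gauss_vec Khat" ..
  have h[measurable]: "?h \<in> borel_measurable borel" by measurable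
  have law: "(LINT \<theta>|layer_measure. f (preact \<phi> n L x l \<eta> u \<theta>)) = (LINT Z|gauss_vec Khat. f Z)"
    "integrable layer_measure (\<lambda>\<theta>. f (preact \<phi> n L x l \<eta> u \<theta>)) \<longleftrightarrow> integrable (gauss_vec Khat) f"
    if "u \<in> ?U" "f \<in> borel_measurable borel" for u and f :: "real^'k \<Rightarrow> real"
    using that unfolding law_preact[OF that(1), symmetric]
    by (simp_all add: integral_distr[OF measurable_preact] integrable_distr_eq[OF measurable_preact])
  have "(\<integral>\<^sup>+\<theta>. \<bar>(\<Sum>u\<in>?U. ?Y u \<theta>) / card ?U - gexp Khat \<psi> i j\<bar> \<partial>layer_measure)
     \<le> ennreal (sqrt ((B * (1 + Khat $ i $ i + Khat $ j $ j))\<^sup>2 / card ?U))"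
  proof (rule layer.average_L1_bound)
    fix u assume u: "u \<in> ?U"
    show "integrable layer_measure (\<lambda>\<theta>. (?Y u \<theta>)\<^sup>2)" "(LINT \<theta>|layer_measure. (?Y u \<theta>)\<^sup>2) \<le> (B * (1 + Khat $ i $ i + Khat $ j $ j))\<^sup>2"
      using law[OF u, of "\<lambda>Z. (?h Z)\<^sup>2"] B(2,3)[of i j] by auto
    show "(LINT \<theta>|layer_measure. ?Y u \<theta>) = gexp Khat \<psi> i j"
      using law(1)[OF u h] by (simp add: gexp_def)
    show "?Y u \<in> borel_measurable layer_measure" by measurable
    fix v assume v: "v \<in> ?U" "u \<noteq> v"
    have ih: "integrable (gauss_vec Khat) ?h" by (rule gexp_integrable_bivariate(1)[OF lip psd_Khat Khat_diag_pos])
    have [measurable]: "(\<lambda>\<theta>. (preact \<phi> n L x l \<eta> u \<theta>, preact \<phi> n L x l \<eta> v \<theta>)) \<in> layer_measure \<rightarrow>\<^sub>M borel"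
      unfolding borel_prod[symmetric] by measurable
    have "(LINT \<theta>|layer_measure. ?Y u \<theta> * ?Y v \<theta>) 
      = (LINT z|distr layer_measure borel (\<lambda>\<theta>. (preact \<phi> n L x l \<eta> u \<theta>, preact \<phi> n L x l \<eta> v \<theta>)). ?h (fst z) * ?h (snd z))"
      by (subst integral_distr) (auto simp: borel_prod[symmetric])
    also have "\<dots> = (LINT z|(gauss_vec Khat \<Otimes>\<^sub>M gauss_vec Khat). ?h (fst z) * ?h (snd z))"
      unfolding law_preact_pair[OF u v] ..
    also have "\<dots> = (LINT Z|gauss_vec Khat. (LINT Z'|gauss_vec Khat. ?h Z * ?h Z'))"
    proof (subst GG.integral_fst'[symmetric])
      show "integrable (gauss_vec Khat \<Otimes>\<^sub>M gauss_vec Khat) (\<lambda>z. ?h (fst z) * ?h (snd z))"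
        by (rule GG.Fubini_integrable) (use ih in \<open>auto simp: abs_mult[of "?h _"] intro!: AE_I2 integrable_mult_right integrable_mult_left integrable_abs\<close>)
    qed simp
    also have "\<dots> = (gexp Khat \<psi> i j)\<^sup>2" by (simp add: gexp_def power2_eq_square)
    finally show "(LINT \<theta>|layer_measure. ?Y u \<theta> * ?Y v \<theta>) = (gexp Khat \<psi> i j)\<^sup>2" .
  qed (use ne in auto)
  moreover have "sqrt ((B * (1 + Khat $ i $ i + Khat $ j $ j))\<^sup>2 / card ?U) = B * (1 + Khat $ i $ i + Khat $ j $ j) / sqrt (n l)"
    using B(1) Khat_diag_pos[of i] Khat_diag_pos[of j] card by (simp add: real_sqrt_divide)
  ultimately show ?thesis unfolding card by simp
qed

end


section \<open>Convergence to the limit kernels\<close>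

lemma nngp_Suc:
  "l \<ge> 1 \<Longrightarrow> nngp \<phi> sW sb x (Suc l) = (\<chi> i j. sW (Suc l) * gexp (nngp \<phi> sW sb x l) (\<phi> (Suc l)) i j + sb (Suc l))"
  by (cases l) auto

text \<open>The activation of layer 1 is the identity, so the first kernel carries no randomness and
  the induction starts with error 0.\<close>

lemma emp_kernel_1:
  fixes x :: "real^'k::finite^'n0::finite" and \<theta> :: "('n0, 'nL::finite) param \<Rightarrow> real"
  assumes "\<phi> 1 = (\<lambda>t. t)"
  shows "emp_kernel \<phi> sW sb n L x 1 \<theta> = nngp \<phi> sW sb x 1"
proof -
  have U: "units n L 0 = (range Inp :: ('n0, 'nL) neuron set)" by (simp add: units_def)
  have inj: "inj (Inp :: 'n0 \<Rightarrow> ('n0, 'nL) neuron)" by (simp add: inj_on_def)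
  have c: "card (range Inp :: ('n0, 'nL) neuron set) = CARD('n0)" by (rule card_image[OF inj])
  have "(\<Sum>j\<in>range (Inp :: 'n0 \<Rightarrow> ('n0, 'nL) neuron). features \<phi> n L x 1 \<theta> j $ i * features \<phi> n L x 1 \<theta> j $ i')
      = column i x \<bullet> column i' x" for i i'
    using assms by (subst sum.reindex[OF inj]) (simp add: features_def inner_vec_def)
  then show ?thesis using c by (simp add: emp_kernel_def U vec_eq_iff)
qed

lemma psd_nngp:
  fixes x :: "real^'k::finite^'n0::finite"
  assumes "\<phi> 1 = (\<lambda>t. t)" and lip: "\<And>l. l \<in> {2..L} \<Longrightarrow> \<exists>C. C-lipschitz_on UNIV (\<phi> l)"
    and var: "\<And>l. l \<in> {1..L} \<Longrightarrow> sW l > 0 \<and> sb l > 0" and "1 \<le> l" "l \<le> L"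
  shows "psd (nngp \<phi> sW sb x l) \<and> (\<forall>i. nngp \<phi> sW sb x l $ i $ i > 0)"
  using assms(4,5)
proof (induction l rule: dec_induct)
  case base
  have v: "sW 1 > 0" "sb 1 > 0" using var[of 1] base by auto
  \<comment> \<open>The first limit kernel is the empirical kernel of a dummy network (zero
    parameters, output type \<open>bool\<close>), which gives semidefiniteness and the lower bound
    \<open>sb 1\<close> on the diagonal without a further computation.\<close>
  have "psd (emp_kernel \<phi> sW sb (\<lambda>_. 1) L x 1 (\<lambda>_ :: ('n0, bool) param. 0))"
    "\<And>i. emp_kernel \<phi> sW sb (\<lambda>_. 1) L x 1 (\<lambda>_ :: ('n0, bool) param. 0) $ i $ i \<ge> sb 1"
    using v by (auto intro!: psd_emp_kernel emp_kernel_diag)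
  then show ?case using v unfolding emp_kernel_1[where \<phi>=\<phi>, OF assms(1)] by (meson less_le_trans)
next
  case (step l)
  have v: "sW (Suc l) > 0" "sb (Suc l) > 0" using var[of "Suc l"] step by auto
  obtain C where C: "C-lipschitz_on UNIV (\<phi> (Suc l))" using lip[of "Suc l"] step by auto
  have IH: "psd (nngp \<phi> sW sb x l)" "\<And>i. nngp \<phi> sW sb x l $ i $ i > 0" using step by auto
  have "sW (Suc l) * gexp (nngp \<phi> sW sb x l) (\<phi> (Suc l)) i i + sb (Suc l) > 0" for i
    using v gexp_diag_nonneg[OF C, of "nngp \<phi> sW sb x l" i] by (simp add: add_nonneg_pos)
  moreover have "psd (\<chi> i j. sW (Suc l) * gexp (nngp \<phi> sW sb x l) (\<phi> (Suc l)) i j + sb (Suc l))"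
    by (rule psd_gexp_kernel[OF C IH]) (use v in auto)
  ultimately show ?case unfolding nngp_Suc[OF step(1)] by simp
qed

lemma emp_kernel_merge:
  fixes x :: "real^'k::finite^'n0::finite" and \<eta> \<theta> :: "('n0, 'nL::finite) param \<Rightarrow> real"
  shows "emp_kernel \<phi> sW sb n L x (Suc (Suc m)) (merge (params_upto n L m) (layer_params n L (Suc m)) (\<eta>, \<theta>)) $ i $ j
    = sW (Suc (Suc m)) / card (units n L (Suc m) :: ('n0, 'nL) neuron set) *
        (\<Sum>u\<in>units n L (Suc m). \<phi> (Suc (Suc m)) (preact \<phi> n L x (Suc m) \<eta> u \<theta> $ i) * \<phi> (Suc (Suc m)) (preact \<phi> n L x (Suc m) \<eta> u \<theta> $ j))
      + sb (Suc (Suc m))"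
  unfolding emp_kernel_def features_def by (simp add: fwd_merge del: fwd.simps cong: sum.cong)

text \<open>Given the layers below \<open>l\<close>, the fluctuation bound and the bias bound are
  both affine in the error of the kernel of layer \<open>l\<close>, so integrating over those layers
  reproduces the inductive estimate with a new constant.\<close>

theorem emp_kernel_convergence:
  fixes x :: "real^'k::finite^'n0::finite" and \<phi> :: "nat \<Rightarrow> real \<Rightarrow> real"
  assumes L: "L \<ge> 2" and phi1: "\<phi> 1 = (\<lambda>t. t)" and lip: "\<And>l. l \<in> {2..L} \<Longrightarrow> \<exists>C. C-lipschitz_on UNIV (\<phi> l)"
    and var: "\<And>l. l \<in> {1..L} \<Longrightarrow> sW l > 0 \<and> sb l > 0" and s: "s > 0" and l: "1 \<le> l" "l \<le> L"
  shows "\<exists>c\<ge>0. \<forall>n. (\<forall>l\<in>{1..L-1}. n l > 0) \<longrightarrow> (\<forall>i j.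
     (\<integral>\<^sup>+\<eta>. \<bar>emp_kernel \<phi> sW sb n L x l \<eta> $ i $ j - nngp \<phi> sW sb x l $ i $ j\<bar>
        \<partial>PiM (params_upto n L (l - 1)) (\<lambda>p :: ('n0, 'nL::finite) param. normal_measure (param_sd sW sb n L s p)))
      \<le> ennreal (c / sqrt (real (Min (n ` {1..L-1})))))"
  using l
proof (induction l rule: dec_induct)
  case base
  have "emp_kernel \<phi> sW sb n L x 1 \<eta> $ i $ j - nngp \<phi> sW sb x 1 $ i $ j = 0" for n i j and \<eta> :: "('n0, 'nL) param \<Rightarrow> real"
    using emp_kernel_1[where \<phi>=\<phi>, OF phi1] by (metis diff_self)
  then show ?case by (intro exI[of _ 0]) simp
next
  case (step l)
  have lL: "1 \<le> l" "l < L" using step.hyps(1) step.prems by simp_all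
  let ?K = "nngp \<phi> sW sb x l"
  let ?\<psi> = "\<phi> (Suc l)"
  from step.IH[OF less_imp_le[OF lL(2)]] obtain c where c: "c \<ge> 0"
    and IHc: "\<forall>n. (\<forall>l\<in>{1..L-1}. n l > 0) \<longrightarrow> (\<forall>i j.
     (\<integral>\<^sup>+\<eta>. \<bar>emp_kernel \<phi> sW sb n L x l \<eta> $ i $ j - ?K $ i $ j\<bar>
        \<partial>PiM (params_upto n L (l - 1)) (\<lambda>p :: ('n0, 'nL) param. normal_measure (param_sd sW sb n L s p)))
      \<le> ennreal (c / sqrt (real (Min (n ` {1..L-1})))))"
    by (elim exE conjE) (rule that)
  obtain m where m: "l = Suc m" using lL(1) by (cases l) simp_all
  have K: "psd ?K" "\<And>i. ?K $ i $ i > 0" using psd_nngp[where \<phi>=\<phi> and l=l and L=L and sW=sW and sb=sb and x=x, OF phi1 lip var] lL by auto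
  obtain C where C: "C-lipschitz_on UNIV ?\<psi>" using lip[of "Suc l"] lL by auto
  obtain B where B: "B \<ge> 0" and B': "\<forall>(S :: real^'k^'k) i j. psd S \<longrightarrow> (\<forall>i. S $ i $ i > 0) \<longrightarrow>
     integrable (gauss_vec S) (\<lambda>Z. (?\<psi> (Z $ i) * ?\<psi> (Z $ j))\<^sup>2) \<and>
     (LINT Z|gauss_vec S. (?\<psi> (Z $ i) * ?\<psi> (Z $ j))\<^sup>2) \<le> (B * (1 + S $ i $ i + S $ j $ j))\<^sup>2"
    using gauss_vec_product_second_moment[OF C] by (elim exE conjE) (rule that)
  obtain D where D: "D \<ge> 0" and D': "\<forall>S i j. psd S \<longrightarrow> (\<forall>i. S $ i $ i > 0) \<longrightarrow>
    \<bar>gexp S ?\<psi> i j - gexp ?K ?\<psi> i j\<bar> \<le> D * (\<bar>S $ i $ i - ?K $ i $ i\<bar> + \<bar>S $ j $ j - ?K $ j $ j\<bar> + \<bar>S $ i $ j - ?K $ i $ j\<bar>)"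
    using gexp_calm[OF C K] by (elim exE conjE) (rule that)
  \<comment> \<open>Bounds every diagonal entry of the limit kernel; the random diagonal of
    \<open>S\<close> is replaced by \<open>T\<close> plus its error.\<close>
  define T where "T = (\<Sum>i\<in>UNIV. ?K $ i $ i)"
  have KT: "?K $ i $ i \<le> T" for i unfolding T_def using K(2) by (intro member_le_sum) (auto intro: less_imp_le)
  have T: "T \<ge> 0" unfolding T_def using K(2) by (intro sum_nonneg) (auto intro: less_imp_le)
  define w where "w = sW (Suc l)"
  have w: "w > 0" using var[of "Suc l"] lL by (auto simp: w_def)
  \<comment> \<open>\<open>B * (1 + 2 * T)\<close> is the fluctuation at the limit kernel.
    \<open>B\<close> and \<open>D\<close> multiply the three kernel errors, at
    \<open>(i, i)\<close>, \<open>(j, j)\<close> and \<open>(i, j)\<close>, whose means the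
    induction hypothesis bounds through \<open>c\<close>.\<close>
  define c' where "c' = w * (B * (1 + 2 * T) + (B + D) * (3 * c))"
  have c': "c' \<ge> 0" using w B D T c by (simp add: c'_def)
  have "(\<integral>\<^sup>+\<zeta>. \<bar>emp_kernel \<phi> sW sb n L x (Suc l) \<zeta> $ i $ j - nngp \<phi> sW sb x (Suc l) $ i $ j\<bar>
        \<partial>PiM (params_upto n L l) (\<lambda>p :: ('n0, 'nL) param. normal_measure (param_sd sW sb n L s p)))
      \<le> ennreal (c' / sqrt (real (Min (n ` {1..L-1}))))" if n: "\<forall>l\<in>{1..L-1}. n l > 0" for n i j
  proof -
    let ?sd = "param_sd sW sb n L s :: ('n0, 'nL) param \<Rightarrow> real"
    let ?I = "params_upto n L m :: ('n0, 'nL) param set" and ?J = "layer_params n L l :: ('n0, 'nL) param set"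
    let ?MI = "PiM ?I (\<lambda>p. normal_measure (?sd p))" and ?MJ = "PiM ?J (\<lambda>p. normal_measure (?sd p))"
    define N where "N = real (Min (n ` {1..L-1}))"
    have "Min (n ` {1..L-1}) \<in> n ` {1..L-1}" using L by (intro Min_in) auto
    then have N1: "N \<ge> 1" using n by (auto simp: N_def Suc_le_eq)
    have Nn: "N \<le> n l" unfolding N_def using lL by (auto intro!: Min_le)
    have nl: "n l > 0" using n lL by auto
    have vl: "sW l > 0" "sb l > 0" using var[of l] lL by auto
    have card: "card (units n L l :: ('n0, 'nL) neuron set) = n l"
      using lL by (auto simp: units_def card_image inj_on_def)
    have meas: "\<phi> l' \<in> borel_measurable borel" if l': "l' \<in> {1..L}" for l'
    proof (cases "l' = 1")
      case True then show ?thesis using phi1 by simp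
    next
      case False
      then obtain C where "C-lipschitz_on UNIV (\<phi> l')" using lip[of l'] l' by force
      then show ?thesis by (rule lipschitz_measurable)
    qed
    have sd: "?sd p > 0" if "p \<in> params_upto n L l" for p
      using that lL var by (auto simp: params_upto_def intro!: param_sd_pos[OF _ _ s, simplified])
    define d where "d \<eta> i j = \<bar>emp_kernel \<phi> sW sb n L x l \<eta> $ i $ j - ?K $ i $ j\<bar>" for \<eta> :: "('n0, 'nL) param \<Rightarrow> real" and i j
    have IH': "(\<integral>\<^sup>+\<eta>. d \<eta> i j \<partial>?MI) \<le> ennreal (c / sqrt N)" for i j
      using IHc[rule_format, of n i j, OF n[rule_format]] unfolding d_def N_def m by simp
    have "?I \<subseteq> params_upto n L l" "?J \<subseteq> params_upto n L l"
      by (rule params_upto_mono, simp add: m) (rule layer_params_subset[OF lL(1) order_refl])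
    then have sdI: "p \<in> ?I \<Longrightarrow> ?sd p > 0" and sdJ: "p \<in> ?J \<Longrightarrow> ?sd p > 0" for p using sd by blast+
    have prob: "prob_space ?MI" "prob_space ?MJ"
      by (rule prob_space_PiM_normal, erule sdI, rule prob_space_PiM_normal, erule sdJ)
    have sMI: "sets ?MI = sets (PiM ?I (\<lambda>_. borel))" by (intro sets_PiM_cong) auto
    have mk: "emp_kernel \<phi> sW sb n L x l \<in> borel_measurable ?MI"
      using measurable_emp_kernel[where m=L and l=l and n=n and L=L and J="?I" and x=x and \<phi>=\<phi> and sW=sW and sb=sb, OF meas] lL m unfolding measurable_cong_sets[OF sMI refl] by simp
    have md[measurable]: "(\<lambda>\<eta>. d \<eta> i j) \<in> borel_measurable ?MI" for i j
      unfolding d_def using borel_measurable_entry[OF mk] by measurable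
    have inner: "(\<integral>\<^sup>+\<theta>. \<bar>emp_kernel \<phi> sW sb n L x (Suc l) (merge ?I ?J (\<eta>, \<theta>)) $ i $ j - nngp \<phi> sW sb x (Suc l) $ i $ j\<bar> \<partial>?MJ)
       \<le> ennreal (w * (B * (1 + 2 * T) / sqrt N)) + ennreal (w * (B + D)) * (ennreal (d \<eta> i i) + ennreal (d \<eta> j j) + ennreal (d \<eta> i j))" for \<eta>
    proof -
      interpret J: prob_space ?MJ by fact
      define S where "S = emp_kernel \<phi> sW sb n L x l \<eta>"
      have S1: "psd S" unfolding S_def by (rule psd_emp_kernel) (use vl in auto)
      have S2: "S $ i $ i > 0" for i
        using emp_kernel_diag[of sW l sb \<phi> n L x \<eta> i] vl by (auto simp: S_def)
      define A where "A \<theta> = (\<Sum>u\<in>units n L l. ?\<psi> (preact \<phi> n L x l \<eta> u \<theta> $ i) * ?\<psi> (preact \<phi> n L x l \<eta> u \<theta> $ j)) / n l" for \<theta>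
      have "(\<lambda>Z :: real^'k. ?\<psi> (Z $ i) * ?\<psi> (Z $ j)) \<in> borel_measurable borel"
        using lipschitz_measurable[OF C] by measurable
      note mA = measurable_compose[OF measurable_preact[where l=l and L=L and sW=sW and sb=sb and s=s and n=n
            and \<phi>=\<phi> and x=x and \<eta>=\<eta>, OF lL vl s] this]
      have [measurable]: "A \<in> borel_measurable ?MJ"
        unfolding A_def[abs_def] by (intro borel_measurable_divide borel_measurable_sum borel_measurable_const mA)
      let ?e = "D * (d \<eta> i i + d \<eta> j j + d \<eta> i j)"
      have e0: "?e \<ge> 0" using D by (simp add: d_def)
      have "\<bar>emp_kernel \<phi> sW sb n L x (Suc l) (merge ?I ?J (\<eta>, \<theta>)) $ i $ j - nngp \<phi> sW sb x (Suc l) $ i $ j\<bar>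
         \<le> w * \<bar>A \<theta> - gexp S ?\<psi> i j\<bar> + w * ?e" for \<theta>
      proof -
        have "emp_kernel \<phi> sW sb n L x (Suc l) (merge ?I ?J (\<eta>, \<theta>)) $ i $ j = w * A \<theta> + sb (Suc l)"
          unfolding m emp_kernel_merge using card unfolding m by (simp add: A_def w_def m)
        moreover have "nngp \<phi> sW sb x (Suc l) $ i $ j = w * gexp ?K ?\<psi> i j + sb (Suc l)"
          unfolding nngp_Suc[OF lL(1)] by (simp add: w_def)
        ultimately have "\<bar>emp_kernel \<phi> sW sb n L x (Suc l) (merge ?I ?J (\<eta>, \<theta>)) $ i $ j - nngp \<phi> sW sb x (Suc l) $ i $ j\<bar>
          = w * \<bar>A \<theta> - gexp ?K ?\<psi> i j\<bar>" using w by (simp add: abs_mult right_diff_distrib[symmetric])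
        also have "\<dots> \<le> w * (\<bar>A \<theta> - gexp S ?\<psi> i j\<bar> + ?e)"
          using D'[rule_format, OF S1 S2, of i j] w unfolding d_def S_def[symmetric] by (intro mult_left_mono) auto
        finally show ?thesis by (simp add: distrib_left)
      qed
      then have "(\<integral>\<^sup>+\<theta>. \<bar>emp_kernel \<phi> sW sb n L x (Suc l) (merge ?I ?J (\<eta>, \<theta>)) $ i $ j - nngp \<phi> sW sb x (Suc l) $ i $ j\<bar> \<partial>?MJ)
        \<le> (\<integral>\<^sup>+\<theta>. ennreal w * ennreal \<bar>A \<theta> - gexp S ?\<psi> i j\<bar> + ennreal (w * ?e) \<partial>?MJ)"
        using w e0 by (intro nn_integral_mono) (simp add: ennreal_mult'[symmetric] ennreal_plus[symmetric] ennreal_leI del: ennreal_plus)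
      also have "\<dots> = ennreal w * (\<integral>\<^sup>+\<theta>. \<bar>A \<theta> - gexp S ?\<psi> i j\<bar> \<partial>?MJ) + ennreal (w * ?e)"
        by (subst nn_integral_add) (auto simp: nn_integral_cmult J.emeasure_space_1)
      also have "(\<integral>\<^sup>+\<theta>. \<bar>A \<theta> - gexp S ?\<psi> i j\<bar> \<partial>?MJ) \<le> ennreal (B * (1 + S $ i $ i + S $ j $ j) / sqrt (n l))"
        unfolding A_def S_def using B'[rule_format, OF S1 S2] unfolding S_def by (intro layer_average_bound[where l=l and L=L and sW=sW and sb=sb and s=s and n=n and \<phi>=\<phi> and x=x and \<eta>=\<eta>, OF lL vl s C nl B]) auto
      also have "B * (1 + S $ i $ i + S $ j $ j) / sqrt (n l) \<le> B * (1 + 2 * T) / sqrt N + B * (d \<eta> i i + d \<eta> j j + d \<eta> i j)"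
      proof -
        \<comment> \<open>The deterministic part must keep the rate \<open>1 / sqrt N\<close>; the
          part proportional to the kernel error already has that rate in mean, so there the crude
          bound 1 suffices.\<close>
        have q: "1 / sqrt (n l) \<le> 1 / sqrt N" "1 / sqrt (n l) \<le> 1" using N1 Nn by (auto intro!: frac_le)
        have S': "1 + S $ i $ i + S $ j $ j \<le> (1 + 2 * T) + (d \<eta> i i + d \<eta> j j + d \<eta> i j)"
          using KT[of i] KT[of j] by (simp add: d_def S_def)
        have "B * (1 + S $ i $ i + S $ j $ j) / sqrt (n l) \<le> B * ((1 + 2 * T) + (d \<eta> i i + d \<eta> j j + d \<eta> i j)) / sqrt (n l)"
          using B S' by (intro divide_right_mono mult_left_mono) auto
        also have "\<dots> = B * (1 + 2 * T) * (1 / sqrt (n l)) + B * (d \<eta> i i + d \<eta> j j + d \<eta> i j) * (1 / sqrt (n l))"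
          by (simp add: algebra_simps add_divide_distrib)
        also have "\<dots> \<le> B * (1 + 2 * T) * (1 / sqrt N) + B * (d \<eta> i i + d \<eta> j j + d \<eta> i j) * 1"
          using B T q by (intro add_mono mult_left_mono) (auto simp: d_def)
        finally show ?thesis by simp
      qed
      finally have "(\<integral>\<^sup>+\<theta>. \<bar>emp_kernel \<phi> sW sb n L x (Suc l) (merge ?I ?J (\<eta>, \<theta>)) $ i $ j - nngp \<phi> sW sb x (Suc l) $ i $ j\<bar> \<partial>?MJ)
         \<le> ennreal w * ennreal (B * (1 + 2 * T) / sqrt N + B * (d \<eta> i i + d \<eta> j j + d \<eta> i j)) + ennreal (w * ?e)"
        by (simp add: add_mono mult_left_mono ennreal_leI)
      also have "\<dots> = ennreal (w * (B * (1 + 2 * T) / sqrt N + B * (d \<eta> i i + d \<eta> j j + d \<eta> i j)) + w * ?e)"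
        using w e0 B T N1 by (subst ennreal_plus) (auto simp: ennreal_mult d_def)
      also have "w * (B * (1 + 2 * T) / sqrt N + B * (d \<eta> i i + d \<eta> j j + d \<eta> i j)) + w * ?e
         = w * (B * (1 + 2 * T) / sqrt N) + w * (B + D) * (d \<eta> i i + d \<eta> j j + d \<eta> i j)" by (simp add: algebra_simps)
      also have "ennreal \<dots> = ennreal (w * (B * (1 + 2 * T) / sqrt N)) + ennreal (w * (B + D)) * (ennreal (d \<eta> i i) + ennreal (d \<eta> j j) + ennreal (d \<eta> i j))"
        using w B D T N1 by (simp add: ennreal_mult d_def)
      finally show ?thesis .
    qed
    interpret I: prob_space ?MI by fact
    have Un: "params_upto n L l = ?I \<union> ?J" unfolding m by (rule params_upto_Suc)
    have mI: "(\<lambda>\<zeta>. ennreal \<bar>emp_kernel \<phi> sW sb n L x (Suc l) \<zeta> $ i $ j - nngp \<phi> sW sb x (Suc l) $ i $ j\<bar>) \<in> borel_measurable (PiM (?I \<union> ?J) (\<lambda>_. borel))"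
      using borel_measurable_entry[OF measurable_emp_kernel[where m=L and l="Suc l" and n=n and L=L and J="?I \<union> ?J" and x=x and \<phi>=\<phi> and sW=sW and sb=sb, OF meas], of i j] lL Un by simp
    have "(\<integral>\<^sup>+\<zeta>. \<bar>emp_kernel \<phi> sW sb n L x (Suc l) \<zeta> $ i $ j - nngp \<phi> sW sb x (Suc l) $ i $ j\<bar> \<partial>PiM (params_upto n L l) (\<lambda>p. normal_measure (?sd p)))
       = (\<integral>\<^sup>+\<eta>. (\<integral>\<^sup>+\<theta>. \<bar>emp_kernel \<phi> sW sb n L x (Suc l) (merge ?I ?J (\<eta>, \<theta>)) $ i $ j - nngp \<phi> sW sb x (Suc l) $ i $ j\<bar> \<partial>?MJ) \<partial>?MI)"
      unfolding Un using sd layer_params_disjoint[of n L m] unfolding m[symmetric] Un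
      by (intro nn_integral_PiM_normal_Un mI) auto
    also have "\<dots> \<le> (\<integral>\<^sup>+\<eta>. ennreal (w * (B * (1 + 2 * T) / sqrt N)) + ennreal (w * (B + D)) * (ennreal (d \<eta> i i) + ennreal (d \<eta> j j) + ennreal (d \<eta> i j)) \<partial>?MI)"
      by (intro nn_integral_mono inner)
    also have "\<dots> = ennreal (w * (B * (1 + 2 * T) / sqrt N)) + ennreal (w * (B + D)) * ((\<integral>\<^sup>+\<eta>. d \<eta> i i \<partial>?MI) + (\<integral>\<^sup>+\<eta>. d \<eta> j j \<partial>?MI) + (\<integral>\<^sup>+\<eta>. d \<eta> i j \<partial>?MI))"
      by (simp add: nn_integral_add nn_integral_cmult I.emeasure_space_1)
    also have "\<dots> \<le> ennreal (w * (B * (1 + 2 * T) / sqrt N)) + ennreal (w * (B + D)) * (ennreal (c / sqrt N) + ennreal (c / sqrt N) + ennreal (c / sqrt N))"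
      by (intro add_mono mult_left_mono IH') auto
    also have "\<dots> = ennreal (w * (B * (1 + 2 * T) / sqrt N) + w * (B + D) * (c / sqrt N + c / sqrt N + c / sqrt N))"
      using w B D T N1 c by (simp add: ennreal_mult'[symmetric] ennreal_plus[symmetric] del: ennreal_plus)
    also have "w * (B * (1 + 2 * T) / sqrt N) + w * (B + D) * (c / sqrt N + c / sqrt N + c / sqrt N) = c' / sqrt N"
      by (simp add: c'_def field_simps add_divide_distrib)
    finally show ?thesis unfolding N_def .
  qed
  then show ?case using c' by (intro exI[of _ c']) simp
qed

section \<open>Couplings of reweighted laws\<close>

text \<open>The excesses of the two densities over their minimum have the same mass
  \<open>m\<close>, because both densities integrate to 1, so their normalised product completes the
  coupling. On the excess nothing relates the two points, and their distance is bounded by the sum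
  of the norms.\<close>

lemma W1_common_density_bound:
  fixes Y Y' :: "'v \<Rightarrow> 'a::euclidean_space" and \<alpha> \<beta> :: "'v \<Rightarrow> real"
  assumes "prob_space V" and [measurable]: "Y \<in> borel_measurable V" "Y' \<in> borel_measurable V"
      "\<alpha> \<in> borel_measurable V" "\<beta> \<in> borel_measurable V"
    and nn: "\<And>v. 0 \<le> \<alpha> v" "\<And>v. 0 \<le> \<beta> v"
    and one: "(\<integral>\<^sup>+v. \<alpha> v \<partial>V) = 1" "(\<integral>\<^sup>+v. \<beta> v \<partial>V) = 1"
  shows "W1 (distr (density V \<alpha>) borel Y) (distr (density V \<beta>) borel Y')
     \<le> (\<integral>\<^sup>+v. ennreal (min (\<alpha> v) (\<beta> v) * norm (Y v - Y' v)) + ennreal (\<bar>\<alpha> v - \<beta> v\<bar> * (norm (Y v) + norm (Y' v))) \<partial>V)"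
proof -
  interpret prob_space V by fact
  let ?bool = "count_space (UNIV :: bool set)"
  interpret bool: sigma_finite_measure ?bool by (rule sigma_finite_measure_count_space_finite) simp
  interpret VB: pair_sigma_finite V ?bool ..
  have VB_sf: "sigma_finite_measure (V \<Otimes>\<^sub>M ?bool)" by unfold_locales
  let ?P = "distr (density V \<alpha>) borel Y" and ?Q = "distr (density V \<beta>) borel Y'"
  define Mn where "Mn v = ennreal (min (\<alpha> v) (\<beta> v))" for v
  define A where "A v = ennreal (max 0 (\<alpha> v - \<beta> v))" for v
  define B where "B v = ennreal (max 0 (\<beta> v - \<alpha> v))" for v
  have [measurable]: "Mn \<in> borel_measurable V" "A \<in> borel_measurable V" "B \<in> borel_measurable V"
    unfolding Mn_def[abs_def] A_def[abs_def] B_def[abs_def] by measurable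
  have MA: "Mn v + A v = ennreal (\<alpha> v)" and MB: "Mn v + B v = ennreal (\<beta> v)" for v
    using nn[of v] by (auto simp: Mn_def A_def B_def min_def max_def simp flip: ennreal_plus)
  have "(\<integral>\<^sup>+v. Mn v \<partial>V) + (\<integral>\<^sup>+v. A v \<partial>V) = 1" "(\<integral>\<^sup>+v. Mn v \<partial>V) + (\<integral>\<^sup>+v. B v \<partial>V) = 1"
    using one by (simp_all add: nn_integral_add[symmetric] MA MB)
  then have mass: "(\<integral>\<^sup>+v. B v \<partial>V) = (\<integral>\<^sup>+v. A v \<partial>V)" "(\<integral>\<^sup>+v. A v \<partial>V) \<noteq> \<top>"
    by (metis ennreal_add_left_cancel ennreal_one_neq_top add_top_left_ennreal top_neq_ennreal add_eq_0_iff_both_eq_0 ennreal_add_eq_top)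
      (metis \<open>integral\<^sup>N V Mn + integral\<^sup>N V A = 1\<close> ennreal_add_eq_top ennreal_one_neq_top)
  define m where "m = (\<integral>\<^sup>+v. A v \<partial>V)"
  have m: "(\<integral>\<^sup>+v. A v \<partial>V) = m" "(\<integral>\<^sup>+v. B v \<partial>V) = m" "m \<noteq> \<top>" using mass by (auto simp: m_def)
  \<comment> \<open>Normalising the product part divides by \<open>m\<close>. If
    \<open>m = 0\<close> the excess densities vanish almost everywhere, and the formula remains true
    because \<open>0 / 0 = 0\<close> in \<open>ennreal\<close>.\<close>
  have scale: "(\<integral>\<^sup>+v. F v * h v \<partial>V) * m / m = (\<integral>\<^sup>+v. F v * h v \<partial>V)"
    if "F \<in> borel_measurable V" "(\<integral>\<^sup>+v. F v \<partial>V) = m" "h \<in> borel_measurable V" for F h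
  proof (cases "m = 0")
    case True
    then have "AE v in V. F v = 0" using that by (simp add: nn_integral_0_iff_AE)
    then have "(\<integral>\<^sup>+v. F v * h v \<partial>V) = 0" using that by (subst nn_integral_0_iff_AE) auto
    then show ?thesis by simp
  next
    case False
    then show ?thesis using m(3) by (simp add: ennreal_mult_divide_eq)
  qed
  \<comment> \<open>The flag selects the common part or the excess part, so that the coupling is the
    image of a single measure. In the common part the second sample is idle and integrates to
    1.\<close>
  define W where "W z = (if snd (snd z) then Mn (fst z) else A (fst z) * B (fst (snd z)) / m)" for z :: "'v \<times> 'v \<times> bool"
  define T where "T z = (Y (fst z), if snd (snd z) then Y' (fst z) else Y' (fst (snd z)))" for z :: "'v \<times> 'v \<times> bool"
  let ?VV = "V \<Otimes>\<^sub>M V \<Otimes>\<^sub>M ?bool"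
  have [measurable]: "W \<in> borel_measurable ?VV" unfolding W_def[abs_def] by measurable
  have T[measurable]: "T \<in> ?VV \<rightarrow>\<^sub>M borel \<Otimes>\<^sub>M borel" unfolding T_def[abs_def] by measurable
  define \<gamma> where "\<gamma> = distr (density ?VV W) (borel \<Otimes>\<^sub>M borel) T"
  have int: "(\<integral>\<^sup>+z. h z \<partial>\<gamma>) = (\<integral>\<^sup>+v. Mn v * h (Y v, Y' v) \<partial>V) + (\<integral>\<^sup>+v. \<integral>\<^sup>+v'. A v * B v' / m * h (Y v, Y' v') \<partial>V \<partial>V)"
    if [measurable]: "h \<in> borel_measurable (borel \<Otimes>\<^sub>M borel)" for h
  proof -
    have "(\<integral>\<^sup>+z. h z \<partial>\<gamma>) = (\<integral>\<^sup>+z. W z * h (T z) \<partial>?VV)"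
      unfolding \<gamma>_def by (simp add: nn_integral_distr nn_integral_density)
    also have "\<dots> = (\<integral>\<^sup>+v. \<integral>\<^sup>+u. W (v, u) * h (T (v, u)) \<partial>(V \<Otimes>\<^sub>M ?bool) \<partial>V)"
      by (subst sigma_finite_measure.nn_integral_fst[OF VB_sf, symmetric]) auto
    also have "\<dots> = (\<integral>\<^sup>+v. \<integral>\<^sup>+v'. \<integral>\<^sup>+f. W (v, v', f) * h (T (v, v', f)) \<partial>?bool \<partial>V \<partial>V)"
      by (intro nn_integral_cong, subst bool.nn_integral_fst[symmetric]) auto
    also have "\<dots> = (\<integral>\<^sup>+v. \<integral>\<^sup>+v'. Mn v * h (Y v, Y' v) + A v * B v' / m * h (Y v, Y' v') \<partial>V \<partial>V)"
      by (simp add: nn_integral_count_space_finite UNIV_bool W_def T_def add.commute)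
    also have "\<dots> = (\<integral>\<^sup>+v. Mn v * h (Y v, Y' v) + (\<integral>\<^sup>+v'. A v * B v' / m * h (Y v, Y' v') \<partial>V) \<partial>V)"
      by (intro nn_integral_cong, subst nn_integral_add) (auto simp: emeasure_space_1)
    also have "\<dots> = (\<integral>\<^sup>+v. Mn v * h (Y v, Y' v) \<partial>V) + (\<integral>\<^sup>+v. \<integral>\<^sup>+v'. A v * B v' / m * h (Y v, Y' v') \<partial>V \<partial>V)"
      by (subst nn_integral_add) auto
    finally show ?thesis .
  qed
  have h1: "(\<integral>\<^sup>+v. \<integral>\<^sup>+v'. A v * B v' / m * h v \<partial>V \<partial>V) = (\<integral>\<^sup>+v. A v * h v \<partial>V)" if [measurable]: "h \<in> borel_measurable V" for h
  proof -
    have "(\<integral>\<^sup>+v. \<integral>\<^sup>+v'. A v * B v' / m * h v \<partial>V \<partial>V) = (\<integral>\<^sup>+v. \<integral>\<^sup>+v'. (A v * h v / m) * B v' \<partial>V \<partial>V)"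
      by (simp add: divide_ennreal_def mult_ac)
    also have "\<dots> = (\<integral>\<^sup>+v. (A v * h v) * (inverse m * m) \<partial>V)"
      by (simp add: nn_integral_cmult m divide_ennreal_def mult.assoc)
    also have "\<dots> = (\<integral>\<^sup>+v. A v * h v \<partial>V) * (inverse m * m)"
      by (rule nn_integral_multc) simp
    also have "\<dots> = (\<integral>\<^sup>+v. A v * h v \<partial>V) * m / m"
      by (simp add: divide_ennreal_def mult_ac)
    finally show ?thesis using scale[of A h] m by simp
  qed
  have h2: "(\<integral>\<^sup>+v. \<integral>\<^sup>+v'. A v * B v' / m * h v' \<partial>V \<partial>V) = (\<integral>\<^sup>+v. B v * h v \<partial>V)" if [measurable]: "h \<in> borel_measurable V" for h
  proof -
    have "(\<integral>\<^sup>+v. \<integral>\<^sup>+v'. A v * B v' / m * h v' \<partial>V \<partial>V) = (\<integral>\<^sup>+v. \<integral>\<^sup>+v'. (A v / m) * (B v' * h v') \<partial>V \<partial>V)"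
      by (simp add: divide_ennreal_def mult_ac)
    also have "\<dots> = (\<integral>\<^sup>+v. A v * (inverse m * (\<integral>\<^sup>+v. B v * h v \<partial>V)) \<partial>V)"
      by (simp add: nn_integral_cmult divide_ennreal_def mult.assoc)
    also have "\<dots> = m * (inverse m * (\<integral>\<^sup>+v. B v * h v \<partial>V))"
      by (subst nn_integral_multc) (simp_all add: m)
    also have "\<dots> = (\<integral>\<^sup>+v. B v * h v \<partial>V) * m / m"
      by (simp add: divide_ennreal_def mult_ac)
    finally show ?thesis using scale[of B h] m by simp
  qed
  have sP: "sets ?P = sets borel" "sets ?Q = sets borel" by auto
  have fstP: "distr \<gamma> ?P fst = ?P"
  proof (rule measure_eqI)
    fix S assume "S \<in> sets (distr \<gamma> ?P fst)"
    then have S[measurable]: "S \<in> sets borel" by simp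
    have "emeasure (distr \<gamma> ?P fst) S = (\<integral>\<^sup>+z. indicator S (fst z) \<partial>\<gamma>)"
      by (subst nn_integral_indicator[symmetric], simp, subst nn_integral_distr) (auto simp: \<gamma>_def)
    also have "\<dots> = (\<integral>\<^sup>+v. Mn v * indicator S (Y v) \<partial>V) + (\<integral>\<^sup>+v. A v * indicator S (Y v) \<partial>V)"
      by (subst int) (auto simp: h1)
    also have "\<dots> = (\<integral>\<^sup>+v. ennreal (\<alpha> v) * indicator S (Y v) \<partial>V)"
      by (simp add: nn_integral_add[symmetric] distrib_right[symmetric] MA)
    also have "\<dots> = emeasure ?P S"
      by (simp add: emeasure_distr emeasure_density) (intro nn_integral_cong; auto split: split_indicator)
    finally show "emeasure (distr \<gamma> ?P fst) S = emeasure ?P S" .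
  qed simp
  have sndQ: "distr \<gamma> ?Q snd = ?Q"
  proof (rule measure_eqI)
    fix S assume "S \<in> sets (distr \<gamma> ?Q snd)"
    then have S[measurable]: "S \<in> sets borel" by simp
    have "emeasure (distr \<gamma> ?Q snd) S = (\<integral>\<^sup>+z. indicator S (snd z) \<partial>\<gamma>)"
      by (subst nn_integral_indicator[symmetric], simp, subst nn_integral_distr) (auto simp: \<gamma>_def)
    also have "\<dots> = (\<integral>\<^sup>+v. Mn v * indicator S (Y' v) \<partial>V) + (\<integral>\<^sup>+v. B v * indicator S (Y' v) \<partial>V)"
      by (subst int) (auto simp: h2)
    also have "\<dots> = (\<integral>\<^sup>+v. ennreal (\<beta> v) * indicator S (Y' v) \<partial>V)"
      by (simp add: nn_integral_add[symmetric] distrib_right[symmetric] MB)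
    also have "\<dots> = emeasure ?Q S"
      by (simp add: emeasure_distr emeasure_density) (intro nn_integral_cong; auto split: split_indicator)
    finally show "emeasure (distr \<gamma> ?Q snd) S = emeasure ?Q S" .
  qed simp
  have "prob_space \<gamma>"
  proof (rule prob_spaceI)
    have "emeasure \<gamma> (space \<gamma>) = (\<integral>\<^sup>+z. 1 \<partial>\<gamma>)" by simp
    also have "\<dots> = (\<integral>\<^sup>+v. Mn v \<partial>V) + (\<integral>\<^sup>+v. A v \<partial>V)"
      using int[of "\<lambda>_. 1"] h1[of "\<lambda>_. 1"] by simp
    also have "\<dots> = 1" using one by (simp add: nn_integral_add[symmetric] MA)
    finally show "emeasure \<gamma> (space \<gamma>) = 1" .
  qed
  moreover have "sets \<gamma> = sets (?P \<Otimes>\<^sub>M ?Q)"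
    unfolding \<gamma>_def sets_distr by (intro sets_pair_measure_cong) (simp_all add: sP)
  ultimately have "\<gamma> \<in> couplings ?P ?Q" using fstP sndQ by (simp add: couplings_def)
  then have "W1 ?P ?Q \<le> (\<integral>\<^sup>+z. norm (fst z - snd z) \<partial>\<gamma>)"
    unfolding W1_def by (rule INF_lower)
  also have "\<dots> = (\<integral>\<^sup>+v. Mn v * norm (Y v - Y' v) \<partial>V) + (\<integral>\<^sup>+v. \<integral>\<^sup>+v'. A v * B v' / m * norm (Y v - Y' v') \<partial>V \<partial>V)"
    by (subst int) auto
  also have "(\<integral>\<^sup>+v. \<integral>\<^sup>+v'. A v * B v' / m * norm (Y v - Y' v') \<partial>V \<partial>V)
     \<le> (\<integral>\<^sup>+v. \<integral>\<^sup>+v'. A v * B v' / m * ennreal (norm (Y v)) + A v * B v' / m * ennreal (norm (Y' v')) \<partial>V \<partial>V)"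
    by (intro nn_integral_mono)
       (auto simp: distrib_left[symmetric] norm_triangle_ineq4 simp flip: ennreal_plus intro!: mult_left_mono ennreal_leI)
  also have "\<dots> = (\<integral>\<^sup>+v. \<integral>\<^sup>+v'. A v * B v' / m * norm (Y v) \<partial>V \<partial>V) + (\<integral>\<^sup>+v. \<integral>\<^sup>+v'. A v * B v' / m * norm (Y' v') \<partial>V \<partial>V)"
    by (subst nn_integral_add[symmetric]; simp add: nn_integral_add)
  also have "\<dots> = (\<integral>\<^sup>+v. A v * norm (Y v) \<partial>V) + (\<integral>\<^sup>+v. B v * norm (Y' v) \<partial>V)"
    by (simp add: h1 h2)
  also have "(\<integral>\<^sup>+v. Mn v * norm (Y v - Y' v) \<partial>V) + ((\<integral>\<^sup>+v. A v * norm (Y v) \<partial>V) + (\<integral>\<^sup>+v. B v * norm (Y' v) \<partial>V))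
    = (\<integral>\<^sup>+v. Mn v * norm (Y v - Y' v) + (A v * norm (Y v) + B v * norm (Y' v)) \<partial>V)"
    by (simp add: nn_integral_add)
  also have "\<dots> \<le> (\<integral>\<^sup>+v. ennreal (min (\<alpha> v) (\<beta> v) * norm (Y v - Y' v)) + ennreal (\<bar>\<alpha> v - \<beta> v\<bar> * (norm (Y v) + norm (Y' v))) \<partial>V)"
  proof (intro nn_integral_mono add_mono)
    fix v
    show "Mn v * norm (Y v - Y' v) \<le> ennreal (min (\<alpha> v) (\<beta> v) * norm (Y v - Y' v))"
      using nn[of v] by (simp add: Mn_def ennreal_mult)
    have "max 0 (\<alpha> v - \<beta> v) * norm (Y v) + max 0 (\<beta> v - \<alpha> v) * norm (Y' v) \<le> \<bar>\<alpha> v - \<beta> v\<bar> * norm (Y v) + \<bar>\<alpha> v - \<beta> v\<bar> * norm (Y' v)"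
      by (intro add_mono mult_right_mono) auto
    moreover have "A v * norm (Y v) + B v * norm (Y' v) = ennreal (max 0 (\<alpha> v - \<beta> v) * norm (Y v) + max 0 (\<beta> v - \<alpha> v) * norm (Y' v))"
      unfolding A_def B_def by (subst ennreal_plus) (auto simp: ennreal_mult'')
    ultimately show "A v * norm (Y v) + B v * norm (Y' v) \<le> ennreal (\<bar>\<alpha> v - \<beta> v\<bar> * (norm (Y v) + norm (Y' v)))"
      by (simp add: distrib_left ennreal_leI del: ennreal_plus)
  qed
  finally show ?thesis by (simp add: add_mono)
qed

section \<open>Scaled likelihood and the law of the variance\<close>

lemma nn_integral_powr_exp_inverse_finite:
  fixes q b :: real
  assumes "q > 0" "b > 0"
  shows "(\<integral>\<^sup>+s. indicator {0<..} s * ennreal (s powr (- q - 1) * exp (- b / s)) \<partial>lborel) < \<infinity>"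
proof -
  \<comment> \<open>Large enough for \<open>s powr N\<close> to cancel the singularity at 0; the
    N-th term of the exponential series bounds \<open>exp (- b / s)\<close> by a multiple of this
    power.\<close>
  define N where "N = nat \<lceil>q + 1\<rceil>"
  have N: "real N \<ge> q + 1" unfolding N_def by (rule real_nat_ceiling_ge)
  define C where "C = fact N / b ^ N"
  have C: "C > 0" using assms by (simp add: C_def)
  have small: "s powr (- q - 1) * exp (- b / s) \<le> C" if s: "0 < s" "s \<le> 1" for s
  proof -
    have "(b / s) ^ N / fact N \<le> exp (b / s)"
    proof -
      have "(b / s) ^ N / fact N = (\<Sum>n\<in>{N}. (b / s) ^ n /\<^sub>R fact n)" by (simp add: divide_inverse mult.commute)
      also have "\<dots> \<le> (\<Sum>n. (b / s) ^ n /\<^sub>R fact n)"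
        using assms s by (intro sum_le_suminf summable_exp_generic) auto
      finally show ?thesis by (simp add: exp_def)
    qed
    then have "exp (- b / s) \<le> fact N / (b / s) ^ N"
      using assms s by (simp add: exp_minus field_simps)
    also have "\<dots> = C * s powr N" using s by (simp add: C_def power_divide powr_realpow)
    finally have "s powr (- q - 1) * exp (- b / s) \<le> s powr (- q - 1) * (C * s powr N)"
      by (intro mult_left_mono) auto
    also have "\<dots> = C * s powr (real N - q - 1)" by (simp add: powr_add[symmetric] algebra_simps)
    also have "\<dots> \<le> C * 1" using C s N by (intro mult_left_mono powr_le1) auto
    finally show ?thesis by simp
  qed
  have "(\<integral>\<^sup>+s. indicator {0<..} s * ennreal (s powr (- q - 1) * exp (- b / s)) \<partial>lborel)
     \<le> (\<integral>\<^sup>+s. ennreal C * indicator {0..1} s + ennreal (s powr (- q - 1)) * indicator {1..} s \<partial>lborel)"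
  proof (rule nn_integral_mono)
    fix s :: real
    show "indicator {0<..} s * ennreal (s powr (- q - 1) * exp (- b / s)) \<le> ennreal C * indicator {0..1} s + ennreal (s powr (- q - 1)) * indicator {1..} s"
    proof (cases "s \<le> 1")
      case True
      then have "indicator {0<..} s * ennreal (s powr (- q - 1) * exp (- b / s)) \<le> ennreal C * indicator {0..1} s"
        using small[of s] by (auto simp: indicator_def ennreal_leI)
      then show ?thesis by (rule add_increasing2[rotated]) simp
    next
      case False
      then have "s powr (- q - 1) * exp (- b / s) \<le> s powr (- q - 1) * 1" using assms by (intro mult_left_mono) auto
      then show ?thesis using False by (auto simp: indicator_def ennreal_leI)
    qed
  qed
  also have "\<dots> = ennreal C + (\<integral>\<^sup>+s. ennreal (s powr (- q - 1)) * indicator {1..} s \<partial>lborel)"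
    by (subst nn_integral_add) (auto simp: nn_integral_cmult)
  also have "(\<integral>\<^sup>+s. ennreal (s powr (- q - 1)) * indicator {1..} s \<partial>lborel) = ennreal (- (1 powr (- q - 1 + 1)) / (- q - 1 + 1))"
    by (rule nn_integral_has_integral_lebesgue'[OF _ has_integral_powr_to_inf]) (use assms in auto)
  also have "ennreal C + \<dots> < \<infinity>" by simp
  finally show ?thesis .
qed


lemma exp_neg_half_square_lipschitz:
  fixes u v :: real
  assumes "0 \<le> u" "0 \<le> v"
  shows "\<bar>exp (- u\<^sup>2 / 2) - exp (- v\<^sup>2 / 2)\<bar> \<le> \<bar>u - v\<bar>"
proof -
  have "norm (exp (- u\<^sup>2 / 2) - exp (- v\<^sup>2 / 2)) \<le> 1 * norm (u - v)"
  proof (rule field_differentiable_bound[of "{0..}" "\<lambda>x. exp (- x\<^sup>2 / 2)" "\<lambda>x. - x * exp (- x\<^sup>2 / 2)"])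
    fix z :: real assume z: "z \<in> {0..}"
    show "((\<lambda>x. exp (- x\<^sup>2 / 2)) has_field_derivative - z * exp (- z\<^sup>2 / 2)) (at z within {0..})"
      by (auto intro!: derivative_eq_intros)
    have "z \<le> 1 + z\<^sup>2 / 2" using zero_le_power2[of "z - 1"] by (simp add: power2_eq_square algebra_simps)
    also have "\<dots> \<le> exp (z\<^sup>2 / 2)" by (rule exp_ge_add_one_self)
    finally show "norm (- z * exp (- z\<^sup>2 / 2)) \<le> 1"
      using z by (simp add: exp_minus field_simps)
  qed (use assms in auto)
  then show ?thesis by simp
qed

text \<open>In the variable \<open>v = z / sqrt s\<close> the likelihood is \<open>fit y s v\<close> times a power of \<open>s\<close>, which is
  absorbed into the law of \<open>s\<close> below; \<open>fit y s\<close> is bounded and Lipschitz uniformly in \<open>s\<close>.\<close>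
definition fit :: "'a::real_normed_vector \<Rightarrow> real \<Rightarrow> 'a \<Rightarrow> real" where
  "fit y s v = exp (- (norm ((1 / sqrt s) *\<^sub>R y - v))\<^sup>2 / 2)"

lemma fit_pos: "0 < fit y s v" and fit_le_1: "fit y s v \<le> 1"
  by (auto simp: fit_def)

lemma fit_lipschitz: "\<bar>fit y s v - fit y s v'\<bar> \<le> norm (v - v')"
proof -
  let ?y = "(1 / sqrt s) *\<^sub>R y"
  have "\<bar>fit y s v - fit y s v'\<bar> \<le> \<bar>norm (?y - v) - norm (?y - v')\<bar>"
    unfolding fit_def by (rule exp_neg_half_square_lipschitz) auto
  also have "\<dots> \<le> norm ((?y - v) - (?y - v'))" by (rule norm_triangle_ineq3)
  finally show ?thesis by (simp add: norm_minus_commute)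
qed

text \<open>Keeps the normalising constant away from 0 for all networks at once. The variables
  \<open>s\<close> and \<open>v\<close> are separated and \<open>norm v\<close> enters linearly, so
  that after integration a first moment of \<open>v\<close> suffices.\<close>

lemma fit_lower_bound:
  assumes "R > 0"
  shows "exp (- (norm ((1 / sqrt s) *\<^sub>R y))\<^sup>2) * (exp (- R\<^sup>2) * (1 - norm v / R)) \<le> fit y s v"
proof -
  let ?u = "norm ((1 / sqrt s) *\<^sub>R y)"
  have "(norm ((1 / sqrt s) *\<^sub>R y - v))\<^sup>2 \<le> (?u + norm v)\<^sup>2" by (intro power_mono norm_triangle_ineq4) auto
  also have "\<dots> \<le> 2 * ?u\<^sup>2 + 2 * (norm v)\<^sup>2"
  proof -
    have "(p + q)\<^sup>2 \<le> 2 * p\<^sup>2 + 2 * q\<^sup>2" for p q :: real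
      using zero_le_power2[of "p - q"] by (simp add: power2_eq_square algebra_simps)
    then show ?thesis .
  qed
  finally have "exp (- ?u\<^sup>2) * exp (- (norm v)\<^sup>2) \<le> fit y s v"
    by (simp add: fit_def exp_add[symmetric])
  moreover have "exp (- R\<^sup>2) * (1 - norm v / R) \<le> exp (- (norm v)\<^sup>2)"
  proof (cases "norm v \<le> R")
    case True
    then have "exp (- R\<^sup>2) * (1 - norm v / R) \<le> exp (- R\<^sup>2) * 1" using assms by (intro mult_left_mono) auto
    also have "\<dots> \<le> exp (- (norm v)\<^sup>2)" using True by (simp add: power_mono)
    finally show ?thesis .
  next
    case False
    then have "exp (- R\<^sup>2) * (1 - norm v / R) \<le> 0" using assms by (intro mult_nonneg_nonpos) auto
    then show ?thesis by (meson exp_ge_zero order_trans)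
  qed
  ultimately show ?thesis by (meson exp_ge_zero mult_left_mono order_trans)
qed

lemma likelihood_eq_fit:
  fixes y v :: "real^'k::finite^'nL::finite"
  assumes "s > 0"
  shows "likelihood y (sqrt s *\<^sub>R v) s = (2 * pi * s) powr (- real (CARD('nL) * CARD('k)) / 2) * fit y s v"
proof -
  have "y - sqrt s *\<^sub>R v = sqrt s *\<^sub>R ((1 / sqrt s) *\<^sub>R y - v)" using assms by (simp add: scaleR_diff_right)
  then have "(norm (y - sqrt s *\<^sub>R v))\<^sup>2 = s * (norm ((1 / sqrt s) *\<^sub>R y - v))\<^sup>2"
    using assms by (simp add: power_mult_distrib)
  then show ?thesis using assms by (simp add: likelihood_def fit_def)
qed

text \<open>Up to a constant, the Inverse-Gamma density of shape \<open>a + d / 2\<close> and scale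
  \<open>b\<close>: the power of \<open>s\<close> in the likelihood of \<open>d\<close> real
  observations is merged with the prior density.\<close>

definition tilted_density :: "real \<Rightarrow> real \<Rightarrow> real \<Rightarrow> real \<Rightarrow> ennreal" where
  "tilted_density a b d s = indicator {0<..} s * ennreal (invgamma_density a b s * (2 * pi * s) powr (- d / 2))"

lemma measurable_tilted_density [measurable]: "tilted_density a b d \<in> borel_measurable borel"
  unfolding tilted_density_def[abs_def] invgamma_density_def[abs_def] by measurable

lemma tilted_density_moment_finite:
  assumes "a > 0" "b > 0" "a + d / 2 > r"
  shows "(\<integral>\<^sup>+s. tilted_density a b d s * ennreal (s powr r) \<partial>lborel) < \<infinity>"
proof -
  define k where "k = b powr a / Gamma a * (2 * pi) powr (- d / 2)"
  have k: "k \<ge> 0" using assms by (simp add: k_def Gamma_real_nonneg)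
  have "tilted_density a b d s * ennreal (s powr r)
     = ennreal k * (indicator {0<..} s * ennreal (s powr (- (a + d / 2 - r) - 1) * exp (- b / s)))" for s
  proof (cases "s > 0")
    case True
    have "s powr (- a - 1) * s powr (- d / 2) * s powr r = s powr (- (a + d / 2 - r) - 1)"
      by (simp add: powr_add[symmetric] algebra_simps)
    then have "invgamma_density a b s * (2 * pi * s) powr (- d / 2) * s powr r = k * (s powr (- (a + d / 2 - r) - 1) * exp (- b / s))"
      using True by (simp add: invgamma_density_def k_def powr_mult)
    then show ?thesis using True k by (simp add: tilted_density_def flip: ennreal_mult'')
  qed (simp add: tilted_density_def)
  then have "(\<integral>\<^sup>+s. tilted_density a b d s * ennreal (s powr r) \<partial>lborel)
     = ennreal k * (\<integral>\<^sup>+s. indicator {0<..} s * ennreal (s powr (- (a + d / 2 - r) - 1) * exp (- b / s)) \<partial>lborel)"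
    by (simp add: nn_integral_cmult)
  also have "\<dots> < \<infinity>"
    using nn_integral_powr_exp_inverse_finite[of "a + d / 2 - r" b] assms by (simp add: ennreal_mult_less_top)
  finally show ?thesis .
qed

lemma tilted_density_mass_pos:
  assumes "a > 0" "b > 0"
  shows "(\<integral>\<^sup>+s. tilted_density a b d s \<partial>lborel) \<noteq> 0"
proof
  assume "(\<integral>\<^sup>+s. tilted_density a b d s \<partial>lborel) = 0"
  then have "AE s in lborel. tilted_density a b d s = 0" by (simp add: nn_integral_0_iff_AE)
  moreover have "tilted_density a b d s \<noteq> 0" if "s > 0" for s
    using that assms Gamma_real_pos[of a] by (auto simp: tilted_density_def invgamma_density_def ennreal_eq_0_iff not_le)
  ultimately have "AE s in lborel. s \<notin> {0<..<1::real}" by (auto elim!: eventually_mono)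
  then have "{0<..<1::real} \<in> null_sets lborel" by (subst (asm) AE_iff_null_sets[symmetric]) auto
  then show False by (simp add: null_sets_def)
qed

definition mixing :: "real \<Rightarrow> real \<Rightarrow> real \<Rightarrow> real measure" where
  "mixing a b d = density lborel (\<lambda>s. tilted_density a b d s / (\<integral>\<^sup>+s. tilted_density a b d s \<partial>lborel))"

lemma sets_mixing [measurable_cong]: "sets (mixing a b d) = sets borel"
  by (simp add: mixing_def)

lemma tilted_density_mass_finite:
  assumes "a > 0" "b > 0" "d \<ge> 0"
  shows "(\<integral>\<^sup>+s. tilted_density a b d s \<partial>lborel) \<noteq> \<top>"
proof -
  have "tilted_density a b d s * ennreal (s powr 0) = tilted_density a b d s" for s
    by (cases "s = 0") (simp_all add: tilted_density_def)
  then show ?thesis using tilted_density_moment_finite[of a b 0 d] assms by simp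
qed

lemma nn_integral_mixing:
  assumes "a > 0" "b > 0" "d \<ge> 0" and [measurable]: "f \<in> borel_measurable borel"
  shows "(\<integral>\<^sup>+s. tilted_density a b d s * f s \<partial>lborel) = (\<integral>\<^sup>+s. tilted_density a b d s \<partial>lborel) * (\<integral>\<^sup>+s. f s \<partial>mixing a b d)"
proof -
  let ?c = "\<integral>\<^sup>+s. tilted_density a b d s \<partial>lborel"
  have c: "?c \<noteq> 0" "?c \<noteq> \<top>" using tilted_density_mass_pos tilted_density_mass_finite assms by auto
  have "?c * (\<integral>\<^sup>+s. f s \<partial>mixing a b d) = (\<integral>\<^sup>+s. ?c * (tilted_density a b d s / ?c * f s) \<partial>lborel)"
    unfolding mixing_def by (subst nn_integral_density) (auto simp: nn_integral_cmult)
  also have "\<dots> = (\<integral>\<^sup>+s. tilted_density a b d s * f s \<partial>lborel)"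
  proof (rule nn_integral_cong)
    fix s
    have "?c * (tilted_density a b d s / ?c * f s) = (?c / ?c) * (tilted_density a b d s * f s)"
      by (simp add: divide_ennreal_def mult_ac)
    then show "?c * (tilted_density a b d s / ?c * f s) = tilted_density a b d s * f s"
      using c by (simp add: ennreal_divide_self less_top[symmetric] not_gr_zero)
  qed
  finally show ?thesis ..
qed

lemma prob_space_mixing:
  assumes "a > 0" "b > 0" "d \<ge> 0"
  shows "prob_space (mixing a b d)"
proof (rule prob_spaceI)
  let ?c = "\<integral>\<^sup>+s. tilted_density a b d s \<partial>lborel"
  have c: "?c \<noteq> 0" "?c \<noteq> \<top>" using tilted_density_mass_pos tilted_density_mass_finite assms by auto
  have "emeasure (mixing a b d) (space (mixing a b d)) = (\<integral>\<^sup>+s. tilted_density a b d s / ?c \<partial>lborel)"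
    by (simp add: mixing_def emeasure_density)
  also have "\<dots> = ?c / ?c" by (rule nn_integral_divide) measurable
  finally show "emeasure (mixing a b d) (space (mixing a b d)) = 1"
    using c by (simp add: ennreal_divide_self less_top[symmetric] not_gr_zero)
qed

text \<open>Outputs are \<open>sqrt s\<close> times the scaled variables, so a first-moment distance
  requires this moment. The absolute value is what the norm of a scaled vector produces; the law of
  \<open>s\<close> lives on positive \<open>s\<close>.\<close>

lemma mixing_sqrt_moment_finite:
  assumes "a > 1/2" "b > 0" "d \<ge> 0"
  shows "(\<integral>\<^sup>+s. ennreal \<bar>sqrt s\<bar> \<partial>mixing a b d) < \<infinity>"
proof -
  let ?c = "\<integral>\<^sup>+s. tilted_density a b d s \<partial>lborel"
  have c: "?c \<noteq> 0" using tilted_density_mass_pos[of a b d] assms by auto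
  have "tilted_density a b d s * ennreal \<bar>sqrt s\<bar> = tilted_density a b d s * ennreal (s powr (1/2))" for s
    by (cases "s > 0") (simp_all add: tilted_density_def powr_half_sqrt)
  then have "?c * (\<integral>\<^sup>+s. ennreal \<bar>sqrt s\<bar> \<partial>mixing a b d) < \<infinity>"
    using nn_integral_mixing[of a b d "\<lambda>s. ennreal \<bar>sqrt s\<bar>"] tilted_density_moment_finite[of a b "1/2" d] assms by simp
  then show ?thesis using c by (auto simp: ennreal_mult_less_top)
qed

section \<open>Posteriors as reweighted images\<close>

lemma measurable_fit [measurable (raw)]:
  fixes y :: "'a::euclidean_space"
  assumes [measurable]: "f \<in> borel_measurable M" "g \<in> borel_measurable M"
  shows "(\<lambda>z. fit y (f z) (g z)) \<in> borel_measurable M"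
  unfolding fit_def by measurable

text \<open>Scaling removes \<open>s\<close> from the random part \<open>X\<close>, so the posterior
  is an image of the product measure \<open>V\<close> under a bounded density. \<open>V\<close> does
  not involve \<open>X\<close>, and two posteriors can be compared on it.\<close>

lemma posterior_eq_distr:
  fixes y :: "real^'k::finite^'nL::finite" and X :: "'w \<Rightarrow> real^'k^'nL"
  assumes ab: "a > 0" "b > 0" and "prob_space \<Omega>" and [measurable]: "X \<in> borel_measurable \<Omega>"
    and \<mu>: "\<And>s. s > 0 \<Longrightarrow> \<mu> s = distr \<Omega> borel (\<lambda>\<omega>. sqrt s *\<^sub>R X \<omega>)"
  defines "V \<equiv> mixing a b (real (CARD('nL) * CARD('k))) \<Otimes>\<^sub>M \<Omega>"
  defines "I \<equiv> (LINT z|V. fit y (fst z) (X (snd z)))"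
  shows "posterior a b y \<mu> = distr (density V (\<lambda>z. ennreal (fit y (fst z) (X (snd z)) / I))) borel (\<lambda>z. sqrt (fst z) *\<^sub>R X (snd z))"
    "I > 0"
proof -
  interpret \<Omega>: prob_space \<Omega> by fact
  define d where "d = real (CARD('nL) * CARD('k))"
  define \<tau> where "\<tau> = mixing a b d"
  have V: "V = \<tau> \<Otimes>\<^sub>M \<Omega>" by (simp add: V_def \<tau>_def d_def)
  interpret \<tau>: prob_space \<tau> unfolding \<tau>_def by (rule prob_space_mixing) (use ab in \<open>auto simp: d_def\<close>)
  interpret \<tau>\<Omega>: pair_prob_space \<tau> \<Omega> ..
  have [measurable_cong]: "sets \<tau> = sets borel" by (simp add: \<tau>_def sets_mixing)
  define c where "c = (\<integral>\<^sup>+s. tilted_density a b d s \<partial>lborel)"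
  have c: "c \<noteq> 0" "c \<noteq> \<top>" unfolding c_def using tilted_density_mass_pos[of a b d] tilted_density_mass_finite[of a b d] ab by (auto simp: d_def)
  let ?e = "\<lambda>z. fit y (fst z) (X (snd z))"
  let ?Y = "\<lambda>z. sqrt (fst z) *\<^sub>R X (snd z)"
  have int_e: "integrable V ?e"
    unfolding V by (rule \<tau>\<Omega>.P.integrable_const_bound[of _ 1]) (auto simp: fit_le_1 less_imp_le[OF fit_pos])
  have Ie: "(\<integral>\<^sup>+z. ennreal (?e z) \<partial>V) = ennreal I"
    unfolding I_def using int_e by (intro nn_integral_eq_integral) (auto simp: less_imp_le[OF fit_pos])
  show I: "I > 0"
  proof (rule ccontr)
    assume "\<not> I > 0"
    then have "(\<integral>\<^sup>+z. ennreal (?e z) \<partial>V) = 0" unfolding Ie by (simp add: ennreal_neg)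
    then have "AE z in V. ennreal (?e z) = 0" unfolding V by (subst (asm) nn_integral_0_iff_AE) auto
    moreover have "ennreal (?e z) \<noteq> 0" for z using fit_pos[of y "fst z" "X (snd z)"] by (simp add: ennreal_eq_0_iff)
    ultimately show False unfolding V by simp
  qed
  define N where "N A = (\<integral>\<^sup>+z. indicator A (?Y z) * ennreal (?e z) \<partial>V)" for A
  have post: "post_unnorm a b y \<mu> A = c * N A" if A[measurable]: "A \<in> sets borel" for A
  proof -
    define J where "J s = (\<integral>\<^sup>+\<omega>. indicator A (sqrt s *\<^sub>R X \<omega>) * ennreal (fit y s (X \<omega>)) \<partial>\<Omega>)" for s
    have [measurable]: "J \<in> borel_measurable borel" unfolding J_def[abs_def] by measurable
    have "indicator {0<..} s * ennreal (invgamma_density a b s) * (\<integral>\<^sup>+z. indicator A z * ennreal (likelihood y z s) \<partial>\<mu> s)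
       = tilted_density a b d s * J s" for s
    proof (cases "s > 0")
      case True
      have [measurable]: "(\<lambda>z. likelihood y z s) \<in> borel_measurable borel" unfolding likelihood_def by measurable
      have "(\<integral>\<^sup>+z. indicator A z * ennreal (likelihood y z s) \<partial>\<mu> s)
         = (\<integral>\<^sup>+\<omega>. indicator A (sqrt s *\<^sub>R X \<omega>) * ennreal (likelihood y (sqrt s *\<^sub>R X \<omega>) s) \<partial>\<Omega>)"
        unfolding \<mu>[OF True] by (subst nn_integral_distr) auto
      also have "\<dots> = (\<integral>\<^sup>+\<omega>. ennreal ((2 * pi * s) powr (- d / 2)) * (indicator A (sqrt s *\<^sub>R X \<omega>) * ennreal (fit y s (X \<omega>))) \<partial>\<Omega>)"
        by (simp add: likelihood_eq_fit[OF True] d_def ennreal_mult less_imp_le[OF fit_pos] mult_ac)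
      also have "\<dots> = ennreal ((2 * pi * s) powr (- d / 2)) * J s"
        unfolding J_def by (rule nn_integral_cmult) measurable
      finally show ?thesis using True by (simp add: tilted_density_def ennreal_mult'' mult.assoc)
    qed (simp add: tilted_density_def)
    then have "post_unnorm a b y \<mu> A = (\<integral>\<^sup>+s. tilted_density a b d s * J s \<partial>lborel)"
      unfolding post_unnorm_def by simp
    also have "\<dots> = c * (\<integral>\<^sup>+s. J s \<partial>\<tau>)"
      unfolding c_def \<tau>_def by (rule nn_integral_mixing) (use ab in \<open>auto simp: d_def\<close>)
    also have "(\<integral>\<^sup>+s. J s \<partial>\<tau>) = N A"
      unfolding J_def N_def V by (subst \<Omega>.nn_integral_fst[symmetric]) auto
    finally show ?thesis .
  qed
  let ?M = "distr (density V (\<lambda>z. ennreal (?e z / I))) borel ?Y"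
  have mY[measurable]: "?Y \<in> borel_measurable V" unfolding V by measurable
  have me[measurable]: "?e \<in> borel_measurable V" unfolding V by measurable
  have "post_unnorm a b y \<mu> A / post_unnorm a b y \<mu> UNIV = emeasure ?M A" if A[measurable]: "A \<in> sets borel" for A
  proof -
    have NU: "N UNIV = ennreal I" unfolding N_def Ie[symmetric] by simp
    have "post_unnorm a b y \<mu> A / post_unnorm a b y \<mu> UNIV = (N A * c) / (ennreal I * c)"
      by (simp add: post NU mult.commute)
    \<comment> \<open>The mass \<open>c\<close> of the tilted density is finite and nonzero and
      cancels.\<close>
    also have "\<dots> = N A / ennreal I" using c by (simp add: ennreal_times_divide divide_mult_eq)
    also have "\<dots> = (\<integral>\<^sup>+z. indicator A (?Y z) * ennreal (?e z) / ennreal I \<partial>V)"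
      unfolding N_def by (subst nn_integral_divide) auto
    also have "\<dots> = (\<integral>\<^sup>+z. ennreal (?e z / I) * indicator (?Y -` A \<inter> space V) z \<partial>V)"
      using I by (intro nn_integral_cong) (auto simp: divide_ennreal less_imp_le[OF fit_pos] split: split_indicator)
    also have "\<dots> = emeasure ?M A" by (simp add: emeasure_distr emeasure_density)
    finally show ?thesis .
  qed
  \<comment> \<open>\<open>posterior\<close> is built by \<open>measure_of\<close> from a set
    function; agreement on Borel sets with the \<open>emeasure\<close> of an existing measure shows
    that this function is countably additive, so \<open>measure_of\<close> returns that
    measure.\<close>
  then have "posterior a b y \<mu> = measure_of UNIV (sets borel) (emeasure ?M)"
    unfolding posterior_def by (intro measure_of_eq) (auto simp: sets.sigma_sets_eq[of borel, simplified])
  also have "\<dots> = ?M" using measure_of_of_measure[of ?M] by simp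
  finally show "posterior a b y \<mu> = ?M" .
qed

text \<open>The constant is chosen before the probability space and the variables, of which it sees
  only the first-moment bound \<open>B\<close>. The weight arises because the difference of the
  densities, itself of the order of the distance plus its mean, multiplies the norms of the
  points.\<close>

theorem posterior_W1_bound:
  fixes y :: "real^'k::finite^'nL::finite" and B :: real
  assumes a: "a > 1/2" and b: "b > 0" and B: "B > 0"
  shows "\<exists>C\<ge>0. \<forall>(\<Omega> :: 'w measure) (X :: 'w \<Rightarrow> real^'k^'nL) X' \<mu> \<mu>'.
     prob_space \<Omega> \<longrightarrow> X \<in> borel_measurable \<Omega> \<longrightarrow> X' \<in> borel_measurable \<Omega> \<longrightarrow>
     (\<forall>s>0. \<mu> s = distr \<Omega> borel (\<lambda>\<omega>. sqrt s *\<^sub>R X \<omega>)) \<longrightarrow> (\<forall>s>0. \<mu>' s = distr \<Omega> borel (\<lambda>\<omega>. sqrt s *\<^sub>R X' \<omega>)) \<longrightarrow>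
     (\<integral>\<^sup>+\<omega>. norm (X \<omega>) \<partial>\<Omega>) \<le> ennreal B \<longrightarrow> (\<integral>\<^sup>+\<omega>. norm (X' \<omega>) \<partial>\<Omega>) \<le> ennreal B \<longrightarrow>
     W1 (posterior a b y \<mu>) (posterior a b y \<mu>')
       \<le> ennreal C * (\<integral>\<^sup>+\<omega>. norm (X \<omega> - X' \<omega>) * (1 + norm (X \<omega>) + norm (X' \<omega>)) \<partial>\<Omega>)"
proof -
  define d where "d = real (CARD('nL) * CARD('k))"
  define \<tau> where "\<tau> = mixing a b d"
  have d0: "d \<ge> 0" by (simp add: d_def)
  interpret \<tau>: prob_space \<tau> unfolding \<tau>_def by (rule prob_space_mixing) (use a b d0 in auto)
  have [measurable_cong]: "sets \<tau> = sets borel" by (simp add: \<tau>_def sets_mixing)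
  define m where "m = enn2real (\<integral>\<^sup>+s. ennreal \<bar>sqrt s\<bar> \<partial>\<tau>)"
  have m: "(\<integral>\<^sup>+s. ennreal \<bar>sqrt s\<bar> \<partial>\<tau>) = ennreal m" "m \<ge> 0"
    using mixing_sqrt_moment_finite[OF a b d0] by (auto simp: m_def \<tau>_def)
  define \<kappa> where "\<kappa> = (LINT s|\<tau>. exp (- (norm ((1 / sqrt s) *\<^sub>R y))\<^sup>2))"
  have int_\<kappa>: "integrable \<tau> (\<lambda>s. exp (- (norm ((1 / sqrt s) *\<^sub>R y))\<^sup>2))"
    by (rule \<tau>.integrable_const_bound[of _ 1]) auto
  have \<kappa>: "\<kappa> > 0"
  proof -
    have "\<kappa> \<ge> 0" unfolding \<kappa>_def by simp
    moreover have "\<kappa> \<noteq> 0"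
    proof
      assume "\<kappa> = 0"
      then have "AE s in \<tau>. exp (- (norm ((1 / sqrt s) *\<^sub>R y))\<^sup>2) = 0"
        unfolding \<kappa>_def using int_\<kappa> by (subst (asm) integral_nonneg_eq_0_iff_AE) auto
      then show False by simp
    qed
    ultimately show ?thesis by simp
  qed
  \<comment> \<open>Lower bound for both normalisers, from \<open>fit_lower_bound\<close> with
    \<open>R = 2 * B\<close>: the mean of \<open>1 - norm v / R\<close> is then at least 1/2, and
    \<open>\<kappa>\<close> is the factor contributed by \<open>s\<close>.\<close>
  define I0 where "I0 = \<kappa> * (exp (- (2 * B)\<^sup>2) / 2)"
  have I0: "I0 > 0" using \<kappa> by (simp add: I0_def)
  \<comment> \<open>\<open>m / I0\<close> pays for moving the common part and for the variation of
    \<open>fit\<close>, the last term for the difference of the normalisers. The summand 1 keeps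
    \<open>C\<close> positive, so that an infinite right-hand side remains infinite.\<close>
  define C where "C = 1 + m / I0 + m * (2 * B) / I0\<^sup>2"
  have C: "C \<ge> 1" using m(2) I0 B by (simp add: C_def)
  then have C0: "C \<ge> 0" by simp
  show ?thesis
  proof (intro exI[of _ C] conjI C0 allI impI)
    fix \<Omega> :: "'w measure" and X X' :: "'w \<Rightarrow> real^'k^'nL" and \<mu> \<mu>'
    assume "prob_space \<Omega>" and [measurable]: "X \<in> borel_measurable \<Omega>" "X' \<in> borel_measurable \<Omega>"
      and \<mu>: "\<forall>s>0. \<mu> s = distr \<Omega> borel (\<lambda>\<omega>. sqrt s *\<^sub>R X \<omega>)"
      and \<mu>': "\<forall>s>0. \<mu>' s = distr \<Omega> borel (\<lambda>\<omega>. sqrt s *\<^sub>R X' \<omega>)"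
      and XB: "(\<integral>\<^sup>+\<omega>. norm (X \<omega>) \<partial>\<Omega>) \<le> ennreal B" and XB': "(\<integral>\<^sup>+\<omega>. norm (X' \<omega>) \<partial>\<Omega>) \<le> ennreal B"
    interpret \<Omega>: prob_space \<Omega> by fact
    interpret \<tau>\<Omega>: pair_prob_space \<tau> \<Omega> ..
    define V where "V = \<tau> \<Otimes>\<^sub>M \<Omega>"
    interpret V: prob_space V unfolding V_def by (rule \<tau>\<Omega>.P.prob_space_axioms)
    have [measurable_cong]: "sets V = sets (borel \<Otimes>\<^sub>M \<Omega>)" unfolding V_def by (intro sets_pair_measure_cong) (simp_all add: \<tau>_def sets_mixing)
    have prod: "(\<integral>\<^sup>+z. ennreal \<bar>sqrt (fst z)\<bar> * G (snd z) \<partial>V) = ennreal m * (\<integral>\<^sup>+\<omega>. G \<omega> \<partial>\<Omega>)"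
      if [measurable]: "G \<in> borel_measurable \<Omega>" for G
    proof -
      have "(\<integral>\<^sup>+z. ennreal \<bar>sqrt (fst z)\<bar> * G (snd z) \<partial>V) = (\<integral>\<^sup>+s. \<integral>\<^sup>+\<omega>. ennreal \<bar>sqrt s\<bar> * G \<omega> \<partial>\<Omega> \<partial>\<tau>)"
        unfolding V_def by (subst \<Omega>.nn_integral_fst[symmetric]) auto
      also have "\<dots> = (\<integral>\<^sup>+s. ennreal \<bar>sqrt s\<bar> * (\<integral>\<^sup>+\<omega>. G \<omega> \<partial>\<Omega>) \<partial>\<tau>)"
        by (intro nn_integral_cong nn_integral_cmult) measurable
      also have "\<dots> = ennreal m * (\<integral>\<^sup>+\<omega>. G \<omega> \<partial>\<Omega>)" by (subst nn_integral_multc) (auto simp: m)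
      finally show ?thesis .
    qed
    let ?D = "\<integral>\<^sup>+\<omega>. norm (X \<omega> - X' \<omega>) * (1 + norm (X \<omega>) + norm (X' \<omega>)) \<partial>\<Omega>"
    define e where "e Z z = fit y (fst z) (Z (snd z))" for Z :: "'w \<Rightarrow> real^'k^'nL" and z
    define I where "I Z = (LINT z|V. e Z z)" for Z :: "'w \<Rightarrow> real^'k^'nL"
    have e01: "0 \<le> e Z z" "e Z z \<le> 1" for Z z by (auto simp: e_def fit_le_1 less_imp_le[OF fit_pos])
    have me[measurable]: "e X \<in> borel_measurable V" "e X' \<in> borel_measurable V" unfolding e_def[abs_def] by measurable
    have int_e: "integrable V (e X)" "integrable V (e X')"
      by (rule V.integrable_const_bound[of _ 1]; use e01 me in auto)+
    have post: "posterior a b y \<mu> = distr (density V (\<lambda>z. ennreal (e X z / I X))) borel (\<lambda>z. sqrt (fst z) *\<^sub>R X (snd z))"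
      "posterior a b y \<mu>' = distr (density V (\<lambda>z. ennreal (e X' z / I X'))) borel (\<lambda>z. sqrt (fst z) *\<^sub>R X' (snd z))"
      using posterior_eq_distr[of a b \<Omega> X \<mu> y] posterior_eq_distr[of a b \<Omega> X' \<mu>' y] a b \<mu> \<mu>' \<open>prob_space \<Omega>\<close>
      unfolding e_def I_def V_def \<tau>_def d_def by auto
    have I0_le: "I0 \<le> I Z" if [measurable]: "Z \<in> borel_measurable \<Omega>" and ZB: "(\<integral>\<^sup>+\<omega>. norm (Z \<omega>) \<partial>\<Omega>) \<le> ennreal B" for Z
    proof -
      have intZ: "integrable \<Omega> (\<lambda>\<omega>. norm (Z \<omega>))"
        using ZB by (intro integrableI_bounded) (auto simp: le_less_trans[OF _ ennreal_less_top])
      have EZ: "\<Omega>.expectation (\<lambda>\<omega>. norm (Z \<omega>)) \<le> B"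
        using ZB B intZ by (subst (asm) nn_integral_eq_integral) (auto simp: ennreal_le_iff)
      let ?h = "\<lambda>\<omega>. exp (- (2 * B)\<^sup>2) * (1 - norm (Z \<omega>) / (2 * B))"
      have inth: "integrable \<Omega> ?h" using intZ by auto
      have "exp (- (2 * B)\<^sup>2) / 2 \<le> exp (- (2 * B)\<^sup>2) * (1 - \<Omega>.expectation (\<lambda>\<omega>. norm (Z \<omega>)) / (2 * B))"
        using EZ B by (simp add: field_simps)
      also have "\<dots> = \<Omega>.expectation ?h" using intZ by (simp add: \<Omega>.prob_space)
      finally have Eh: "exp (- (2 * B)\<^sup>2) / 2 \<le> \<Omega>.expectation ?h" .
      let ?k = "\<lambda>s. exp (- (norm ((1 / sqrt s) *\<^sub>R y))\<^sup>2)"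
      have intV: "integrable V (\<lambda>z. ?k (fst z) * ?h (snd z))"
        unfolding V_def
        by (rule \<tau>\<Omega>.Fubini_integrable) (use inth int_\<kappa> in \<open>auto simp: abs_mult intro!: AE_I2 integrable_mult_right integrable_mult_left simp del: exp_minus\<close>)
      have "I0 \<le> \<kappa> * \<Omega>.expectation ?h" unfolding I0_def using Eh \<kappa> by (intro mult_left_mono) auto
      also have "\<dots> = (LINT z|V. ?k (fst z) * ?h (snd z))"
        using intV unfolding V_def \<kappa>_def by (subst \<tau>\<Omega>.integral_fst'[symmetric]) auto
      also have "\<dots> \<le> I Z"
        unfolding I_def
      proof (rule integral_mono[OF intV])
        have "e Z \<in> borel_measurable V" unfolding e_def[abs_def] by measurable
        then show "integrable V (e Z)"
          by (intro V.integrable_const_bound[of _ 1]) (use e01 in auto)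
        show "?k (fst z) * ?h (snd z) \<le> e Z z" for z
          unfolding e_def using B by (intro fit_lower_bound) auto
      qed
      finally show ?thesis .
    qed
    have I: "I0 \<le> I X" "I0 \<le> I X'" "I X > 0" "I X' > 0"
      using I0_le[of X] I0_le[of X'] XB XB' I0 by auto
    show "W1 (posterior a b y \<mu>) (posterior a b y \<mu>') \<le> ennreal C * ?D"
    proof (cases "?D = \<top>")
      case True
      then show ?thesis using C by (simp add: ennreal_mult_top)
    next
      case False
      then obtain Dr where Dr: "?D = ennreal Dr" "Dr \<ge> 0" by (cases ?D) auto
      have diff: "(\<integral>\<^sup>+z. ennreal (norm (X (snd z) - X' (snd z))) \<partial>V) \<le> ennreal Dr"
      proof -
        have "(\<integral>\<^sup>+z. ennreal (norm (X (snd z) - X' (snd z))) \<partial>V) = (\<integral>\<^sup>+s. \<integral>\<^sup>+\<omega>. ennreal (norm (X \<omega> - X' \<omega>)) \<partial>\<Omega> \<partial>\<tau>)"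
          unfolding V_def by (subst \<Omega>.nn_integral_fst[symmetric]) auto
        also have "\<dots> = (\<integral>\<^sup>+\<omega>. ennreal (norm (X \<omega> - X' \<omega>)) \<partial>\<Omega>)" by (simp add: \<tau>.emeasure_space_1)
        also have "\<dots> \<le> ?D" by (intro nn_integral_mono ennreal_leI mult_right_le_one_le[THEN order_trans]) (auto simp: mult_le_cancel_left1)
        finally show ?thesis using Dr by simp
      qed
      have II: "\<bar>I X - I X'\<bar> \<le> Dr"
      proof -
        have "\<bar>I X - I X'\<bar> = \<bar>LINT z|V. e X z - e X' z\<bar>" unfolding I_def using int_e by simp
        also have "ennreal \<dots> \<le> (\<integral>\<^sup>+z. \<bar>e X z - e X' z\<bar> \<partial>V)"
          using integral_norm_bound_ennreal[of V "\<lambda>z. e X z - e X' z"] int_e by auto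
        also have "\<dots> \<le> (\<integral>\<^sup>+z. norm (X (snd z) - X' (snd z)) \<partial>V)"
          unfolding e_def by (intro nn_integral_mono ennreal_leI fit_lipschitz)
        also have "\<dots> \<le> ennreal Dr" by (rule diff)
        finally show ?thesis using Dr by simp
      qed
      have one: "(\<integral>\<^sup>+z. ennreal (e Z z / I Z) \<partial>V) = 1" if "integrable V (e Z)" "I Z > 0" for Z
      proof -
        have "(\<integral>\<^sup>+z. ennreal (e Z z / I Z) \<partial>V) = ennreal (LINT z|V. e Z z / I Z)"
          using that e01 by (intro nn_integral_eq_integral) auto
        then show ?thesis using that by (simp add: I_def[symmetric])
      qed
      \<comment> \<open>The numerators differ by at most the distance of the points, the normalisers
        by at most its mean, which \<open>Dr\<close> dominates.\<close>
      have dens: "\<bar>e X z / I X - e X' z / I X'\<bar> \<le> norm (X (snd z) - X' (snd z)) / I0 + Dr / I0\<^sup>2" for z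
      proof -
        have "e X z / I X - e X' z / I X' = (e X z - e X' z) / I X + e X' z * ((I X' - I X) / (I X * I X'))"
          using I by (simp add: field_simps)
        then have "\<bar>e X z / I X - e X' z / I X'\<bar> \<le> \<bar>e X z - e X' z\<bar> / I X + e X' z * (\<bar>I X' - I X\<bar> / (I X * I X'))"
          using I e01[of X' z] by (simp only:) (rule order_trans[OF abs_triangle_ineq], simp add: abs_mult)
        also have "\<bar>e X z - e X' z\<bar> / I X \<le> norm (X (snd z) - X' (snd z)) / I0"
          unfolding e_def using I I0 by (intro frac_le fit_lipschitz) auto
        also have "e X' z * (\<bar>I X' - I X\<bar> / (I X * I X')) \<le> 1 * (Dr / (I0 * I0))"
          using I I0 e01[of X' z] II by (intro mult_mono frac_le) (auto simp: abs_minus_commute)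
        finally show ?thesis by (simp add: power2_eq_square)
      qed
      let ?G = "\<lambda>\<omega>. norm (X \<omega> - X' \<omega>) * (1 + norm (X \<omega>) + norm (X' \<omega>)) / I0 + Dr / I0\<^sup>2 * (norm (X \<omega>) + norm (X' \<omega>))"
      have "W1 (posterior a b y \<mu>) (posterior a b y \<mu>')
        \<le> (\<integral>\<^sup>+z. ennreal (min (e X z / I X) (e X' z / I X') * norm (sqrt (fst z) *\<^sub>R X (snd z) - sqrt (fst z) *\<^sub>R X' (snd z)))
            + ennreal (\<bar>e X z / I X - e X' z / I X'\<bar> * (norm (sqrt (fst z) *\<^sub>R X (snd z)) + norm (sqrt (fst z) *\<^sub>R X' (snd z)))) \<partial>V)"
        unfolding post
        by (rule W1_common_density_bound[OF V.prob_space_axioms]) (use e01 I int_e one in \<open>auto intro!: divide_nonneg_pos\<close>)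
      also have "\<dots> \<le> (\<integral>\<^sup>+z. ennreal \<bar>sqrt (fst z)\<bar> * ennreal (?G (snd z)) \<partial>V)"
      proof (rule nn_integral_mono)
        fix z
        let ?q = "\<bar>sqrt (fst z)\<bar>" and ?x = "X (snd z)" and ?x' = "X' (snd z)"
        let ?u = "min (e X z / I X) (e X' z / I X') * norm (sqrt (fst z) *\<^sub>R ?x - sqrt (fst z) *\<^sub>R ?x')"
        let ?w = "\<bar>e X z / I X - e X' z / I X'\<bar> * (norm (sqrt (fst z) *\<^sub>R ?x) + norm (sqrt (fst z) *\<^sub>R ?x'))"
        have 1: "?u \<le> 1 / I0 * (?q * norm (?x - ?x'))"
        proof -
          have "min (e X z / I X) (e X' z / I X') \<le> e X z / I X" by simp
          also have "\<dots> \<le> 1 / I0" using I I0 e01[of X z] by (intro frac_le) auto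
          finally show ?thesis unfolding scaleR_diff_right[symmetric] norm_scaleR by (intro mult_right_mono) auto
        qed
        have 2: "?w \<le> (norm (?x - ?x') / I0 + Dr / I0\<^sup>2) * (?q * (norm ?x + norm ?x'))"
          unfolding norm_scaleR distrib_left[symmetric] by (intro mult_right_mono dens) auto
        have "1 / I0 * (?q * norm (?x - ?x')) + (norm (?x - ?x') / I0 + Dr / I0\<^sup>2) * (?q * (norm ?x + norm ?x')) = ?q * ?G (snd z)"
          by (simp add: algebra_simps add_divide_distrib)
        then have "?u + ?w \<le> ?q * ?G (snd z)" using 1 2 by linarith
        moreover have "ennreal ?u + ennreal ?w = ennreal (?u + ?w)"
        proof (rule ennreal_plus[symmetric])
          have "0 \<le> min (e X z / I X) (e X' z / I X')" using I(3,4) e01(1)[of X z] e01(1)[of X' z] by simp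
          then show "0 \<le> ?u" by (rule mult_nonneg_nonneg) simp
          show "0 \<le> ?w" by (intro mult_nonneg_nonneg add_nonneg_nonneg) simp_all
        qed
        moreover have "ennreal ?q * ennreal (?G (snd z)) = ennreal (?q * ?G (snd z))" by (rule ennreal_mult'[symmetric]) simp
        ultimately show "ennreal ?u + ennreal ?w \<le> ennreal ?q * ennreal (?G (snd z))" by (simp only: ennreal_leI)
      qed
      also have "\<dots> = ennreal m * (\<integral>\<^sup>+\<omega>. ennreal (?G \<omega>) \<partial>\<Omega>)" by (rule prod) measurable
      also have "(\<integral>\<^sup>+\<omega>. ennreal (?G \<omega>) \<partial>\<Omega>) = (\<integral>\<^sup>+\<omega>. ennreal (1 / I0) * ennreal (norm (X \<omega> - X' \<omega>) * (1 + norm (X \<omega>) + norm (X' \<omega>)))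
          + ennreal (Dr / I0\<^sup>2) * (ennreal (norm (X \<omega>)) + ennreal (norm (X' \<omega>))) \<partial>\<Omega>)"
        using I0 Dr by (intro nn_integral_cong) (simp add: ennreal_plus[symmetric] ennreal_mult'[symmetric] del: ennreal_plus)
      also have "\<dots> = ennreal (1 / I0) * ?D + ennreal (Dr / I0\<^sup>2) * ((\<integral>\<^sup>+\<omega>. norm (X \<omega>) \<partial>\<Omega>) + (\<integral>\<^sup>+\<omega>. norm (X' \<omega>) \<partial>\<Omega>))"
        by (simp add: nn_integral_add nn_integral_cmult)
      also have "\<dots> \<le> ennreal (1 / I0) * ennreal Dr + ennreal (Dr / I0\<^sup>2) * (ennreal B + ennreal B)"
        unfolding Dr by (intro add_mono mult_left_mono XB XB' order_refl) auto
      also have "\<dots> = ennreal (1 / I0 * Dr + Dr / I0\<^sup>2 * (B + B))"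
        using I0 Dr B by (simp add: ennreal_plus[symmetric] ennreal_mult'[symmetric] del: ennreal_plus)
      also have "ennreal m * ennreal (1 / I0 * Dr + Dr / I0\<^sup>2 * (B + B)) = ennreal (m * (1 / I0 * Dr + Dr / I0\<^sup>2 * (B + B)))"
        using m(2) by (simp add: ennreal_mult')
      also have "m * (1 / I0 * Dr + Dr / I0\<^sup>2 * (B + B)) = (C - 1) * Dr" by (simp add: C_def algebra_simps add_divide_distrib)
      also have "ennreal ((C - 1) * Dr) \<le> ennreal (C * Dr)" using Dr(2) by (intro ennreal_leI mult_right_mono) auto
      also have "ennreal (C * Dr) = ennreal C * ?D" unfolding Dr using C by (simp add: ennreal_mult')
      finally show ?thesis by (simp add: mult_left_mono)
    qed
  qed
qed

section \<open>Representation of the prior laws\<close>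

text \<open>Stated for an arbitrary Euclidean space because the noise shared by both prior laws is a
  matrix.\<close>

definition std_gauss :: "'a::euclidean_space measure" where
  "std_gauss = distr (PiM Basis (\<lambda>_. normal_measure 1)) borel (\<lambda>\<theta>. \<Sum>b\<in>Basis. \<theta> b *\<^sub>R b)"

lemma gaussian_law_std_gauss: "gaussian_law (std_gauss :: 'a::euclidean_space measure) (\<lambda>t. t \<bullet> t)"
proof -
  have "gaussian_law (std_gauss :: 'a measure) (\<lambda>t. \<Sum>b\<in>Basis. 1\<^sup>2 * (t \<bullet> b)\<^sup>2)"
    unfolding std_gauss_def by (rule gaussian_law_linear_combination) auto
  moreover have "(\<Sum>b\<in>Basis. 1\<^sup>2 * (t \<bullet> b)\<^sup>2) = t \<bullet> t" for t :: 'a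
    by (simp add: euclidean_inner[of t t] power2_eq_square)
  ultimately show ?thesis by simp
qed

lemma sets_std_gauss [measurable_cong]: "sets std_gauss = sets borel"
  by (simp add: std_gauss_def)

lemma prob_space_std_gauss: "prob_space std_gauss"
  by (rule gaussian_law_prob_space[OF gaussian_law_std_gauss])

lemma std_gauss_second_moment:
  "(\<integral>\<^sup>+\<xi>. ennreal ((norm \<xi>)\<^sup>2) \<partial>(std_gauss :: 'a::euclidean_space measure)) = ennreal (real DIM('a))"
proof -
  have m: "integrable std_gauss (\<lambda>x. (b \<bullet> x)\<^sup>2)" "(LINT x|std_gauss. (b \<bullet> x)\<^sup>2) = 1" if "b \<in> Basis" for b :: 'a
    using gaussian_law_moments(1,2)[OF gaussian_law_std_gauss, of b 1] that by (simp_all add: power2_eq_square)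
  have e: "(norm x)\<^sup>2 = (\<Sum>b\<in>Basis. (b \<bullet> x)\<^sup>2)" for x :: 'a
    unfolding power2_norm_eq_inner by (subst euclidean_inner) (simp add: power2_eq_square inner_commute)
  have "integrable std_gauss (\<lambda>x :: 'a. (norm x)\<^sup>2)" "(LINT x|std_gauss. (norm (x :: 'a))\<^sup>2) = real DIM('a)"
    unfolding e using m by simp_all
  then show ?thesis by (subst nn_integral_eq_integral) auto
qed

text \<open>The same \<open>A\<close> acts on every row, so standard noise becomes a matrix with
  independent rows of covariance \<open>A ** transpose A\<close>.\<close>

definition row_apply :: "real^'k^'k \<Rightarrow> real^'k^'r \<Rightarrow> real^'k^'r::finite" where
  "row_apply A \<xi> = (\<chi> r. A *v (\<xi> $ r :: real^'k::finite))"

lemma bounded_bilinear_row_apply: "bounded_bilinear (row_apply :: real^'k^'k \<Rightarrow> real^'k^'r \<Rightarrow> real^'k::finite^'r::finite)"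
  unfolding bilinear_conv_bounded_bilinear[symmetric] bilinear_def
  by (auto simp: row_apply_def linear_iff vec_eq_iff matrix_vector_mult_def sum.distrib sum_distrib_left algebra_simps)

lemma measurable_row_apply [measurable (raw)]:
  fixes g :: "'a \<Rightarrow> real^'k::finite^'r::finite"
  assumes f: "f \<in> borel_measurable M" and g: "g \<in> borel_measurable M"
  shows "(\<lambda>x. row_apply (f x) (g x)) \<in> borel_measurable M"
proof (rule borel_measurable_continuous_Pair[OF f g])
  show "continuous_on UNIV (\<lambda>x. row_apply (fst x) (snd x :: real^'k^'r))"
    by (intro bounded_bilinear.continuous_on[OF bounded_bilinear_row_apply] continuous_intros)
qed

lemma inner_row_apply: "t \<bullet> row_apply A \<xi> = row_apply (transpose A) t \<bullet> \<xi>"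
proof -
  have "t $ r \<bullet> (A *v \<xi> $ r) = (transpose A *v t $ r) \<bullet> \<xi> $ r" for r
    by (simp add: dot_lmul_matrix[symmetric] vector_transpose_matrix)
  then show ?thesis by (simp add: inner_vec_def[of t] inner_vec_def[of _ \<xi>] row_apply_def)
qed

lemma row_apply_transpose_norm:
  "row_apply (transpose A) t \<bullet> row_apply (transpose A) t = (\<Sum>r\<in>UNIV. t $ r \<bullet> ((A ** transpose A) *v t $ r))"
proof -
  have "row_apply (transpose A) t \<bullet> row_apply (transpose A) t = t \<bullet> row_apply A (row_apply (transpose A) t)"
    by (simp add: inner_row_apply)
  also have "\<dots> = (\<Sum>r\<in>UNIV. t $ r \<bullet> ((A ** transpose A) *v t $ r))"
    by (simp add: inner_vec_def[of t] row_apply_def matrix_vector_mul_assoc del: transpose_matrix_vector)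
  finally show ?thesis .
qed

lemma gaussian_law_row_apply:
  assumes "psd K" "s > 0"
  shows "gaussian_law (distr (std_gauss :: (real^'k::finite^'r::finite) measure) borel (\<lambda>\<xi>. sqrt s *\<^sub>R row_apply (chol_factor K) \<xi>))
    (\<lambda>t. s * (\<Sum>r\<in>UNIV. t $ r \<bullet> (K *v t $ r)))"
proof -
  let ?A = "chol_factor K"
  have "gaussian_law (distr (std_gauss :: (real^'k^'r) measure) borel (\<lambda>\<xi>. sqrt s *\<^sub>R row_apply ?A \<xi>))
    (\<lambda>t. (sqrt s *\<^sub>R row_apply (transpose ?A) t) \<bullet> (sqrt s *\<^sub>R row_apply (transpose ?A) t))"
    by (rule gaussian_law_linear_image[OF gaussian_law_std_gauss]) (measurable, simp add: inner_row_apply)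
  then show ?thesis
    using assms by (simp add: row_apply_transpose_norm chol_factor mult.assoc[symmetric])
qed

text \<open>Independent rows make the forms add, which gives the form of
  \<open>gaussian_law_row_apply\<close>; thus the arbitrary factor inside \<open>gauss_vec\<close>
  can be exchanged for the Cholesky factor.\<close>

lemma gaussian_law_gp_law:
  fixes K :: "real^'k::finite^'k"
  assumes K: "psd K" and s: "s > 0"
  shows "gaussian_law (gp_law K s :: (real^'k^'r::finite) measure) (\<lambda>t. s * (\<Sum>r\<in>UNIV. t $ r \<bullet> (K *v t $ r)))"
proof -
  let ?G = "gauss_vec (s *\<^sub>R K)"
  have sK: "psd (s *\<^sub>R K)"
    using K s unfolding psd_def by (auto simp: transpose_scalar scaleR_matrix_vector_assoc[symmetric] transpose_def vec_eq_iff)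
  have G: "gaussian_law ?G (\<lambda>t. t \<bullet> ((s *\<^sub>R K) *v t))" by (rule gaussian_law_gauss_vec[OF sK])
  interpret G: prob_space ?G by (rule gauss_vec_prob_space[OF sK])
  interpret P: product_prob_space "\<lambda>_ :: 'r. ?G" UNIV by unfold_locales
  let ?P = "PiM UNIV (\<lambda>_ :: 'r. ?G)"
  have v[measurable]: "vec_lambda \<in> borel_measurable ?P"
  proof (rule borel_measurable_matrixI)
    fix r c
    have "(\<lambda>Z. Z r) \<in> ?P \<rightarrow>\<^sub>M ?G" by (rule measurable_component_singleton) simp
    then have f1: "(\<lambda>Z. Z r) \<in> borel_measurable ?P" by (simp add: measurable_cong_sets[OF refl gauss_vec_sets])
    have f2: "(\<lambda>z :: real^'k. z $ c) \<in> borel_measurable borel"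
      by (intro borel_measurable_continuous_onI continuous_intros)
    show "(\<lambda>Z. vec_lambda Z $ r $ c) \<in> borel_measurable ?P"
      using measurable_compose[OF f1 f2] by simp
  qed
  have "(CLINT x|gp_law K s. iexp (t \<bullet> x)) = complex_of_real (exp (- (s * (\<Sum>r\<in>UNIV. t $ r \<bullet> (K *v t $ r))) / 2))" for t :: "real^'k^'r"
  proof -
    have "(CLINT x|gp_law K s. iexp (t \<bullet> x)) = (CLINT Z|?P. iexp (t \<bullet> vec_lambda Z))"
      unfolding gp_law_def by (subst integral_distr) auto
    also have "\<dots> = (CLINT Z|?P. (\<Prod>r\<in>UNIV. iexp (t $ r \<bullet> Z r)))"
      by (simp add: inner_vec_def[of t] exp_sum sum_distrib_left)
    also have "\<dots> = (\<Prod>r\<in>UNIV. CLINT z|?G. iexp (t $ r \<bullet> z))"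
      by (rule P.product_integral_prod) (auto intro!: G.integrable_const_bound[of _ 1])
    also have "\<dots> = (\<Prod>r\<in>UNIV. complex_of_real (exp (- (s * (t $ r \<bullet> (K *v t $ r))) / 2)))"
      using G unfolding gaussian_law_def by (simp add: scaleR_matrix_vector_assoc[symmetric])
    also have "\<dots> = complex_of_real (exp (\<Sum>r\<in>UNIV. - (s * (t $ r \<bullet> (K *v t $ r))) / 2))"
      by (simp only: exp_sum[OF finite] of_real_prod)
    finally show ?thesis by (simp only: sum_negf sum_divide_distrib[symmetric] sum_distrib_left)
  qed
  moreover have "prob_space (gp_law K s :: (real^'k^'r) measure)"
    unfolding gp_law_def by (rule P.prob_space_distr) (rule v)
  ultimately show ?thesis unfolding gaussian_law_def by (simp add: gp_law_def)
qed

section \<open>Network output and limit process on a common space\<close>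

lemma emeasure_distr_eq_nn_integral:
  assumes [measurable]: "f \<in> borel_measurable M" "A \<in> sets borel"
  shows "emeasure (distr M borel f) A = (\<integral>\<^sup>+x. indicator A (f x) \<partial>M)"
proof -
  have "(\<integral>\<^sup>+x. indicator A (f x) \<partial>M) = (\<integral>\<^sup>+x. indicator (f -` A \<inter> space M) x \<partial>M)"
    by (intro nn_integral_cong) (auto split: split_indicator)
  then show ?thesis by (simp add: emeasure_distr)
qed

lemma nngp_cong:
  "(\<And>l. 1 \<le> l \<Longrightarrow> l \<le> m \<Longrightarrow> sW l = sW' l \<and> sb l = sb' l) \<Longrightarrow> nngp \<phi> sW sb x m = nngp \<phi> sW' sb' x m"
proof (induction m)
  case (Suc m)
  then show ?case by (cases m) auto
qed simp

text \<open>With unit variances in the last layer, the rescaled kernel is the next kernel of the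
  recursion, so the convergence theorem covers it at \<open>l = L\<close>.\<close>

lemma Kprime_eq_nngp:
  "L \<ge> 2 \<Longrightarrow> Kprime \<phi> sW sb L x = nngp \<phi> (sW(L := 1)) (sb(L := 1)) x L"
proof -
  assume L: "L \<ge> 2"
  then obtain m where m: "L = Suc m" "m \<ge> 1" by (cases L) auto
  have "nngp \<phi> (sW(L := 1)) (sb(L := 1)) x m = nngp \<phi> sW sb x m"
    by (rule nngp_cong) (use m in auto)
  then show ?thesis using m(2) unfolding Kprime_def m(1) nngp_Suc[OF m(2)] by (simp add: m(1))
qed

lemma net_out_merge:
  fixes x :: "real^'k::finite^'n0::finite" and \<eta> \<theta> :: "('n0, 'nL::finite) param \<Rightarrow> real"
  assumes L: "L = Suc m"
  shows "net_out \<phi> n L x (merge (params_upto n L m) (layer_params n L L) (\<eta>, \<theta>))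
    = (\<Sum>p\<in>layer_params n L L. \<theta> p *\<^sub>R (\<chi> r. unit_weight \<phi> n L x L \<eta> (Out r) p))"
proof -
  have U: "Out r \<in> units n L (Suc m)" for r :: 'nL using L by (auto simp: units_def)
  have "net_out \<phi> n L x (merge (params_upto n L m) (layer_params n L L) (\<eta>, \<theta>)) $ r $ c = preact \<phi> n L x L \<eta> (Out r) \<theta> $ c" for r c
    using fwd_merge[OF U[of r], of \<phi> \<eta> \<theta> c x] by (simp add: net_out_def L del: fwd.simps)
  then show ?thesis by (simp add: vec_eq_iff preact_def)
qed

lemma sum_eq_single:
  fixes f :: "'r::finite \<Rightarrow> real"
  assumes "\<And>r. r \<noteq> r0 \<Longrightarrow> f r = 0"
  shows "(\<Sum>r\<in>UNIV. f r) = f r0"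
  using sum.mono_neutral_right[of UNIV "{r0}" f] assms by simp

text \<open>Each last-layer parameter feeds a single output row, so the squared inner product splits
  into a sum over rows. The variance \<open>s\<close> factors out and leaves the kernel with unit
  last-layer variances.\<close>

lemma output_quadratic:
  fixes x :: "real^'k::finite^'n0::finite" and \<eta> :: "('n0, 'nL::finite) param \<Rightarrow> real" and t :: "real^'k^'nL"
  assumes L: "L \<ge> 1" and s: "s > 0"
  shows "(\<Sum>p\<in>layer_params n L L. (param_sd sW sb n L s p)\<^sup>2 * (t \<bullet> (\<chi> r. unit_weight \<phi> n L x L \<eta> (Out r) p))\<^sup>2)
    = s * (\<Sum>r\<in>UNIV. t $ r \<bullet> (emp_kernel \<phi> (sW(L := 1)) (sb(L := 1)) n L x L \<eta> *v t $ r))"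
proof -
  let ?w = "\<lambda>r p. unit_weight \<phi> n L x L \<eta> (Out r) p"
  have U: "Out r \<in> units n L L" for r using L by (auto simp: units_def)
  have sd: "(param_sd sW sb n L s p)\<^sup>2 = pvar sW sb n L s p" if "p \<in> layer_params n L L" for p :: "('n0, 'nL) param"
    using param_sd_pos[OF that, of sW sb s] s by (simp add: less_imp_le)
  have sq: "(t \<bullet> (\<chi> r. ?w r p))\<^sup>2 = (\<Sum>r\<in>UNIV. (t $ r \<bullet> ?w r p)\<^sup>2)" for p
  proof -
    \<comment> \<open>The neuron to which the parameter \<open>p\<close> belongs; the coefficient of
      \<open>p\<close> in every other neuron is 0.\<close>
    define i where "i = (case p of Wt _ i _ \<Rightarrow> i | Bs _ i \<Rightarrow> i)"
    have i: "?w r p = 0" if "i \<noteq> Out r" for r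
      using that by (cases p) (auto simp: unit_weight_def i_def)
    show ?thesis
    proof (cases "\<exists>r0. i = Out r0")
      case True
      then obtain r0 where "i = Out r0" by blast
      then have z: "?w r p = 0" if "r \<noteq> r0" for r using i that by auto
      have "(\<Sum>r\<in>UNIV. t $ r \<bullet> ?w r p) = t $ r0 \<bullet> ?w r0 p" "(\<Sum>r\<in>UNIV. (t $ r \<bullet> ?w r p)\<^sup>2) = (t $ r0 \<bullet> ?w r0 p)\<^sup>2"
        by (rule sum_eq_single; use z in simp)+
      then show ?thesis by (simp add: inner_vec_def[of t])
    next
      case False
      then have "?w r p = 0" for r using i by auto
      then show ?thesis by (simp add: inner_vec_def[of t])
    qed
  qed
  have one: "(\<Sum>p\<in>layer_params n L L. pvar sW sb n L s p * (t $ r \<bullet> ?w r p)\<^sup>2)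
     = s * (t $ r \<bullet> (emp_kernel \<phi> (sW(L := 1)) (sb(L := 1)) n L x L \<eta> *v t $ r))" for r
    by (subst sum_layer_params_unit[OF U[of r]])
       (auto simp: unit_weight_def emp_kernel_quadratic distrib_left sum_distrib_left)
  have "(\<Sum>p\<in>layer_params n L L. (param_sd sW sb n L s p)\<^sup>2 * (t \<bullet> (\<chi> r. ?w r p))\<^sup>2)
     = (\<Sum>p\<in>layer_params n L L. \<Sum>r\<in>UNIV. pvar sW sb n L s p * (t $ r \<bullet> ?w r p)\<^sup>2)"
    by (intro sum.cong refl) (simp add: sd sq sum_distrib_left)
  also have "\<dots> = (\<Sum>r\<in>UNIV. \<Sum>p\<in>layer_params n L L. pvar sW sb n L s p * (t $ r \<bullet> ?w r p)\<^sup>2)" by (rule sum.swap)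
  finally show ?thesis unfolding one by (simp add: sum_distrib_left)
qed

lemma measurable_net_out:
  fixes x :: "real^'k::finite^'n0::finite"
  assumes "\<And>l. l \<in> {1..L} \<Longrightarrow> \<phi> l \<in> borel_measurable borel" "L \<ge> 1"
  shows "(net_out \<phi> n L x :: (('n0, 'nL::finite) param \<Rightarrow> real) \<Rightarrow> real^'k^'nL) \<in> borel_measurable (PiM (params_upto n L L) (\<lambda>_. borel))"
proof (rule borel_measurable_matrixI)
  fix r c
  have "(\<lambda>\<theta> :: ('n0, 'nL) param \<Rightarrow> real. fwd \<phi> n L \<theta> (column c x) L (Out r)) \<in> borel_measurable (PiM (params_upto n L L) (\<lambda>_. borel))"
    by (rule measurable_fwd[where m=L]) (use assms in \<open>auto simp: units_def\<close>)
  then show "(\<lambda>\<theta>. net_out \<phi> n L x \<theta> $ r $ c) \<in> borel_measurable (PiM (params_upto n L L) (\<lambda>_. borel))"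
    by (simp add: net_out_def)
qed

text \<open>The variances of the hidden parameters do not involve \<open>s\<close>, so
  \<open>MI\<close> may be taken at the value 1 and one space serves all \<open>s\<close>. Given
  \<open>\<eta>\<close>, the output and the transformed noise have the same quadratic form, hence
  the same law.\<close>

theorem net_law_representation:
  fixes x :: "real^'k::finite^'n0::finite" and n :: "nat \<Rightarrow> nat"
  assumes meas: "\<And>l. l \<in> {1..L} \<Longrightarrow> \<phi> l \<in> borel_measurable borel" and L: "L \<ge> 1"
    and var: "\<And>l. l \<in> {1..L} \<Longrightarrow> l \<noteq> L \<Longrightarrow> sW l > 0 \<and> sb l > 0" and s: "s > 0"
  defines "MI \<equiv> PiM (params_upto n L (L - 1)) (\<lambda>p :: ('n0, 'nL::finite) param. normal_measure (param_sd sW sb n L 1 p))"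
  shows "(net_law \<phi> sW sb n L x s :: (real^'k^'nL) measure) = distr (MI \<Otimes>\<^sub>M std_gauss) borel
     (\<lambda>(\<eta>, \<xi>). sqrt s *\<^sub>R row_apply (chol_factor (emp_kernel \<phi> (sW(L := 1)) (sb(L := 1)) n L x L \<eta>)) \<xi>)"
proof (rule measure_eqI)
  obtain m where m: "L = Suc m" using L by (cases L) auto
  let ?sd = "param_sd sW sb n L s :: ('n0, 'nL) param \<Rightarrow> real"
  let ?I = "params_upto n L m :: ('n0, 'nL) param set" and ?J = "layer_params n L L :: ('n0, 'nL) param set"
  let ?K = "\<lambda>\<eta> :: ('n0, 'nL) param \<Rightarrow> real. emp_kernel \<phi> (sW(L := 1)) (sb(L := 1)) n L x L \<eta>"
  let ?X = "\<lambda>(\<eta>, \<xi> :: real^'k^'nL). sqrt s *\<^sub>R row_apply (chol_factor (?K \<eta>)) \<xi>"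
  have Un: "params_upto n L L = ?I \<union> ?J" unfolding m by (rule params_upto_Suc)
  have disj: "?I \<inter> ?J = {}" unfolding m by (rule layer_params_disjoint)
  have pos: "param_sd sW sb n L s' p > 0" if p: "p \<in> params_upto n L L" "s' > 0" for p :: "('n0, 'nL) param" and s'
  proof -
    obtain l where l: "l \<in> {1..L}" "p \<in> layer_params n L l" using p(1) unfolding params_upto_def by blast
    show ?thesis by (rule param_sd_pos[OF l(2)]) (use var[OF l(1)] p in auto)
  qed
  have eqI: "?sd p = param_sd sW sb n L 1 p" if "p \<in> ?I" for p
    using that by (auto simp: params_upto_def layer_params_def m)
  have MI: "MI = PiM ?I (\<lambda>p. normal_measure (?sd p))"
    unfolding MI_def using eqI by (intro PiM_cong) (auto simp: m)
  interpret MI: prob_space MI unfolding MI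
    by (rule prob_space_PiM_normal) (rule pos[OF _ s], simp add: Un)
  interpret G: prob_space "std_gauss :: (real^'k^'nL) measure" by (rule prob_space_std_gauss)
  have sMI: "sets MI = sets (PiM ?I (\<lambda>_. borel))" unfolding MI by (intro sets_PiM_cong) auto
  have K[measurable]: "?K \<in> borel_measurable MI"
    using measurable_emp_kernel[where m=L and l=L and n=n and L=L and J="?I" and x=x and \<phi>=\<phi> and sW="sW(L := 1)" and sb="sb(L := 1)", OF meas]
      L m unfolding measurable_cong_sets[OF sMI refl] by simp
  have X[measurable]: "?X \<in> borel_measurable (MI \<Otimes>\<^sub>M std_gauss)" by measurable
  have mo: "net_out \<phi> n L x \<in> borel_measurable (PiM (?I \<union> ?J) (\<lambda>_. borel))"
    unfolding Un[symmetric] by (rule measurable_net_out[OF meas L])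
  have sP: "sets (prior sW sb n L s :: (('n0, 'nL) param \<Rightarrow> real) measure) = sets (PiM (?I \<union> ?J) (\<lambda>_. borel))"
    unfolding prior_def params_eq_params_upto Un by (intro sets_PiM_cong) auto
  show "sets (net_law \<phi> sW sb n L x s :: (real^'k^'nL) measure) = sets (distr (MI \<Otimes>\<^sub>M std_gauss) borel ?X)"
    by (simp add: net_law_def)
  fix A :: "(real^'k^'nL) set" assume "A \<in> sets (net_law \<phi> sW sb n L x s :: (real^'k^'nL) measure)"
  then have A[measurable]: "A \<in> sets borel" by (simp add: net_law_def)
  let ?out = "\<lambda>\<eta> \<theta>. net_out \<phi> n L x (merge ?I ?J (\<eta>, \<theta>))"
  let ?MJ = "PiM ?J (\<lambda>p. normal_measure (?sd p))"
  have law: "distr ?MJ borel (?out \<eta>) = distr std_gauss borel (\<lambda>\<xi>. ?X (\<eta>, \<xi>))" for \<eta>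
  proof (rule gaussian_law_unique)
    have "psd (?K \<eta>)" by (rule psd_emp_kernel) auto
    then show "gaussian_law (distr std_gauss borel (\<lambda>\<xi>. ?X (\<eta>, \<xi>))) (\<lambda>t. s * (\<Sum>r\<in>UNIV. t $ r \<bullet> (?K \<eta> *v t $ r)))"
      using gaussian_law_row_apply[OF _ s] by simp
    have "gaussian_law (distr ?MJ borel (?out \<eta>))
        (\<lambda>t. \<Sum>p\<in>?J. (?sd p)\<^sup>2 * (t \<bullet> (\<chi> r. unit_weight \<phi> n L x L \<eta> (Out r) p))\<^sup>2)"
      unfolding net_out_merge[OF m]
      by (rule gaussian_law_linear_combination) (simp, rule pos[OF _ s], simp add: Un)
    then show "gaussian_law (distr ?MJ borel (?out \<eta>)) (\<lambda>t. s * (\<Sum>r\<in>UNIV. t $ r \<bullet> (?K \<eta> *v t $ r)))"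
      unfolding output_quadratic[OF L s] .
  qed
  have mout: "?out \<eta> \<in> borel_measurable ?MJ" for \<eta>
    unfolding net_out_merge[OF m] by (intro borel_measurable_sum borel_measurable_scaleR borel_measurable_const) auto
  have "emeasure (net_law \<phi> sW sb n L x s) A = (\<integral>\<^sup>+\<theta>. indicator A (net_out \<phi> n L x \<theta>) \<partial>(prior sW sb n L s :: (('n0, 'nL) param \<Rightarrow> real) measure))"
    unfolding net_law_def using mo unfolding measurable_cong_sets[OF sP refl, symmetric]
    by (rule emeasure_distr_eq_nn_integral[OF _ A])
  also have "\<dots> = (\<integral>\<^sup>+\<eta>. \<integral>\<^sup>+\<theta>. indicator A (?out \<eta> \<theta>) \<partial>?MJ \<partial>MI)"
    unfolding prior_def params_eq_params_upto Un MI
    by (rule nn_integral_PiM_normal_Un) (use disj pos[OF _ s] Un mo in auto)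
  also have "\<dots> = (\<integral>\<^sup>+\<eta>. emeasure (distr ?MJ borel (?out \<eta>)) A \<partial>MI)"
  proof (rule nn_integral_cong)
    fix \<eta>
    show "(\<integral>\<^sup>+\<theta>. indicator A (?out \<eta> \<theta>) \<partial>?MJ) = emeasure (distr ?MJ borel (?out \<eta>)) A"
      by (rule emeasure_distr_eq_nn_integral[OF mout A, symmetric])
  qed
  also have "\<dots> = (\<integral>\<^sup>+\<eta>. \<integral>\<^sup>+\<xi>. indicator A (?X (\<eta>, \<xi>)) \<partial>std_gauss \<partial>MI)"
    unfolding law
  proof (rule nn_integral_cong)
    fix \<eta>
    have "(\<lambda>\<xi>. ?X (\<eta>, \<xi>)) \<in> borel_measurable std_gauss" unfolding case_prod_conv by measurable
    then show "emeasure (distr std_gauss borel (\<lambda>\<xi>. ?X (\<eta>, \<xi>))) A = (\<integral>\<^sup>+\<xi>. indicator A (?X (\<eta>, \<xi>)) \<partial>std_gauss)"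
      by (rule emeasure_distr_eq_nn_integral[OF _ A])
  qed
  also have "\<dots> = (\<integral>\<^sup>+z. indicator A (?X z) \<partial>(MI \<Otimes>\<^sub>M std_gauss))"
    by (rule G.nn_integral_fst) measurable
  also have "\<dots> = emeasure (distr (MI \<Otimes>\<^sub>M std_gauss) borel ?X) A"
    by (rule emeasure_distr_eq_nn_integral[OF _ A, symmetric]) measurable
  finally show "emeasure (net_law \<phi> sW sb n L x s) A = emeasure (distr (MI \<Otimes>\<^sub>M std_gauss) borel ?X) A" .
qed

text \<open>The factor \<open>M\<close> is idle; it places the limit law on the same space, with the
  same noise \<open>\<xi>\<close>, as the network law.\<close>

lemma gp_law_representation:
  fixes K :: "real^'k::finite^'k"
  assumes M: "prob_space M" and K: "psd K" and s: "s > 0"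
  shows "(gp_law K s :: (real^'k^'r::finite) measure) = distr (M \<Otimes>\<^sub>M std_gauss) borel (\<lambda>(\<eta>, \<xi>). sqrt s *\<^sub>R row_apply (chol_factor K) \<xi>)"
proof (rule measure_eqI)
  interpret M: prob_space M by fact
  interpret G: prob_space "std_gauss :: (real^'k^'r) measure" by (rule prob_space_std_gauss)
  let ?g = "\<lambda>\<xi> :: real^'k^'r. sqrt s *\<^sub>R row_apply (chol_factor K) \<xi>"
  show "sets (gp_law K s :: (real^'k^'r) measure) = sets (distr (M \<Otimes>\<^sub>M std_gauss) borel (\<lambda>(\<eta>, \<xi>). ?g \<xi>))" by (simp add: gp_law_def)
  fix A :: "(real^'k^'r) set" assume "A \<in> sets (gp_law K s :: (real^'k^'r) measure)"
  then have A[measurable]: "A \<in> sets borel" by (simp add: gp_law_def)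
  have law: "(gp_law K s :: (real^'k^'r) measure) = distr std_gauss borel ?g"
    by (rule gaussian_law_unique[OF gaussian_law_gp_law[OF K s] gaussian_law_row_apply[OF K s]])
  have "emeasure (gp_law K s) A = (\<integral>\<^sup>+\<xi>. indicator A (?g \<xi>) \<partial>std_gauss)"
    unfolding law by (rule emeasure_distr_eq_nn_integral[OF _ A]) measurable
  also have "\<dots> = (\<integral>\<^sup>+\<eta>. \<integral>\<^sup>+\<xi>. indicator A (?g \<xi>) \<partial>std_gauss \<partial>M)" by (simp add: M.emeasure_space_1)
  also have "\<dots> = (\<integral>\<^sup>+z. indicator A (case z of (\<eta>, \<xi>) \<Rightarrow> ?g \<xi>) \<partial>(M \<Otimes>\<^sub>M std_gauss))"
    by (subst G.nn_integral_fst[symmetric]) auto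
  also have "\<dots> = emeasure (distr (M \<Otimes>\<^sub>M std_gauss) borel (\<lambda>(\<eta>, \<xi>). ?g \<xi>)) A"
    by (rule emeasure_distr_eq_nn_integral[OF _ A, symmetric]) measurable
  finally show "emeasure (gp_law K s) A = emeasure (distr (M \<Otimes>\<^sub>M std_gauss) borel (\<lambda>(\<eta>, \<xi>). ?g \<xi>)) A" .
qed


section \<open>From kernel error to transport cost\<close>

lemma norm_matrix_le_sum_abs: "norm (A :: real^'c::finite^'r::finite) \<le> (\<Sum>r\<in>UNIV. \<Sum>c\<in>UNIV. \<bar>A $ r $ c\<bar>)"
proof -
  have "norm A \<le> (\<Sum>r\<in>UNIV. norm (A $ r))"
    unfolding norm_vec_def by (rule L2_set_le_sum) simp
  also have "\<dots> \<le> (\<Sum>r\<in>UNIV. \<Sum>c\<in>UNIV. \<bar>A $ r $ c\<bar>)"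
    by (intro sum_mono norm_le_l1_cart)
  finally show ?thesis .
qed

text \<open>Separates the noise from the kernel error: under a product measure the right-hand side
  integrates to a second moment of \<open>\<xi>\<close> times a first moment of the error. One power
  of \<open>norm \<xi>\<close> comes from the difference, the other from the weight.\<close>

lemma row_apply_transport_bound:
  fixes K :: "real^'k::finite^'k"
  assumes K: "pos_def K"
  shows "\<exists>C\<ge>0. \<forall>S (\<xi> :: real^'k^'r::finite). psd S \<longrightarrow>
    norm (row_apply (chol_factor S) \<xi> - row_apply (chol_factor K) \<xi>)
      * (1 + norm (row_apply (chol_factor S) \<xi>) + norm (row_apply (chol_factor K) \<xi>))
    \<le> C * (1 + (norm \<xi>)\<^sup>2) * (\<Sum>i\<in>UNIV. \<Sum>j\<in>UNIV. \<bar>S $ i $ j - K $ i $ j\<bar>)"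
proof -
  interpret row: bounded_bilinear "row_apply :: real^'k^'k \<Rightarrow> real^'k^'r \<Rightarrow> real^'k^'r" by (rule bounded_bilinear_row_apply)
  obtain k where k: "k > 0" "\<And>A (\<xi> :: real^'k^'r). norm (row_apply A \<xi>) \<le> norm A * norm \<xi> * k"
    using row.pos_bounded by blast
  obtain C1 where C1: "C1 \<ge> 0" and calm: "\<forall>S. psd S \<longrightarrow> norm (chol_factor S - chol_factor K) * (1 + norm (chol_factor S) + norm (chol_factor K)) \<le> C1 * norm (S - K)"
    using chol_factor_calm[OF K] by (elim exE conjE) (rule that)
  have "norm (row_apply (chol_factor S) \<xi> - row_apply (chol_factor K) \<xi>)
      * (1 + norm (row_apply (chol_factor S) \<xi>) + norm (row_apply (chol_factor K) \<xi>))
    \<le> (2 * k * (1 + k) * C1) * (1 + (norm \<xi>)\<^sup>2) * (\<Sum>i\<in>UNIV. \<Sum>j\<in>UNIV. \<bar>S $ i $ j - K $ i $ j\<bar>)" if S: "psd S" for S and \<xi> :: "real^'k^'r"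
  proof -
    define A where "A = chol_factor S" define A' where "A' = chol_factor K" define z where "z = norm \<xi>"
    have z: "z \<ge> 0" by (simp add: z_def)
    have 1: "norm (row_apply A \<xi> - row_apply A' \<xi>) \<le> norm (A - A') * z * k"
      using k(2)[of "A - A'" \<xi>] by (simp add: row.diff_left z_def)
    have "1 + norm (row_apply A \<xi>) + norm (row_apply A' \<xi>) \<le> 1 + norm A * z * k + norm A' * z * k"
      using k(2)[of A \<xi>] k(2)[of A' \<xi>] by (simp add: z_def)
    also have "\<dots> \<le> (1 + norm A + norm A') * ((1 + k) * (1 + z))"
    proof -
      have "(1 + norm A + norm A') * ((1 + k) * (1 + z)) - (1 + norm A * z * k + norm A' * z * k)
        = (k + z + k * z) + (norm A + norm A') * (1 + k + z)" by (simp add: algebra_simps)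
      moreover have "\<dots> \<ge> 0" using k(1) z by simp
      ultimately show ?thesis by linarith
    qed
    finally have 2: "1 + norm (row_apply A \<xi>) + norm (row_apply A' \<xi>) \<le> (1 + norm A + norm A') * ((1 + k) * (1 + z))" .
    have "norm (row_apply A \<xi> - row_apply A' \<xi>) * (1 + norm (row_apply A \<xi>) + norm (row_apply A' \<xi>))
      \<le> (norm (A - A') * z * k) * ((1 + norm A + norm A') * ((1 + k) * (1 + z)))"
      using 1 2 k(1) z by (intro mult_mono) auto
    also have "\<dots> = (norm (A - A') * (1 + norm A + norm A')) * (k * (1 + k)) * (z + z\<^sup>2)"
      by (simp add: power2_eq_square algebra_simps)
    also have "\<dots> \<le> (C1 * norm (S - K)) * (k * (1 + k)) * (2 * (1 + z\<^sup>2))"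
    proof (rule mult_mono)
      have "norm (A - A') * (1 + norm A + norm A') \<le> C1 * norm (S - K)" using calm S by (simp add: A_def A'_def)
      then show "norm (A - A') * (1 + norm A + norm A') * (k * (1 + k)) \<le> C1 * norm (S - K) * (k * (1 + k))"
        using k(1) by (intro mult_right_mono) auto
      show "z + z\<^sup>2 \<le> 2 * (1 + z\<^sup>2)"
        using zero_le_power2[of "z - 1"] z by (simp add: power2_eq_square algebra_simps)
    qed (use C1 k z in auto)
    also have "\<dots> = (2 * k * (1 + k) * C1) * (1 + z\<^sup>2) * norm (S - K)" by (simp add: algebra_simps)
    also have "\<dots> \<le> (2 * k * (1 + k) * C1) * (1 + z\<^sup>2) * (\<Sum>i\<in>UNIV. \<Sum>j\<in>UNIV. \<bar>S $ i $ j - K $ i $ j\<bar>)"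
      using norm_matrix_le_sum_abs[of "S - K"] C1 k(1) by (intro mult_left_mono) auto
    finally show ?thesis by (simp add: A_def A'_def z_def)
  qed
  then show ?thesis using C1 k(1) by (intro exI[of _ "2 * k * (1 + k) * C1"]) auto
qed

theorem theorem3p4:
  fixes L :: nat
    and \<phi> :: "nat \<Rightarrow> real \<Rightarrow> real"
    and sW sb :: "nat \<Rightarrow> real"
    and x :: "real^'k::finite^'n0::finite"
    and y :: "real^'k^'nL::finite"
    and a b :: real
  assumes "L \<ge> 2"
    and "\<phi> 1 = (\<lambda>t. t)"
    and "\<forall>l\<in>{2..L}. \<exists>C. C-lipschitz_on UNIV (\<phi> l)"
    and "\<forall>l\<in>{1..L-1}. sW l > 0 \<and> sb l > 0"
    and "pos_def (Kprime \<phi> sW sb L x)"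
    and "a > 1/2"
    and "\<exists>\<epsilon>. 0 < \<epsilon> \<and> \<epsilon> < 1 / onorm (\<lambda>v. Kprime \<phi> sW sb L x *v v)
             \<and> b > (1 + (\<epsilon> + 2) / (2 * \<epsilon> + 2)) * (norm y)\<^sup>2"
  shows "\<exists>c>0. \<forall>n :: nat \<Rightarrow> nat. (\<forall>l\<in>{1..L-1}. n l > 0) \<longrightarrow>
           W1 (posterior a b y (net_law \<phi> sW sb n L x :: real \<Rightarrow> (real^'k^'nL) measure))
              (posterior a b y (gp_law (Kprime \<phi> sW sb L x)))
           \<le> ennreal (c / sqrt (real (Min (n ` {1..L-1}))))"
proof -
  obtain \<epsilon> where \<epsilon>: "0 < \<epsilon>" "b > (1 + (\<epsilon> + 2) / (2 * \<epsilon> + 2)) * (norm y)\<^sup>2" using assms(7) by blast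
  have "0 \<le> (1 + (\<epsilon> + 2) / (2 * \<epsilon> + 2)) * (norm y)\<^sup>2" using \<epsilon>(1) by simp
  then have b: "b > 0" using \<epsilon>(2) by linarith
  \<comment> \<open>Unit variances in the last layer, the factor \<open>s\<close> being taken out;
    with them layer \<open>L\<close> meets the assumptions of the convergence theorem.\<close>
  define sW' where "sW' = sW(L := 1)"
  define sb' where "sb' = sb(L := 1)"
  define K where "K = Kprime \<phi> sW sb L x"
  have K: "pos_def K" "psd K" using assms(5) pos_def_imp_psd by (auto simp: K_def)
  have KL: "nngp \<phi> sW' sb' x L = K" unfolding K_def sW'_def sb'_def using Kprime_eq_nngp[OF assms(1)] by metis
  have lip: "\<exists>C. C-lipschitz_on UNIV (\<phi> l)" if "l \<in> {2..L}" for l using assms(3) that by blast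
  have var: "sW l > 0 \<and> sb l > 0" if "l \<in> {1..L}" "l \<noteq> L" for l using assms(4) that by auto
  have var': "sW' l > 0 \<and> sb' l > 0" if "l \<in> {1..L}" for l using var that by (auto simp: sW'_def sb'_def)
  have meas: "\<phi> l \<in> borel_measurable borel" if l: "l \<in> {1..L}" for l
  proof (cases "l = 1")
    case False
    then obtain C where "C-lipschitz_on UNIV (\<phi> l)" using lip[of l] l by force
    then show ?thesis by (rule lipschitz_measurable)
  qed (simp add: assms(2)[simplified])
  define sd where "sd n = (param_sd sW sb n L 1 :: ('n0, 'nL) param \<Rightarrow> real)" for n
  define MI where "MI n = PiM (params_upto n L (L - 1)) (\<lambda>p :: ('n0, 'nL) param. normal_measure (sd n p))" for n
  define Kh where "Kh n \<eta> = emp_kernel \<phi> sW' sb' n L x L \<eta>" for n and \<eta> :: "('n0, 'nL) param \<Rightarrow> real"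
  have psdKh: "psd (Kh n \<eta>)" for n \<eta> unfolding Kh_def by (rule psd_emp_kernel) (auto simp: sW'_def sb'_def)
  have "pvar sW' sb' n L s p = pvar sW sb n L s p" for n s and p :: "('n0, 'nL) param"
    by (cases p) (auto simp: sW'_def sb'_def)
  then have sd': "param_sd sW' sb' n L 1 p = sd n p" for n and p :: "('n0, 'nL) param" by (simp add: sd_def)
  have "\<exists>c\<ge>0. \<forall>n. (\<forall>l\<in>{1..L-1}. n l > 0) \<longrightarrow> (\<forall>i j.
     (\<integral>\<^sup>+\<eta>. \<bar>emp_kernel \<phi> sW' sb' n L x L \<eta> $ i $ j - nngp \<phi> sW' sb' x L $ i $ j\<bar>
        \<partial>PiM (params_upto n L (L - 1)) (\<lambda>p :: ('n0, 'nL) param. normal_measure (param_sd sW' sb' n L 1 p)))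
      \<le> ennreal (c / sqrt (real (Min (n ` {1..L-1})))))"
    by (rule emp_kernel_convergence) (use assms(1,2) lip var' in auto)
  then obtain c0 where c0: "c0 \<ge> 0" and conv0: "\<forall>n. (\<forall>l\<in>{1..L-1}. n l > 0) \<longrightarrow> (\<forall>i j.
     (\<integral>\<^sup>+\<eta>. \<bar>Kh n \<eta> $ i $ j - K $ i $ j\<bar> \<partial>MI n) \<le> ennreal (c0 / sqrt (real (Min (n ` {1..L-1})))))"
    unfolding KL sd' Kh_def[symmetric] MI_def[symmetric] by (elim exE conjE) (rule that)
  obtain C1 where C1: "C1 \<ge> 0" and tr: "\<forall>S (\<xi> :: real^'k^'nL). psd S \<longrightarrow>
    norm (row_apply (chol_factor S) \<xi> - row_apply (chol_factor K) \<xi>)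
      * (1 + norm (row_apply (chol_factor S) \<xi>) + norm (row_apply (chol_factor K) \<xi>))
    \<le> C1 * (1 + (norm \<xi>)\<^sup>2) * (\<Sum>i\<in>UNIV. \<Sum>j\<in>UNIV. \<bar>S $ i $ j - K $ i $ j\<bar>)"
    using row_apply_transport_bound[OF K(1)] by (elim exE conjE) (rule that)
  let ?G = "std_gauss :: (real^'k^'nL) measure"
  interpret G: prob_space ?G by (rule prob_space_std_gauss)
  define M2 where "M2 = 1 + real DIM(real^'k^'nL)"
  have M2: "(\<integral>\<^sup>+\<xi>. ennreal (1 + (norm \<xi>)\<^sup>2) \<partial>?G) = ennreal M2" "M2 \<ge> 0"
    by (simp_all add: M2_def nn_integral_add std_gauss_second_moment G.emeasure_space_1)
  define X where "X n z = row_apply (chol_factor (Kh n (fst z))) (snd z)" for n and z :: "(('n0, 'nL) param \<Rightarrow> real) \<times> (real^'k^'nL)"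
  define X' where "X' z = row_apply (chol_factor K) (snd z)" for z :: "(('n0, 'nL) param \<Rightarrow> real) \<times> (real^'k^'nL)"
  define q where "q = real CARD('k) * real CARD('k)"
  define c2 where "c2 = C1 * M2 * (q * c0)"
  have c2: "c2 \<ge> 0" using C1 M2(2) c0 by (simp add: c2_def q_def)
  obtain k where k: "k > 0" "\<And>A (\<xi> :: real^'k^'nL). norm (row_apply A \<xi>) \<le> norm A * norm \<xi> * k"
    using bounded_bilinear.pos_bounded[OF bounded_bilinear_row_apply] by blast
  \<comment> \<open>First-moment bound for the limit variable; \<open>norm \<xi>\<close> is
    estimated by \<open>1 + (norm \<xi>)\<^sup>2\<close> so that \<open>M2\<close> can be
    reused.\<close>
  define B0 where "B0 = norm (chol_factor K) * k * M2"
  have B0: "B0 \<ge> 0" using k(1) M2(2) by (simp add: B0_def)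
  have main: "prob_space (MI n)" "X n \<in> borel_measurable (MI n \<Otimes>\<^sub>M ?G)" "X' \<in> borel_measurable (MI n \<Otimes>\<^sub>M ?G)"
    "(\<integral>\<^sup>+z. norm (X n z - X' z) * (1 + norm (X n z) + norm (X' z)) \<partial>(MI n \<Otimes>\<^sub>M ?G)) \<le> ennreal (c2 / sqrt (real (Min (n ` {1..L-1}))))"
    "(\<integral>\<^sup>+z. norm (X' z) \<partial>(MI n \<Otimes>\<^sub>M ?G)) \<le> ennreal B0"
    "real (Min (n ` {1..L-1})) \<ge> 1"
    if n: "\<forall>l\<in>{1..L-1}. n l > 0" for n
  proof -
    let ?N = "real (Min (n ` {1..L-1}))"
    have "Min (n ` {1..L-1}) \<in> n ` {1..L-1}" using assms(1) by (intro Min_in) auto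
    then show N1: "?N \<ge> 1" using n by (auto simp: Suc_le_eq)
    show pM: "prob_space (MI n)"
      unfolding MI_def
    proof (rule prob_space_PiM_normal)
      fix p :: "('n0, 'nL) param" assume "p \<in> params_upto n L (L - 1)"
      then obtain l where l: "l \<in> {1..L-1}" "p \<in> layer_params n L l" unfolding params_upto_def by blast
      then have lL: "l \<in> {1..L}" "l \<noteq> L" using assms(1) by auto
      show "sd n p > 0" unfolding sd_def by (rule param_sd_pos[OF l(2)]) (use var[OF lL] in auto)
    qed
    interpret MI: prob_space "MI n" by (rule pM)
    have sMI: "sets (MI n) = sets (PiM (params_upto n L (L - 1)) (\<lambda>_. borel))" unfolding MI_def by (intro sets_PiM_cong) auto
    have [measurable]: "Kh n \<in> borel_measurable (MI n)"
      using measurable_emp_kernel[where m=L and l=L and n=n and L=L and J="params_upto n L (L - 1)" and x=x and \<phi>=\<phi> and sW=sW' and sb=sb', OF meas]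
        assms(1) unfolding measurable_cong_sets[OF sMI refl] Kh_def[abs_def] by simp
    show X[measurable]: "X n \<in> borel_measurable (MI n \<Otimes>\<^sub>M ?G)" "X' \<in> borel_measurable (MI n \<Otimes>\<^sub>M ?G)"
      unfolding X_def[abs_def] X'_def[abs_def] by measurable
    define d where "d \<eta> = (\<Sum>i\<in>UNIV. \<Sum>j\<in>UNIV. \<bar>Kh n \<eta> $ i $ j - K $ i $ j\<bar>)" for \<eta>
    have d0: "d \<eta> \<ge> 0" for \<eta> by (simp add: d_def sum_nonneg)
    have [measurable]: "d \<in> borel_measurable (MI n)" unfolding d_def[abs_def] by measurable
    have "(\<integral>\<^sup>+\<eta>. d \<eta> \<partial>MI n) = (\<Sum>i\<in>UNIV. \<Sum>j\<in>UNIV. \<integral>\<^sup>+\<eta>. \<bar>Kh n \<eta> $ i $ j - K $ i $ j\<bar> \<partial>MI n)"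
      by (simp add: d_def nn_integral_sum sum_nonneg flip: sum_ennreal)
    also have "\<dots> \<le> (\<Sum>i\<in>(UNIV :: 'k set). \<Sum>j\<in>(UNIV :: 'k set). ennreal (c0 / sqrt ?N))"
      using conv0[rule_format, OF n[rule_format]] by (intro sum_mono) auto
    also have "\<dots> = ennreal (q * c0 / sqrt ?N)"
      using c0 N1 by (simp add: q_def ennreal_mult'[symmetric] ennreal_of_nat_eq_real_of_nat mult.assoc)
    finally have d: "(\<integral>\<^sup>+\<eta>. d \<eta> \<partial>MI n) \<le> ennreal (q * c0 / sqrt ?N)" .
    have "(\<integral>\<^sup>+z. norm (X n z - X' z) * (1 + norm (X n z) + norm (X' z)) \<partial>(MI n \<Otimes>\<^sub>M ?G))
       \<le> (\<integral>\<^sup>+z. (ennreal C1 * ennreal (1 + (norm (snd z))\<^sup>2)) * ennreal (d (fst z)) \<partial>(MI n \<Otimes>\<^sub>M ?G))"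
    proof (rule nn_integral_mono)
      fix z
      have "norm (X n z - X' z) * (1 + norm (X n z) + norm (X' z)) \<le> C1 * (1 + (norm (snd z))\<^sup>2) * d (fst z)"
        unfolding X_def X'_def d_def using tr psdKh by blast
      then show "ennreal (norm (X n z - X' z) * (1 + norm (X n z) + norm (X' z))) \<le> (ennreal C1 * ennreal (1 + (norm (snd z))\<^sup>2)) * ennreal (d (fst z))"
        using C1 d0 by (simp only: ennreal_mult'[symmetric] ennreal_mult''[symmetric] ennreal_leI)
    qed
    also have "\<dots> = (\<integral>\<^sup>+\<eta>. \<integral>\<^sup>+\<xi>. (ennreal C1 * ennreal (1 + (norm \<xi>)\<^sup>2)) * ennreal (d \<eta>) \<partial>?G \<partial>MI n)"
      by (subst G.nn_integral_fst[symmetric]) auto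
    also have "\<dots> = (\<integral>\<^sup>+\<eta>. (ennreal C1 * ennreal M2) * ennreal (d \<eta>) \<partial>MI n)"
      by (simp only: M2(1)[symmetric]) (intro nn_integral_cong, subst nn_integral_multc, simp, subst nn_integral_cmult, simp_all)
    also have "\<dots> = ennreal C1 * ennreal M2 * (\<integral>\<^sup>+\<eta>. d \<eta> \<partial>MI n)" by (rule nn_integral_cmult) measurable
    also have "\<dots> \<le> ennreal C1 * ennreal M2 * ennreal (q * c0 / sqrt ?N)" by (rule mult_left_mono[OF d]) simp
    also have "\<dots> = ennreal (c2 / sqrt ?N)"
      using C1 M2(2) c0 by (simp add: c2_def q_def ennreal_mult'[symmetric])
    finally show "(\<integral>\<^sup>+z. norm (X n z - X' z) * (1 + norm (X n z) + norm (X' z)) \<partial>(MI n \<Otimes>\<^sub>M ?G)) \<le> ennreal (c2 / sqrt ?N)" .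
    have "(\<integral>\<^sup>+z. norm (X' z) \<partial>(MI n \<Otimes>\<^sub>M ?G)) \<le> (\<integral>\<^sup>+z. ennreal (norm (chol_factor K) * k) * ennreal (1 + (norm (snd z))\<^sup>2) \<partial>(MI n \<Otimes>\<^sub>M ?G))"
    proof (rule nn_integral_mono)
      fix z :: "(('n0, 'nL) param \<Rightarrow> real) \<times> (real^'k^'nL)"
      have "norm (X' z) \<le> norm (chol_factor K) * k * norm (snd z)" using k(2)[of "chol_factor K" "snd z"] by (simp add: X'_def mult_ac)
      also have "\<dots> \<le> norm (chol_factor K) * k * (1 + (norm (snd z))\<^sup>2)"
      proof (rule mult_left_mono)
        have "2 * norm (snd z) \<le> 1 + (norm (snd z))\<^sup>2" using zero_le_power2[of "norm (snd z) - 1"] by (simp add: power2_eq_square algebra_simps)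
        then show "norm (snd z) \<le> 1 + (norm (snd z))\<^sup>2" using norm_ge_zero[of "snd z"] by linarith
      qed (use k(1) in simp)
      finally show "ennreal (norm (X' z)) \<le> ennreal (norm (chol_factor K) * k) * ennreal (1 + (norm (snd z))\<^sup>2)"
        using k(1) by (simp only: ennreal_mult''[symmetric] ennreal_leI zero_le_power2 add_nonneg_nonneg zero_le_one)
    qed
    also have "\<dots> = (\<integral>\<^sup>+\<eta>. \<integral>\<^sup>+\<xi>. ennreal (norm (chol_factor K) * k) * ennreal (1 + (norm \<xi>)\<^sup>2) \<partial>?G \<partial>MI n)"
      by (subst G.nn_integral_fst[symmetric]) auto
    also have "\<dots> = (\<integral>\<^sup>+\<eta>. ennreal (norm (chol_factor K) * k) * ennreal M2 \<partial>MI n)"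
      by (simp only: M2(1)[symmetric]) (intro nn_integral_cong nn_integral_cmult, simp)
    also have "\<dots> = ennreal B0" using k(1) M2(2) by (simp add: MI.emeasure_space_1 B0_def ennreal_mult'[symmetric])
    finally show "(\<integral>\<^sup>+z. norm (X' z) \<partial>(MI n \<Otimes>\<^sub>M ?G)) \<le> ennreal B0" .
  qed
  \<comment> \<open>The norm of the network variable exceeds that of the limit variable by at most
    the weighted distance, whose mean is at most \<open>c2\<close> because the minimal width is at
    least 1.\<close>
  define B where "B = B0 + c2 + 1"
  have B: "B > 0" using B0 c2 by (simp add: B_def)
  \<comment> \<open>Hidden neurons are indexed by naturals, so the sample type is the same for all
    widths and \<open>C\<close> can be fixed before \<open>n\<close>; only the measure
    varies.\<close>
  obtain C where C: "C \<ge> 0" and bound: "\<forall>(\<Omega> :: ((('n0, 'nL) param \<Rightarrow> real) \<times> (real^'k^'nL)) measure) (X :: _ \<Rightarrow> real^'k^'nL) X' \<mu> \<mu>'.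
     prob_space \<Omega> \<longrightarrow> X \<in> borel_measurable \<Omega> \<longrightarrow> X' \<in> borel_measurable \<Omega> \<longrightarrow>
     (\<forall>s>0. \<mu> s = distr \<Omega> borel (\<lambda>\<omega>. sqrt s *\<^sub>R X \<omega>)) \<longrightarrow> (\<forall>s>0. \<mu>' s = distr \<Omega> borel (\<lambda>\<omega>. sqrt s *\<^sub>R X' \<omega>)) \<longrightarrow>
     (\<integral>\<^sup>+\<omega>. norm (X \<omega>) \<partial>\<Omega>) \<le> ennreal B \<longrightarrow> (\<integral>\<^sup>+\<omega>. norm (X' \<omega>) \<partial>\<Omega>) \<le> ennreal B \<longrightarrow>
     W1 (posterior a b y \<mu>) (posterior a b y \<mu>')
       \<le> ennreal C * (\<integral>\<^sup>+\<omega>. norm (X \<omega> - X' \<omega>) * (1 + norm (X \<omega>) + norm (X' \<omega>)) \<partial>\<Omega>)"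
    using posterior_W1_bound[OF assms(6) b B, of y] by (elim exE conjE) (rule that)
  show ?thesis
  \<comment> \<open>The summand 1 makes the constant strictly positive even if \<open>C\<close> or
    \<open>c2\<close> is 0.\<close>
  proof (intro exI[of _ "C * c2 + 1"] conjI allI impI)
    show "0 < C * c2 + 1" using C c2 by (simp add: add_nonneg_pos)
    fix n :: "nat \<Rightarrow> nat" assume n: "\<forall>l\<in>{1..L-1}. n l > 0"
    let ?N = "real (Min (n ` {1..L-1}))"
    let ?\<Omega> = "MI n \<Otimes>\<^sub>M ?G"
    note m = main[OF n]
    interpret MI: prob_space "MI n" by (rule m(1))
    interpret \<Omega>: pair_prob_space "MI n" ?G ..
    note [measurable] = m(2,3)
    have D: "c2 / sqrt ?N \<le> c2" using c2 m(6) by (simp add: divide_le_eq mult_le_cancel_left1)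
    have "(\<integral>\<^sup>+z. norm (X n z) \<partial>?\<Omega>) \<le> (\<integral>\<^sup>+z. ennreal (norm (X' z)) + ennreal (norm (X n z - X' z) * (1 + norm (X n z) + norm (X' z))) \<partial>?\<Omega>)"
    proof (rule nn_integral_mono)
      fix z
      have "norm (X n z) \<le> norm (X' z) + norm (X n z - X' z) * 1" by (simp add: norm_triangle_sub)
      also have "\<dots> \<le> norm (X' z) + norm (X n z - X' z) * (1 + norm (X n z) + norm (X' z))"
        by (intro add_left_mono mult_left_mono) auto
      finally have "ennreal (norm (X n z)) \<le> ennreal (norm (X' z) + norm (X n z - X' z) * (1 + norm (X n z) + norm (X' z)))"
        by (rule ennreal_leI)
      then show "ennreal (norm (X n z)) \<le> ennreal (norm (X' z)) + ennreal (norm (X n z - X' z) * (1 + norm (X n z) + norm (X' z)))"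
        by (simp only: ennreal_plus norm_ge_zero mult_nonneg_nonneg add_nonneg_nonneg zero_le_one)
    qed
    also have "\<dots> = (\<integral>\<^sup>+z. norm (X' z) \<partial>?\<Omega>) + (\<integral>\<^sup>+z. norm (X n z - X' z) * (1 + norm (X n z) + norm (X' z)) \<partial>?\<Omega>)"
      by (rule nn_integral_add) measurable
    also have "\<dots> \<le> ennreal B0 + ennreal c2"
      using D by (intro add_mono m(5) order_trans[OF m(4)] ennreal_leI)
    also have "\<dots> \<le> ennreal B" using B0 c2 by (simp add: B_def ennreal_plus[symmetric] ennreal_leI del: ennreal_plus)
    finally have XB: "(\<integral>\<^sup>+z. norm (X n z) \<partial>?\<Omega>) \<le> ennreal B" .
    have XB': "(\<integral>\<^sup>+z. norm (X' z) \<partial>?\<Omega>) \<le> ennreal B"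
      by (rule order_trans[OF m(5)]) (use B0 c2 in \<open>simp add: B_def ennreal_leI\<close>)
    have net: "\<forall>s>0. (net_law \<phi> sW sb n L x s :: (real^'k^'nL) measure) = distr ?\<Omega> borel (\<lambda>z. sqrt s *\<^sub>R X n z)"
    proof (intro allI impI)
      fix s :: real assume s: "s > 0"
      show "(net_law \<phi> sW sb n L x s :: (real^'k^'nL) measure) = distr ?\<Omega> borel (\<lambda>z. sqrt s *\<^sub>R X n z)"
        by (subst net_law_representation[OF meas _ var s])
           (use assms(1) in \<open>auto simp: X_def MI_def sd_def Kh_def sW'_def sb'_def case_prod_beta'\<close>)
    qed
    have gp: "\<forall>s>0. (gp_law K s :: (real^'k^'nL) measure) = distr ?\<Omega> borel (\<lambda>z. sqrt s *\<^sub>R X' z)"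
      by (intro allI impI, subst gp_law_representation[OF m(1) K(2)]) (simp_all add: X'_def case_prod_beta')
    have "W1 (posterior a b y (net_law \<phi> sW sb n L x)) (posterior a b y (gp_law K))
       \<le> ennreal C * (\<integral>\<^sup>+z. norm (X n z - X' z) * (1 + norm (X n z) + norm (X' z)) \<partial>?\<Omega>)"
      using bound \<Omega>.P.prob_space_axioms m(2,3) net gp XB XB' by blast
    also have "\<dots> \<le> ennreal C * ennreal (c2 / sqrt ?N)" by (rule mult_left_mono[OF m(4)]) simp
    also have "\<dots> = ennreal (C * c2 / sqrt ?N)" using C by (simp add: ennreal_mult'[symmetric])
    also have "\<dots> \<le> ennreal ((C * c2 + 1) / sqrt ?N)" using m(6) by (intro ennreal_leI divide_right_mono) auto
    finally show "W1 (posterior a b y (net_law \<phi> sW sb n L x)) (posterior a b y (gp_law (Kprime \<phi> sW sb L x)))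
       \<le> ennreal ((C * c2 + 1) / sqrt ?N)" unfolding K_def .
  qed
qed

end
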